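(* Let $G$ be a finite non-abelian group of order coprime with $6$. Then $\mathbb{Z}G$ has a bicyclic unit $\beta$ and a Bass cyclic unit $u$ such that $(u,\beta^t)$ is a free pair for every sufficiently large positive integer $t$.
   Context: $\mathbb{Z}G$ is the integral group ring of $G$. The bicyclic units of $\mathbb{Z}G$ are the elements of one of the forms $1+(1-h)x(1+h+h^2+\cdots+h^{d-1})$ or $1+(1+h+h^2+\cdots+h^{d-1})x(1-h)$, where $x,h\in G$ and $h$ has order $d$. The Bass cyclic units of $\mathbb{Z}G$ are the elements of the form $u_{k,m}(x)=(1+x+x^2+\cdots+x^{k-1})^m+\frac{1-k^m}{d}(1+x+x^2+\cdots+x^{d-1})$, where $x\in G$ has order $d$ and $k,m$ are positive integers with $\gcd(k,d)=1$ and $\phi(d)\mid m$ ($\phi$ is the Euler function). A pair $(g,h)$ of elements of a group is a free pair if $\langle g,h\rangle$ is a non-abelian free group (free on the two generators $g,h$). *)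

theory Defs
  imports "HOL-Algebra.Algebra" "HOL-Number_Theory.Residues"
begin

(* An element of the integral group ring is a finitely supported coefficient function that
   vanishes off the carrier of G, so equality of elements is equality of functions. *)
definition group_ring :: "('a, 'b) monoid_scheme \<Rightarrow> ('a \<Rightarrow> int) ring" where
  "group_ring G =
     \<lparr> carrier = {a. finite {x. a x \<noteq> 0} \<and> {x. a x \<noteq> 0} \<subseteq> carrier G},
       monoid.mult = (\<lambda>a b x. \<Sum>y | a y \<noteq> 0. \<Sum>z | b z \<noteq> 0.
                 if y \<otimes>\<^bsub>G\<^esub> z = x then a y * b z else 0),
       one = (\<lambda>x. if x = \<one>\<^bsub>G\<^esub> then 1 else 0),
       ring.zero = (\<lambda>x. 0),
       ring.add = (\<lambda>a b x. a x + b x) \<rparr>"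

definition gr_embed :: "'a \<Rightarrow> ('a \<Rightarrow> int)" where
  "gr_embed g = (\<lambda>x. if x = g then 1 else 0)"

(* 1 + g + ... + g^(n-1) *)
definition gr_geom :: "('a, 'b) monoid_scheme \<Rightarrow> 'a \<Rightarrow> nat \<Rightarrow> ('a \<Rightarrow> int)" where
  "gr_geom G g n = (\<Oplus>\<^bsub>group_ring G\<^esub>i\<in>{..<n}. gr_embed (g [^]\<^bsub>G\<^esub> i))"

(* group.ord is 0 on elements of infinite order, which the condition on ord excludes. *)
definition bicyclic_units :: "('a, 'b) monoid_scheme \<Rightarrow> ('a \<Rightarrow> int) set" where
  "bicyclic_units G =
     {\<one>\<^bsub>group_ring G\<^esub> \<oplus>\<^bsub>group_ring G\<^esub>
        ((\<one>\<^bsub>group_ring G\<^esub> \<ominus>\<^bsub>group_ring G\<^esub> gr_embed h)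
           \<otimes>\<^bsub>group_ring G\<^esub> gr_embed x \<otimes>\<^bsub>group_ring G\<^esub> gr_geom G h (group.ord G h))
      | x h. x \<in> carrier G \<and> h \<in> carrier G \<and> 0 < group.ord G h}
   \<union> {\<one>\<^bsub>group_ring G\<^esub> \<oplus>\<^bsub>group_ring G\<^esub>
        (gr_geom G h (group.ord G h) \<otimes>\<^bsub>group_ring G\<^esub> gr_embed x
           \<otimes>\<^bsub>group_ring G\<^esub> (\<one>\<^bsub>group_ring G\<^esub> \<ominus>\<^bsub>group_ring G\<^esub> gr_embed h))
      | x h. x \<in> carrier G \<and> h \<in> carrier G \<and> 0 < group.ord G h}"

(* The coefficient (1 - k^m) / d of a Bass cyclic unit is an integer, so div is exact there. *)
lemma bass_coefficient_exact:
  fixes k m d :: nat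
  assumes "coprime k d" and "totient d dvd m"
  shows "int d dvd 1 - int k ^ m"
proof -
  obtain c where c: "m = totient d * c" using assms(2) by blast
  have "[k ^ totient d = 1] (mod d)" using assms(1) by (rule euler_theorem)
  then have "[(k ^ totient d) ^ c = 1 ^ c] (mod d)" by (rule cong_pow)
  then have "[k ^ m = 1] (mod d)" by (simp add: c power_mult)
  then have "[int (k ^ m) = int 1] (mod int d)" by (simp only: cong_int_iff)
  then show ?thesis by (simp add: cong_iff_dvd_diff dvd_diff_commute)
qed

definition bass_unit :: "('a, 'b) monoid_scheme \<Rightarrow> nat \<Rightarrow> nat \<Rightarrow> 'a \<Rightarrow> ('a \<Rightarrow> int)" where
  "bass_unit G k m x =
     (gr_geom G x k [^]\<^bsub>group_ring G\<^esub> m) \<oplus>\<^bsub>group_ring G\<^esub>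
     add_pow (group_ring G) ((1 - int k ^ m) div int (group.ord G x)) (gr_geom G x (group.ord G x))"

definition bass_cyclic_units :: "('a, 'b) monoid_scheme \<Rightarrow> ('a \<Rightarrow> int) set" where
  "bass_cyclic_units G =
     {bass_unit G k m x | k m x. x \<in> carrier G \<and> 0 < group.ord G x \<and> 0 < k \<and> 0 < m
        \<and> coprime k (group.ord G x) \<and> totient (group.ord G x) dvd m}"

(* A word is a list of letters (s, e), standing for s if e holds and for the inverse of s
   otherwise; it is reduced if no letter stands next to its inverse. *)
definition reduced_words :: "'a set \<Rightarrow> ('a \<times> bool) list set" where
  "reduced_words S =
     {w \<in> lists (S \<times> UNIV). successively (\<lambda>(s, e) (t, f). s = t \<longrightarrow> e = f) w}"

definition word_value :: "('a, 'b) monoid_scheme \<Rightarrow> ('a \<times> bool) list \<Rightarrow> 'a" where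
  "word_value G w =
     foldr (\<lambda>(s, e) a. (if e then s else inv\<^bsub>G\<^esub> s) \<otimes>\<^bsub>G\<^esub> a) w \<one>\<^bsub>G\<^esub>"

(* Every element of G is the value of exactly one reduced word over S. *)
definition free_group_on :: "('a, 'b) monoid_scheme \<Rightarrow> 'a set \<Rightarrow> bool" where
  "free_group_on G S \<longleftrightarrow>
     group G \<and> S \<subseteq> carrier G \<and> bij_betw (word_value G) (reduced_words S) (carrier G)"

(* A free group on two distinct generators has rank 2, hence is non-abelian. *)
definition free_pair :: "('a, 'b) monoid_scheme \<Rightarrow> 'a \<Rightarrow> 'a \<Rightarrow> bool" where
  "free_pair G g h \<longleftrightarrow>
     g \<in> carrier G \<and> h \<in> carrier G \<and> g \<noteq> h \<and>
     free_group_on (subgroup_generated G {g, h}) {g, h}"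

end

theory Submission
  imports "HOL-Analysis.Kronecker_Approximation_Theorem" "HOL-Computational_Algebra.Polynomial" Defs
begin

text \<open>
The units act on a monomial representation in which the Bass cyclic unit is a diagonal matrix with
positive real entries and the bicyclic unit is a transvection, and a ping-pong argument shows that
they generate a free group.

Let \<open>A\<close> be an abelian subgroup of \<open>G\<close>, let \<open>b\<close> normalize \<open>A\<close> with \<open>b^q\<close> in \<open>A\<close> for a prime \<open>q\<close>,
and let \<open>chi\<close> be a character of \<open>A\<close> that is trivial at \<open>b^q\<close> and not invariant under \<open>b\<close>. For an
element \<open>\<alpha>\<close> of the integral group ring, the sums \<open>coord \<alpha> i\<close> of \<open>\<alpha>(b^i a) chi(a)\<close> over \<open>a\<close> in \<open>A\<close> have
period \<open>q\<close> in \<open>i\<close>, so they are the coordinates of a vector in a \<open>q\<close>-dimensional space. Left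
multiplication by \<open>b^k\<close> shifts the coordinates by \<open>k\<close>, and left multiplication by an element \<open>y\<close> of \<open>A\<close>
multiplies coordinate \<open>i\<close> by the conjugate character \<open>conj_chi y i\<close>. Hence, for \<open>g\<close> in \<open>A\<close>, the Bass
cyclic unit \<open>u\<close> of \<open>g\<close> with \<open>k = 2\<close> is diagonal; with a suitable exponent its entries are powers
of the positive numbers \<open>bass_rate (conj_chi g i)\<close> (\<open>coord_bass_unit\<close>). The bicyclic unit \<open>\<beta>\<close> made from
\<open>h = b^k\<close> and \<open>x = g\<close> adds to a vector a fixed multiple of its coordinate sum times the vector \<open>v\<close>
with entries \<open>conj_chi g i - conj_chi g (i - k)\<close>, whose coordinate sum is 0 (\<open>coord_bicyclic\<close>).

Consider the cone of the vectors whose coordinate sum is not small compared with their norm. For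
large \<open>t\<close>, every nontrivial power of \<open>\<beta>^t\<close> moves the cone close to the line of \<open>v\<close>, outside the cone.
Every nontrivial power of \<open>u\<close> moves the vectors close to that line back into the cone, provided that
the coordinate sum of \<open>u^n v\<close> is bounded below by a multiple of the norm of \<open>u^n\<close> for all nonzero
\<open>n\<close>. So no reduced word acts trivially (\<open>shear_ping_pong.free_pair_shear\<close>).

Powers of a Bass cyclic unit are Bass cyclic units, so that only the behaviour for large \<open>n\<close>
matters, and there the indices with the largest (for negative \<open>n\<close>, the smallest) rate dominate:
the sums of \<open>v\<close> over these two sets of indices have to be nonzero. For the smallest rate this holds for
every \<open>k\<close> prime to \<open>q\<close>, because all summands have real parts of the same sign; here the order of \<open>G\<close>
being prime to 6 enters, as it makes 1 the only eigenvalue of rate 1. For the largest rate a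
good \<open>k\<close> exists because a circulant matrix of prime size whose symbol is the indicator of a
nonempty proper set is invertible (\<open>shifted_sums_distinguish\<close>, \<open>extremal_shift_sums\<close>).

It remains to find \<open>A\<close>, \<open>b\<close> and \<open>chi\<close>. A counting argument in a minimal nonabelian subgroup
gives an abelian subgroup with a noncentralizing normalizer, and a choice of elements of minimal
order gives commutators outside the group generated by \<open>b^q\<close> (\<open>inducing_exists\<close>); then
characters separate them from that group (\<open>character_separates\<close>).
\<close>

section \<open>Reduced words and freeness\<close>

lemma word_value_Nil [simp]: "word_value G [] = \<one>\<^bsub>G\<^esub>"
  by (simp add: word_value_def)

lemma word_value_Cons [simp]:
  "word_value G (l # w) = (if snd l then fst l else inv\<^bsub>G\<^esub> fst l) \<otimes>\<^bsub>G\<^esub> word_value G w"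
  by (simp add: word_value_def case_prod_beta)

lemma reduced_words_Nil [simp]: "[] \<in> reduced_words S"
  by (simp add: reduced_words_def)

lemma reduced_words_Cons:
  "l # w \<in> reduced_words S \<longleftrightarrow>
     fst l \<in> S \<and> w \<in> reduced_words S \<and> (w \<noteq> [] \<longrightarrow> fst l = fst (hd w) \<longrightarrow> snd l = snd (hd w))"
  by (cases w) (auto simp: reduced_words_def case_prod_beta mem_Times_iff)

definition inverse_word :: "('a \<times> bool) list \<Rightarrow> ('a \<times> bool) list" where
  "inverse_word w = rev (map (\<lambda>(s, e). (s, \<not> e)) w)"

lemma inverse_word_reduced:
  assumes "w \<in> reduced_words S"
  shows "inverse_word w \<in> reduced_words S"
  using assms
  by (auto simp: inverse_word_def reduced_words_def successively_rev successively_map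
      case_prod_beta mem_Times_iff eq_commute elim!: successively_mono)

context group
begin

lemma word_value_closed:
  "w \<in> reduced_words S \<Longrightarrow> S \<subseteq> carrier G \<Longrightarrow> word_value G w \<in> carrier G"
  by (induction w) (auto simp: reduced_words_Cons)

lemma word_value_append:
  assumes "set v \<subseteq> carrier G \<times> UNIV" "set w \<subseteq> carrier G \<times> UNIV"
  shows "word_value G (v @ w) = word_value G v \<otimes> word_value G w \<and> word_value G w \<in> carrier G
     \<and> word_value G v \<in> carrier G"
proof -
  have cl: "set w \<subseteq> carrier G \<times> UNIV \<Longrightarrow> word_value G w \<in> carrier G" for w
    by (induction w) auto
  show ?thesis
    using assms by (induction v) (auto simp: m_assoc cl)
qed

lemma word_value_inverse_word:
  assumes "set w \<subseteq> carrier G \<times> UNIV"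
  shows "word_value G (inverse_word w) = inv (word_value G w)"
  using assms
proof (induction w)
  case Nil
  then show ?case by (simp add: inverse_word_def)
next
  case (Cons l w)
  have s: "set (inverse_word w) \<subseteq> carrier G \<times> UNIV"
    using Cons.prems by (auto simp: inverse_word_def)
  have "inverse_word (l # w) = inverse_word w @ [(fst l, \<not> snd l)]"
    by (simp add: inverse_word_def case_prod_beta)
  moreover have "word_value G w \<in> carrier G" using word_value_append[of "[]" w] Cons.prems by simp
  ultimately show ?case
    using Cons word_value_append[OF s, of "[(fst l, \<not> snd l)]"]
    by (cases l) (auto simp: inv_mult_group)
qed

text \<open>Prepending a letter to a reduced word either leaves it reduced or cancels its first letter, so the values of the reduced words are closed under multiplication by the generators and their inverses.\<close>

lemma generate_subset_reduced_values:
  assumes S: "S \<subseteq> carrier G"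
  shows "generate G S \<subseteq> word_value G ` reduced_words S"
proof
  let ?V = "word_value G ` reduced_words S"
  have letter: "(if e then s else inv s) \<otimes> y \<in> ?V" if "s \<in> S" "y \<in> ?V" for s e y
  proof -
    obtain w where w: "w \<in> reduced_words S" "y = word_value G w" using \<open>y \<in> ?V\<close> by blast
    show ?thesis
    proof (cases "w \<noteq> [] \<and> hd w = (s, \<not> e)")
      case True
      then obtain w' where w': "w = (s, \<not> e) # w'" by (cases w) auto
      have "w' \<in> reduced_words S" using w w' by (simp add: reduced_words_Cons)
      moreover have "(if e then s else inv s) \<otimes> y = word_value G w'"
        using w w' S \<open>s \<in> S\<close> word_value_closed[OF calculation S]
        by (auto simp: m_assoc[symmetric])
      ultimately show ?thesis by blast
    next
      case False
      then have "(s, e) # w \<in> reduced_words S"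
        using w \<open>s \<in> S\<close> by (auto simp: reduced_words_Cons prod_eq_iff)
      moreover have "(if e then s else inv s) \<otimes> y = word_value G ((s, e) # w)"
        using w by simp
      ultimately show ?thesis by blast
    qed
  qed
  fix x assume x: "x \<in> generate G S"
  have Vc: "?V \<subseteq> carrier G" using word_value_closed[OF _ S] by blast
  from x have "\<forall>y\<in>?V. x \<otimes> y \<in> ?V"
  proof (induction rule: generate.induct)
    case one
    then show ?case using Vc by auto
  next
    case (incl h)
    then show ?case using letter[of h _ True] by simp
  next
    case (inv h)
    then show ?case using letter[of h _ False] by simp
  next
    case (eng h1 h2)
    have "h1 \<in> carrier G" "h2 \<in> carrier G" using eng.hyps generate_in_carrier[OF S] by auto
    then show ?case using eng.IH Vc by (metis m_assoc subsetD)
  qed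
  moreover have "\<one> \<in> ?V" by (rule image_eqI[of _ _ "[]"]) auto
  moreover have "x \<in> carrier G" using x generate_in_carrier[OF S] by auto
  ultimately show "x \<in> ?V" by (metis r_one)
qed

text \<open>Once a common prefix is cancelled, the first letters differ, and then the inverse of one word followed by the other is reduced; its value would be trivial.\<close>

lemma reduced_words_value_inj:
  assumes S: "S \<subseteq> carrier G"
    and nt: "\<And>w. w \<in> reduced_words S \<Longrightarrow> w \<noteq> [] \<Longrightarrow> word_value G w \<noteq> \<one>"
  shows "v \<in> reduced_words S \<Longrightarrow> w \<in> reduced_words S \<Longrightarrow> word_value G v = word_value G w \<Longrightarrow> v = w"
proof (induction v arbitrary: w)
  case Nil
  then show ?case using nt[of w] by auto
next
  case (Cons l v)
  note c = word_value_closed[OF _ S]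
  show ?case
  proof (cases w)
    case Nil
    then show ?thesis using Cons.prems nt[of "l # v"] by auto
  next
    case (Cons m w')
    have lm: "fst l \<in> S" "fst m \<in> S" "v \<in> reduced_words S" "w' \<in> reduced_words S"
      using Cons.prems Cons by (auto simp: reduced_words_Cons)
    show ?thesis
    proof (cases "l = m")
      case True
      have "word_value G v = word_value G w'"
        using Cons.prems(3) Cons True lm S c by (auto split: if_splits)
      then show ?thesis using Cons.IH[of w'] lm Cons True by simp
    next
      case False
      let ?z = "inverse_word (l # v) @ w"
      have wc: "set x \<subseteq> carrier G \<times> UNIV" if "x \<in> reduced_words S" for x
        using that S by (auto simp: reduced_words_def lists_eq_set)
      have i: "inverse_word (l # v) \<in> reduced_words S"
        using Cons.prems by (intro inverse_word_reduced)
      have la: "last (inverse_word (l # v)) = (fst l, \<not> snd l)"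
        by (simp add: inverse_word_def case_prod_beta)
      have "?z \<in> reduced_words S"
        using i Cons.prems(2) la False Cons
        by (auto simp: reduced_words_def successively_append_iff case_prod_beta prod_eq_iff)
      moreover have "word_value G ?z = \<one>"
        using word_value_append[OF wc[OF i] wc[OF Cons.prems(2)]]
          word_value_inverse_word[OF wc[OF Cons.prems(1)]] Cons.prems(3) c[OF Cons.prems(2)]
        by simp
      ultimately show ?thesis using nt[of ?z] Cons by simp
    qed
  qed
qed

text \<open>The absence of relations is all that freeness asks for, since every element of the generated group is the value of some reduced word.\<close>

lemma free_group_onI:
  assumes S: "S \<subseteq> carrier G"
    and nt: "\<And>w. w \<in> reduced_words S \<Longrightarrow> w \<noteq> [] \<Longrightarrow> word_value G w \<noteq> \<one>"
  shows "free_group_on (subgroup_generated G S) S"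
proof -
  let ?H = "subgroup_generated G S"
  have H: "carrier ?H = generate G S"
    using S by (simp add: carrier_subgroup_generated Int_absorb1)
  have SH: "S \<subseteq> carrier ?H" using H by (auto intro: generate.incl)
  have val: "word_value ?H w = word_value G w \<and> word_value G w \<in> generate G S"
    if "w \<in> reduced_words S" for w
    using that
  proof (induction w)
    case Nil
    then show ?case by (simp add: generate.one)
  next
    case (Cons l w)
    have l: "fst l \<in> S" "w \<in> reduced_words S" using Cons.prems by (auto simp: reduced_words_Cons)
    then have "(if snd l then fst l else inv (fst l)) \<in> generate G S"
      by (auto intro: generate.incl generate.inv)
    then show ?case using Cons.IH l SH by (auto simp: inv_subgroup_generated intro: generate.eng)
  qed
  have "inj_on (word_value ?H) (reduced_words S)"
    using reduced_words_value_inj[OF S nt] val by (auto intro!: inj_onI)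
  moreover have "word_value ?H ` reduced_words S = carrier ?H"
    using val generate_subset_reduced_values[OF S] H by (force simp: image_iff subset_iff)
  ultimately show ?thesis
    unfolding free_group_on_def bij_betw_def using SH by simp
qed

end

section \<open>Ping-pong for a diagonal matrix and a transvection\<close>

definition coord_sum :: "'i set \<Rightarrow> ('i \<Rightarrow> complex) \<Rightarrow> complex" where
  "coord_sum I x = (\<Sum>i\<in>I. x i)"

definition l1norm :: "'i set \<Rightarrow> ('i \<Rightarrow> complex) \<Rightarrow> real" where
  "l1norm I x = (\<Sum>i\<in>I. cmod (x i))"

lemma l1norm_nonneg [simp]: "0 \<le> l1norm I x"
  by (simp add: l1norm_def sum_nonneg)

lemma coord_sum_le_l1norm: "cmod (coord_sum I x) \<le> l1norm I x"
  unfolding coord_sum_def l1norm_def by (rule norm_sum)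

lemma l1norm_scale_le:
  assumes "\<And>i. i \<in> I \<Longrightarrow> 0 \<le> r i" "\<And>i. i \<in> I \<Longrightarrow> r i \<le> R"
  shows "l1norm I (\<lambda>i. of_real (r i) * x i) \<le> R * l1norm I x"
  unfolding l1norm_def sum_distrib_left
  using assms by (intro sum_mono) (auto simp: norm_mult intro: mult_right_mono)

lemma l1norm_add_smult_le: "l1norm I (\<lambda>i. x i + a * v i) \<le> l1norm I x + cmod a * l1norm I v"
  unfolding l1norm_def sum_distrib_left sum.distrib[symmetric]
  by (intro sum_mono order_trans[OF norm_triangle_ineq]) (simp add: norm_mult)

lemma l1norm_add_smult_ge: "cmod a * l1norm I v - l1norm I x \<le> l1norm I (\<lambda>i. x i + a * v i)"
  unfolding l1norm_def sum_distrib_left sum_subtractf[symmetric]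
proof (intro sum_mono)
  fix i
  show "cmod a * cmod (v i) - cmod (x i) \<le> cmod (x i + a * v i)"
    using norm_triangle_ineq2[of "a * v i" "- x i"] by (simp add: norm_mult add.commute)
qed

lemma coord_sum_shear:
  assumes "\<And>i. i \<in> I \<Longrightarrow> y i = x i + a * v i"
  shows "coord_sum I y = coord_sum I x + a * coord_sum I v"
  using assms by (simp add: coord_sum_def sum.distrib sum_distrib_left)

text \<open>The orbit map \<open>vec\<close> sends the unit element to the all-ones vector. On its values \<open>u\<close> acts as a diagonal
matrix with positive entries, and \<open>B\<close> as the transvection that adds \<open>T\<close> times the coordinate sum times
\<open>v\<close>. The Boolean is the sign of an exponent, as in the letters of a word, so that both signs are
treated at once. The decisive hypothesis \<open>dominant\<close> says that the coordinate sum of \<open>u^n v\<close> is comparable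
with the operator norm of \<open>u^n\<close>, uniformly in the nonzero exponent \<open>n\<close>.\<close>

locale shear_ping_pong = group U for U (structure) +
  fixes u B :: 'a and vec :: "'a \<Rightarrow> 'i \<Rightarrow> complex" and I :: "'i set"
    and \<mu> :: "bool \<Rightarrow> 'i \<Rightarrow> real" and L :: "bool \<Rightarrow> real" and v :: "'i \<Rightarrow> complex" and c T :: real
  assumes I: "finite I" "I \<noteq> {}"
    and u: "u \<in> carrier U" and B: "B \<in> carrier U"
    and vec_one: "\<And>i. i \<in> I \<Longrightarrow> vec \<one> i = 1"
    and vec_u: "\<And>a e i. a \<in> carrier U \<Longrightarrow> i \<in> I \<Longrightarrow>
               vec ((if e then u else inv u) \<otimes> a) i = of_real (\<mu> e i) * vec a i"
    and vec_B: "\<And>a e i. a \<in> carrier U \<Longrightarrow> i \<in> I \<Longrightarrow>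
               vec ((if e then B else inv B) \<otimes> a) i =
                 vec a i + of_real (if e then T else - T) * coord_sum I (vec a) * v i"
    and v: "coord_sum I v = 0"
    and \<mu>_pos: "\<And>e i. i \<in> I \<Longrightarrow> 0 < \<mu> e i" and \<mu>_le: "\<And>e i. i \<in> I \<Longrightarrow> \<mu> e i \<le> L e"
    and \<mu>_inv: "\<And>i. i \<in> I \<Longrightarrow> \<mu> True i * \<mu> False i = 1"
    and c: "0 < c" "c \<le> 2 * l1norm I v"
    and dominant: "\<And>e n. 0 < n \<Longrightarrow>
               c * L e ^ n \<le> cmod (coord_sum I (\<lambda>i. of_real (\<mu> e i ^ n) * v i))"
    and T: "2 * (1 + 2 * l1norm I v / c) / c < T" "2 * (2 * l1norm I v / c) / l1norm I v < T"
begin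

text \<open>For the vectors \<open>u^n v\<close> with nonzero \<open>n\<close>, the coordinate sum is at least \<open>c / l1norm I v\<close> times the norm;
half of this leaves room for vectors that are only close to \<open>v\<close>.\<close>

definition aperture :: real where
  "aperture = c / (2 * l1norm I v)"

definition cone :: "('i \<Rightarrow> complex) set" where
  "cone = {x. coord_sum I x \<noteq> 0 \<and> aperture * l1norm I x \<le> cmod (coord_sum I x)}"

text \<open>This contains the images of the cone under the nontrivial powers of \<open>B\<close>. Only the size of the multiple
of \<open>v\<close> matters, so the exponent is forgotten.\<close>

definition sheared :: "('i \<Rightarrow> complex) set" where
  "sheared = {y. \<exists>x\<in>cone. \<exists>a. cmod a \<ge> T * cmod (coord_sum I x) \<and> coord_sum I y = coord_sum I x
     \<and> (\<forall>i\<in>I. y i = x i + a * v i)}"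

lemma coord_sum_cong:
  assumes "\<And>i. i \<in> I \<Longrightarrow> x i = y i"
  shows "coord_sum I x = coord_sum I y" "l1norm I x = l1norm I y"
  using assms by (simp_all add: coord_sum_def l1norm_def)

lemma l1norm_v_pos: "0 < l1norm I v"
  using c by linarith

lemma aperture_pos: "0 < aperture" and aperture_le_1: "aperture \<le> 1"
  using c l1norm_v_pos by (simp_all add: aperture_def)

lemma T_pos: "0 < T"
proof -
  have "0 < 2 * (1 + 2 * l1norm I v / c) / c" using c l1norm_v_pos by (simp add: add_pos_pos)
  then show ?thesis using T by linarith
qed

lemma L_pos: "0 < L e"
proof -
  obtain i where "i \<in> I" using I by blast
  then show ?thesis using \<mu>_pos[of i e] \<mu>_le[of i e] by linarith
qed

text \<open>For \<open>y = x + a v\<close>, the vector \<open>a v\<close> contributes at least \<open>c L^n\<close> times the modulus of \<open>a\<close> to the coordinate sum of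
\<open>u^n y\<close>, while \<open>x\<close> contributes at most \<open>L^n\<close> times its norm, which the cone condition bounds by
a multiple of the coordinate sum of \<open>x\<close>. Both are relative to the same \<open>L^n\<close>, so a single bound on \<open>T\<close> serves all \<open>n\<close>.\<close>

lemma power_in_cone:
  assumes y: "y \<in> sheared" and n: "0 < n"
  shows "(\<lambda>i. of_real (\<mu> e i ^ n) * y i) \<in> cone"
proof -
  obtain x a where x: "x \<in> cone" and a: "cmod a \<ge> T * cmod (coord_sum I x)"
    and yi: "\<And>i. i \<in> I \<Longrightarrow> y i = x i + a * v i"
    using y by (auto simp: sheared_def)
  let ?p = "cmod (coord_sum I x)" and ?N = "l1norm I v"
  have p: "0 < ?p" and px: "l1norm I x \<le> ?p / aperture"
    using x aperture_pos by (auto simp: cone_def field_simps)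
  define Ln where "Ln = L e ^ n"
  have Ln: "0 < Ln" using L_pos by (simp add: Ln_def)
  have r: "0 \<le> \<mu> e i ^ n" "\<mu> e i ^ n \<le> Ln" if "i \<in> I" for i
    using \<mu>_pos[OF that, of e] power_mono[OF \<mu>_le[OF that, of e], of n] by (simp_all add: Ln_def)
  have Tp: "T * ?p > 0" using p T_pos by simp
  have ap: "0 < cmod a" by (rule less_le_trans[OF Tp a])
  let ?z = "\<lambda>i. of_real (\<mu> e i ^ n) * y i"
  have cy: "coord_sum I ?z = coord_sum I (\<lambda>i. of_real (\<mu> e i ^ n) * x i)
      + a * coord_sum I (\<lambda>i. of_real (\<mu> e i ^ n) * v i)"
    unfolding coord_sum_def sum_distrib_left sum.distrib[symmetric]
    by (intro sum.cong) (auto simp: yi algebra_simps)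
  have "cmod (coord_sum I (\<lambda>i. of_real (\<mu> e i ^ n) * x i)) \<le> Ln * l1norm I x"
    by (rule order_trans[OF coord_sum_le_l1norm l1norm_scale_le[OF r]])
  also have "\<dots> \<le> Ln * (?p / aperture)" using px Ln by (intro mult_left_mono) auto
  finally have up: "cmod (coord_sum I (\<lambda>i. of_real (\<mu> e i ^ n) * x i)) \<le> Ln * (?p / aperture)" .
  have "cmod a * (c * Ln) \<le> cmod (a * coord_sum I (\<lambda>i. of_real (\<mu> e i ^ n) * v i))"
    using dominant[OF n, of e] by (auto simp: norm_mult Ln_def intro: mult_left_mono)
  then have lo: "Ln * (cmod a * c - ?p / aperture) \<le> cmod (coord_sum I ?z)"
    unfolding cy using up
      norm_diff_ineq[of "a * coord_sum I (\<lambda>i. of_real (\<mu> e i ^ n) * v i)"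
        "coord_sum I (\<lambda>i. of_real (\<mu> e i ^ n) * x i)"]
    by (simp add: algebra_simps)
  have "l1norm I ?z \<le> Ln * l1norm I y"
    by (rule l1norm_scale_le[OF r])
  also have "l1norm I y \<le> l1norm I x + cmod a * ?N"
    using l1norm_add_smult_le[of I x a v] coord_sum_cong(2)[of y "\<lambda>i. x i + a * v i"] yi by auto
  also have "\<dots> \<le> ?p / aperture + cmod a * ?N" using px by simp
  finally have hi: "l1norm I ?z \<le> Ln * (?p / aperture + cmod a * ?N)"
    using Ln by (simp add: mult_left_mono)
  \<comment> \<open>the condition on \<open>T\<close>, multiplied out\<close>
  have T': "2 * (1 + 1 / aperture) < T * c"
    using T(1) c l1norm_v_pos by (simp add: aperture_def field_simps)
  have "2 * (1 + 1 / aperture) * ?p < T * c * ?p" using T' p by simp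
  also have "\<dots> \<le> cmod a * c" using a c by (simp add: mult.commute mult.left_commute mult_left_mono)
  finally have key: "2 * (?p + ?p / aperture) < cmod a * c" by (simp add: algebra_simps)
  have aN: "aperture * (cmod a * ?N) = cmod a * c / 2"
    using l1norm_v_pos by (simp add: aperture_def)
  have "aperture * l1norm I ?z \<le> aperture * (Ln * (?p / aperture + cmod a * ?N))"
    using hi aperture_pos by (simp add: mult_left_mono)
  also have "\<dots> = Ln * (?p + cmod a * c / 2)"
    using aperture_pos aN by (simp add: algebra_simps)
  also have "\<dots> \<le> Ln * (cmod a * c - ?p / aperture)"
    using key Ln by (intro mult_left_mono) (auto simp: algebra_simps)
  finally have 1: "aperture * l1norm I ?z \<le> cmod (coord_sum I ?z)" using lo by linarith
  have "0 < ?p + cmod a * c / 2" using p ap c by (simp add: add_pos_pos)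
  then have "0 < Ln * (cmod a * c - ?p / aperture)"
    using key Ln p by (intro mult_pos_pos) (auto simp: algebra_simps)
  then have "coord_sum I ?z \<noteq> 0" using lo by auto
  then show ?thesis using 1 by (simp add: cone_def)
qed

text \<open>Positive coordinates do not cancel in the coordinate sum. This is why the all-ones vector is a good base
point: every power of \<open>u\<close>, the trivial one included, leaves it in the cone.\<close>

lemma ones_power_in_cone: "(\<lambda>i. of_real (\<mu> e i ^ n)) \<in> cone"
proof -
  have pos: "0 < (\<Sum>i\<in>I. \<mu> e i ^ n)" using I \<mu>_pos by (intro sum_pos) auto
  have l: "l1norm I (\<lambda>i. of_real (\<mu> e i ^ n)) = (\<Sum>i\<in>I. \<mu> e i ^ n)"
    unfolding l1norm_def using \<mu>_pos[of _ e] by (intro sum.cong) (auto simp: norm_power less_imp_le)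
  have cs: "coord_sum I (\<lambda>i. of_real (\<mu> e i ^ n)) = of_real (\<Sum>i\<in>I. \<mu> e i ^ n)"
    by (simp add: coord_sum_def)
  have "aperture * (\<Sum>i\<in>I. \<mu> e i ^ n) \<le> (\<Sum>i\<in>I. \<mu> e i ^ n)"
    using aperture_le_1 pos by (intro mult_left_le_one_le) (auto simp: aperture_pos less_imp_le)
  then show ?thesis unfolding cone_def using pos by (simp only: mem_Collect_eq l cs) (auto simp del: of_real_sum)
qed

text \<open>The coordinate sum of \<open>v\<close> is 0, so adding a large multiple of \<open>v\<close> makes the vector longer and leaves its
coordinate sum alone.\<close>

lemma sheared_not_cone:
  assumes "y \<in> sheared"
  shows "y \<notin> cone"
proof
  assume yc: "y \<in> cone"
  obtain x a where x: "x \<in> cone" and a: "cmod a \<ge> T * cmod (coord_sum I x)"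
    and cy: "coord_sum I y = coord_sum I x" and yi: "\<And>i. i \<in> I \<Longrightarrow> y i = x i + a * v i"
    using assms by (auto simp: sheared_def)
  let ?p = "cmod (coord_sum I x)" and ?N = "l1norm I v"
  have p: "0 < ?p" and px: "l1norm I x \<le> ?p / aperture"
    using x aperture_pos by (auto simp: cone_def field_simps)
  have "cmod a * ?N - l1norm I x \<le> l1norm I y"
    using l1norm_add_smult_ge[of a I v x] coord_sum_cong(2)[of y "\<lambda>i. x i + a * v i"] yi by auto
  moreover have "l1norm I y \<le> ?p / aperture"
    using yc cy aperture_pos by (auto simp: cone_def field_simps)
  moreover have "T * ?p * ?N \<le> cmod a * ?N" using a l1norm_v_pos by (simp add: mult_right_mono)
  ultimately have "T * ?p * ?N \<le> 2 * (?p / aperture)" using px by linarith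
  then have "?p * (T * ?N) \<le> ?p * (2 / aperture)" by (simp add: mult.commute mult.left_commute)
  then have "T * ?N \<le> 2 / aperture" using p by (simp only: mult_le_cancel_left_pos)
  moreover have "2 / aperture < T * ?N" using T(2) l1norm_v_pos c by (simp add: aperture_def field_simps)
  ultimately show False by linarith
qed

lemma shear_large:
  assumes "0 < n"
  shows "T * cmod p \<le> cmod (of_real (real n * (if e then T else - T)) * p)"
proof -
  have "1 * (T * cmod p) \<le> real n * (T * cmod p)"
    using assms T_pos by (intro mult_right_mono) auto
  then show ?thesis using T_pos by (cases e) (simp_all add: norm_mult mult.assoc)
qed

lemma cone_cong: "y \<in> cone \<Longrightarrow> (\<And>i. i \<in> I \<Longrightarrow> y i = z i) \<Longrightarrow> z \<in> cone"
  unfolding cone_def using coord_sum_cong[of y z] by simp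

lemma one_in_cone: "vec \<one> \<in> cone"
  by (rule cone_cong[OF ones_power_in_cone[of True 0]]) (simp add: vec_one)

lemma u_neq_B: "u \<noteq> B"
proof
  assume eq: "u = B"
  have "vec (u \<otimes> \<one>) \<in> cone"
    by (rule cone_cong[OF ones_power_in_cone[of True 1]]) (use vec_u[of \<one> _ True] vec_one in auto)
  moreover have "vec (B \<otimes> \<one>) \<in> sheared"
  proof -
    have "coord_sum I (vec (B \<otimes> \<one>)) = coord_sum I (vec \<one>)"
      using coord_sum_shear[of I "vec (B \<otimes> \<one>)" "vec \<one>" "of_real T * coord_sum I (vec \<one>)" v]
        vec_B[of \<one> _ True] v by simp
    then show ?thesis
      unfolding sheared_def using vec_B[of \<one> _ True] one_in_cone T_pos
      by (auto intro!: bexI[of _ "vec \<one>"] exI[of _ "of_real T * coord_sum I (vec \<one>)"] simp: norm_mult)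
  qed
  ultimately show False using eq sheared_not_cone by simp
qed

text \<open>Reading a word from its last letter, a run of letters \<open>u\<close> moves the base point or a sheared vector into the
cone, and a run of letters \<open>B\<close> shears a vector of the cone; \<open>n\<close> is the length of the current run. The
statement keeps the vector from before the current run, because only the run as a whole moves it
to the right place.\<close>

lemma reduced_word_position:
  assumes "w \<in> reduced_words {u, B}"
  shows "word_value U w \<in> carrier U \<and>
   (case w of [] \<Rightarrow> True
    | l # _ \<Rightarrow>
       if fst l = u
       then \<exists>n>0. \<exists>y\<in>insert (vec \<one>) sheared.
              \<forall>i\<in>I. vec (word_value U w) i = of_real (\<mu> (snd l) i ^ n) * y i
       else \<exists>n>0. \<exists>x\<in>cone. \<forall>i\<in>I. vec (word_value U w) i =
              x i + of_real (real n * (if snd l then T else - T)) * coord_sum I x * v i)"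
  using assms
proof (induction w)
  case Nil
  then show ?case by simp
next
  case (Cons l w)
  let ?a = "word_value U w"
  have lS: "fst l \<in> {u, B}" and w: "w \<in> reduced_words {u, B}"
    and lw: "w \<noteq> [] \<Longrightarrow> fst l = fst (hd w) \<Longrightarrow> snd l = snd (hd w)"
    using Cons.prems by (auto simp: reduced_words_Cons)
  have ac: "?a \<in> carrier U" using Cons.IH[OF w] by blast
  have cl: "word_value U (l # w) \<in> carrier U" using lS u B ac by auto
  show ?case
  proof (cases "fst l = u")
    case True
    have act: "vec (word_value U (l # w)) i = of_real (\<mu> (snd l) i) * vec ?a i" if "i \<in> I" for i
      using vec_u[OF ac that, of "snd l"] True by (cases "snd l") auto
    have "\<exists>n>0. \<exists>y\<in>insert (vec \<one>) sheared.
              \<forall>i\<in>I. vec (word_value U (l # w)) i = of_real (\<mu> (snd l) i ^ n) * y i"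
    proof (cases w)
      case Nil
      then show ?thesis using act by (intro exI[of _ 1]) auto
    next
      case (Cons m w')
      show ?thesis
      proof (cases "fst m = u")
        case True
        then have "snd m = snd l" using lw Cons \<open>fst l = u\<close> by simp
        then obtain n y where "n > 0" "y \<in> insert (vec \<one>) sheared"
          "\<And>i. i \<in> I \<Longrightarrow> vec ?a i = of_real (\<mu> (snd l) i ^ n) * y i"
          using Cons.IH[OF w] Cons True by auto
        then show ?thesis using act by (intro exI[of _ "Suc n"]) auto
      next
        case False
        then obtain n x where n: "n > 0" and x: "x \<in> cone"
          and eq: "\<And>i. i \<in> I \<Longrightarrow> vec ?a i =
             x i + of_real (real n * (if snd m then T else - T)) * coord_sum I x * v i"
          using Cons.IH[OF w] Cons by auto
        have "coord_sum I (vec ?a) = coord_sum I x" using coord_sum_shear[of I, OF eq] v by simp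
        moreover have "T * cmod (coord_sum I x) \<le>
            cmod (of_real (real n * (if snd m then T else - T)) * coord_sum I x)"
          by (rule shear_large[OF n])
        ultimately have "vec ?a \<in> sheared"
          unfolding sheared_def using x eq by blast
        then show ?thesis using act by (intro exI[of _ 1]) auto
      qed
    qed
    then show ?thesis using True cl by simp
  next
    case False
    then have lB: "fst l = B" using lS by simp
    let ?t = "if snd l then T else - T"
    have act: "vec (word_value U (l # w)) i = vec ?a i + of_real ?t * coord_sum I (vec ?a) * v i"
      if "i \<in> I" for i
      using vec_B[OF ac that, of "snd l"] lB by (cases "snd l") auto
    have "\<exists>n>0. \<exists>x\<in>cone. \<forall>i\<in>I. vec (word_value U (l # w)) i =
              x i + of_real (real n * ?t) * coord_sum I x * v i"
    proof (cases "w \<noteq> [] \<and> fst (hd w) = B")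
      case True
      then obtain m w' where m: "w = m # w'" "fst m = B" by (cases w) auto
      have "snd m = snd l" using lw m lB by simp
      then obtain n x where n: "n > 0" and x: "x \<in> cone"
          and eq: "\<And>i. i \<in> I \<Longrightarrow> vec ?a i = x i + of_real (real n * ?t) * coord_sum I x * v i"
        using Cons.IH[OF w] m u_neq_B by auto
      have "coord_sum I (vec ?a) = coord_sum I x" using coord_sum_shear[of I, OF eq] v by simp
      then have "vec (word_value U (l # w)) i = x i + of_real (real (Suc n) * ?t) * coord_sum I x * v i"
        if "i \<in> I" for i
        using act[OF that] eq[OF that] by (simp add: algebra_simps)
      then show ?thesis using x by blast
    next
      case False
      have "vec ?a \<in> cone"
      proof (cases w)
        case Nil
        then show ?thesis by (simp add: one_in_cone)
      next
        case (Cons m w')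
        then have "fst m = u" using False w by (auto simp: reduced_words_Cons)
        then obtain n y where n: "n > 0" and y: "y \<in> insert (vec \<one>) sheared"
          and eq: "\<And>i. i \<in> I \<Longrightarrow> vec ?a i = of_real (\<mu> (snd m) i ^ n) * y i"
          using Cons.IH[OF w] Cons by auto
        show ?thesis
        proof (cases "y \<in> sheared")
          case True
          show ?thesis by (rule cone_cong[OF power_in_cone[OF True n, of "snd m"]]) (simp add: eq)
        next
          case False
          then have "y = vec \<one>" using y by simp
          then show ?thesis
            by (intro cone_cong[OF ones_power_in_cone[of "snd m" n]]) (simp add: eq vec_one)
        qed
      qed
      then show ?thesis using act by (intro exI[of _ 1]) auto
    qed
    then show ?thesis using False cl by simp
  qed
qed

text \<open>Let a nonempty reduced word act trivially. If it begins with \<open>B\<close>, then the base point would be sheared,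
although it lies in the cone. If it begins with a run \<open>u^n\<close>, then the rest of the word takes the base
point to its image under \<open>u^(-n)\<close>, which lies in the cone; so the rest is empty, all \<open>n\<close>-th powers of the
diagonal entries are 1, and the coordinate sum of \<open>u^n v\<close> is 0, against \<open>dominant\<close>.\<close>

lemma free_pair_shear: "free_pair U u B"
proof -
  have "word_value U w \<noteq> \<one>" if w: "w \<in> reduced_words {u, B}" "w \<noteq> []" for w
  proof
    assume one: "word_value U w = \<one>"
    obtain l w' where lw: "w = l # w'" using w(2) by (cases w) auto
    note pos = reduced_word_position[OF w(1)]
    show False
    proof (cases "fst l = u")
      case True
      then have "\<exists>n>0. \<exists>y\<in>insert (vec \<one>) sheared.
          \<forall>i\<in>I. vec (word_value U w) i = complex_of_real (\<mu> (snd l) i ^ n) * y i"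
        using conjunct2[OF pos] by (simp only: lw list.case if_True)
      then obtain n y where n: "n > 0" and y: "y \<in> insert (vec \<one>) sheared"
        and eq': "\<forall>i\<in>I. vec (word_value U w) i = complex_of_real (\<mu> (snd l) i ^ n) * y i"
        by blast
      have eq: "1 = complex_of_real (\<mu> (snd l) i ^ n) * y i" if "i \<in> I" for i
        using eq' one vec_one that by simp
      have inv: "\<mu> (\<not> e) i ^ n * \<mu> e i ^ n = 1" if "i \<in> I" for e i
        using \<mu>_inv[OF that] by (cases e) (simp_all add: power_mult_distrib[symmetric] mult.commute)
      have yi: "of_real (\<mu> (\<not> snd l) i ^ n) = y i" if "i \<in> I" for i
      proof -
        have "complex_of_real (\<mu> (\<not> snd l) i ^ n)
            = of_real (\<mu> (\<not> snd l) i ^ n) * (of_real (\<mu> (snd l) i ^ n) * y i)"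
          using eq[OF that] by simp
        also have "\<dots> = of_real (\<mu> (\<not> snd l) i ^ n * \<mu> (snd l) i ^ n) * y i"
          by (simp only: of_real_mult mult.assoc)
        finally show ?thesis by (simp only: inv[OF that] of_real_1 mult_1)
      qed
      have "y \<in> cone" by (rule cone_cong[OF ones_power_in_cone[of "\<not> snd l" n]]) (simp only: yi)
      then have "y = vec \<one>" using y sheared_not_cone by blast
      then have one': "of_real (\<mu> (snd l) i ^ n) = (1::complex)" if "i \<in> I" for i
        using eq[OF that] vec_one[OF that] by (simp only: mult_1_right)
      have "coord_sum I (\<lambda>i. of_real (\<mu> (snd l) i ^ n) * v i) = coord_sum I v"
        unfolding coord_sum_def by (intro sum.cong refl) (simp only: one' mult_1)
      then have "c * L (snd l) ^ n \<le> 0" using dominant[OF n, of "snd l"] v by simp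
      moreover have "0 < c * L (snd l) ^ n" using c L_pos[of "snd l"] by simp
      ultimately show False by linarith
    next
      case False
      then have "\<exists>n>0. \<exists>x\<in>cone. \<forall>i\<in>I. vec (word_value U w) i =
           x i + of_real (real n * (if snd l then T else - T)) * coord_sum I x * v i"
        using conjunct2[OF pos] by (simp only: lw list.case if_False)
      then obtain n x where n: "n > 0" and x: "x \<in> cone"
        and eq': "\<forall>i\<in>I. vec (word_value U w) i =
           x i + of_real (real n * (if snd l then T else - T)) * coord_sum I x * v i"
        by blast
      have eq: "vec \<one> i =
           x i + of_real (real n * (if snd l then T else - T)) * coord_sum I x * v i"
        if "i \<in> I" for i using eq' one that by simp
      have "coord_sum I (vec \<one>) = coord_sum I x" using coord_sum_shear[of I, OF eq] v by simp
      moreover have "T * cmod (coord_sum I x) \<le>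
          cmod (of_real (real n * (if snd l then T else - T)) * coord_sum I x)"
          by (rule shear_large[OF n])
      ultimately have "vec \<one> \<in> sheared" unfolding sheared_def using x eq by blast
      then show False using one_in_cone sheared_not_cone by blast
    qed
  qed
  then show ?thesis
    unfolding free_pair_def using u B u_neq_B free_group_onI[of "{u, B}"] by simp
qed

end

section \<open>Circulant matrices of prime size and growth rates at roots of unity\<close>

definition fwd_diff :: "(int \<Rightarrow> int) \<Rightarrow> int \<Rightarrow> int" where
  "fwd_diff z i = z (i + 1) - z i"

lemma fwd_diff_Suc: "(fwd_diff ^^ Suc n) z i = (fwd_diff ^^ n) z (i + 1) - (fwd_diff ^^ n) z i"
  by (simp add: fwd_diff_def)

lemma fwd_diff_funpow:
  "(fwd_diff ^^ n) z i = (\<Sum>j\<le>n. (-1) ^ (n + j) * int (n choose j) * z (i + int j))"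
proof (induction n arbitrary: i)
  case 0
  then show ?case by simp
next
  case (Suc n)
  let ?g = "\<lambda>j. (-1) ^ (n + j) * int (n choose j) * z (i + int j)"
  have "(\<Sum>j\<le>n. ?g j) = (\<Sum>j\<le>Suc n. ?g j)" by simp
  also have "\<dots> = ?g 0 + (\<Sum>j\<le>n. ?g (Suc j))" by (rule sum.atMost_Suc_shift)
  finally have g: "(\<Sum>j\<le>n. ?g j) = ?g 0 + (\<Sum>j\<le>n. ?g (Suc j))" .
  have "(fwd_diff ^^ Suc n) z i = (fwd_diff ^^ n) z (i + 1) - (fwd_diff ^^ n) z i"
    by (simp add: fwd_diff_def)
  also have "\<dots> = (\<Sum>j\<le>n. (-1) ^ (n + j) * int (n choose j) * z (i + 1 + int j))
      - (?g 0 + (\<Sum>j\<le>n. ?g (Suc j)))"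
    unfolding Suc.IH using g by simp
  also have "\<dots> = (-1) ^ Suc n * z i
      + (\<Sum>j\<le>n. (-1) ^ (n + j) * int (n choose j) * z (i + 1 + int j) - ?g (Suc j))"
    by (simp only: sum_subtractf) simp
  also have "(\<Sum>j\<le>n. (-1) ^ (n + j) * int (n choose j) * z (i + 1 + int j) - ?g (Suc j))
      = (\<Sum>j\<le>n. (-1) ^ (Suc n + Suc j) * int (Suc n choose Suc j) * z (i + int (Suc j)))"
    by (intro sum.cong) (auto simp: algebra_simps)
  also have "(-1) ^ Suc n * z i
      + (\<Sum>j\<le>n. (-1) ^ (Suc n + Suc j) * int (Suc n choose Suc j) * z (i + int (Suc j)))
      = (\<Sum>j\<le>Suc n. (-1) ^ (Suc n + j) * int (Suc n choose j) * z (i + int j))"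
    by (subst sum.atMost_Suc_shift) simp
  finally show ?case .
qed

text \<open>Modulo \<open>q\<close>, the \<open>q\<close>-th power of shift minus identity is the \<open>q\<close>-fold shift minus identity.\<close>

lemma fwd_diff_funpow_prime:
  assumes q: "Factorial_Ring.prime q" "odd q" and per: "\<And>i. z (i + int q) = z i"
  shows "int q dvd (fwd_diff ^^ q) z i"
proof -
  let ?g = "\<lambda>j. (-1) ^ (q + j) * int (q choose j) * z (i + int j)"
  have q0: "0 < q" using q prime_gt_0_nat by blast
  have split: "{..q} = insert 0 (insert q {1..<q})" using q0 by auto
  have "(\<Sum>j\<le>q. ?g j) = ?g 0 + (?g q + (\<Sum>j\<in>{1..<q}. ?g j))"
    unfolding split using q0 by (subst sum.insert, auto)
  moreover have "?g 0 + ?g q = 0" using q per by simp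
  ultimately have "(fwd_diff ^^ q) z i = (\<Sum>j\<in>{1..<q}. ?g j)"
    unfolding fwd_diff_funpow by linarith
  moreover have "int q dvd (\<Sum>j\<in>{1..<q}. ?g j)"
  proof (rule dvd_sum)
    fix j assume "j \<in> {1..<q}"
    then have "q dvd (q choose j)" using q by (intro dvd_choose_prime) auto
    then show "int q dvd ?g j" by (meson dvd_mult dvd_mult2 of_nat_dvd_iff)
  qed
  ultimately show ?thesis by (simp only:)
qed

text \<open>The circulant operator commutes with \<open>fwd_diff\<close>, which is nilpotent modulo \<open>q\<close>. If \<open>z\<close> were nonzero
modulo \<open>q\<close>, its last iterated difference that is nonzero modulo \<open>q\<close> would be constant modulo \<open>q\<close>; on constants
the circulant operator is multiplication by \<open>card E\<close>, which is invertible modulo \<open>q\<close>.\<close>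

lemma circulant_kernel_divisible:
  assumes q: "Factorial_Ring.prime q" "odd q"
    and per: "\<And>i. z (i + int q) = z i"
    and E: "coprime (card E) q"
    and ker: "\<And>k. (\<Sum>i\<in>E. z (i - k)) = (0::int)"
  shows "int q dvd z i"
proof -
  have iter: "(\<forall>i. (fwd_diff ^^ n) z (i + int q) = (fwd_diff ^^ n) z i)
      \<and> (\<forall>k. (\<Sum>i\<in>E. (fwd_diff ^^ n) z (i - k)) = 0)" for n
  proof (induction n)
    case 0
    then show ?case using per ker by simp
  next
    case (Suc n)
    have "(\<Sum>i\<in>E. (fwd_diff ^^ Suc n) z (i - k)) = 0" for k
    proof -
      have "(\<Sum>i\<in>E. (fwd_diff ^^ Suc n) z (i - k)) =
          (\<Sum>i\<in>E. (fwd_diff ^^ n) z (i - (k - 1))) - (\<Sum>i\<in>E. (fwd_diff ^^ n) z (i - k))"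
        by (simp only: fwd_diff_Suc sum_subtractf) (simp add: algebra_simps)
      then show ?thesis using Suc.IH by simp
    qed
    moreover have "(fwd_diff ^^ Suc n) z (i + int q) = (fwd_diff ^^ Suc n) z i" for i
    proof -
      have "(fwd_diff ^^ n) z (i + int q + 1) = (fwd_diff ^^ n) z (i + 1)"
        using Suc.IH by (metis add.assoc add.commute)
      then show ?thesis using Suc.IH by (simp only: fwd_diff_Suc)
    qed
    ultimately show ?case by blast
  qed
  have step: "\<forall>i. int q dvd w i"
    if w: "\<forall>i. int q dvd fwd_diff w i" and k: "(\<Sum>i\<in>E. w (i - 0)) = 0" for w
  proof -
    have up: "[w (i + int n) = w i] (mod int q)" for i n
    proof (induction n)
      case (Suc n)
      have "[w (i + int n + 1) = w (i + int n)] (mod int q)"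
        using w by (simp add: fwd_diff_def cong_iff_dvd_diff)
      then have "[w (i + int (Suc n)) = w (i + int n)] (mod int q)" by (simp add: add.commute add.left_commute)
      then show ?case using Suc.IH cong_trans by blast
    qed simp
    have c: "[w i = w 0] (mod int q)" for i
    proof (cases "0 \<le> i")
      case True
      then show ?thesis using up[of 0 "nat i"] by simp
    next
      case False
      then show ?thesis using up[of i "nat (- i)"] by (simp add: cong_sym)
    qed
    have "[(\<Sum>i\<in>E. w i) = (\<Sum>i\<in>E. w 0)] (mod int q)" by (intro cong_sum c)
    then have "int q dvd int (card E) * w 0" using k by (simp add: cong_iff_dvd_diff)
    moreover have "coprime (int q) (int (card E))" using E by (simp add: coprime_commute)
    ultimately have "int q dvd w 0" using coprime_dvd_mult_right_iff by blast
    then show ?thesis using c cong_dvd_iff by blast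
  qed
  have "\<forall>i. int q dvd (fwd_diff ^^ (q - n)) z i" if "n \<le> q" for n
    using that
  proof (induction n)
    case 0
    then show ?case using fwd_diff_funpow_prime[OF q] per by simp
  next
    case (Suc n)
    then have e: "q - n = Suc (q - Suc n)" by simp
    let ?w = "(fwd_diff ^^ (q - Suc n)) z"
    have "\<forall>i. int q dvd fwd_diff ?w i" using Suc by (simp add: e)
    moreover have "(\<Sum>i\<in>E. ?w (i - 0)) = 0" using iter[of "q - Suc n"] by blast
    ultimately show ?case by (rule step)
  qed
  from this[of q] show ?thesis by simp
qed

text \<open>Infinite descent: an element of the kernel can be divided by \<open>q\<close> again and again.\<close>

lemma circulant_int_injective:
  assumes q: "Factorial_Ring.prime q" "odd q"
    and per: "\<And>i. z (i + int q) = z i"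
    and E: "coprime (card E) q"
    and ker: "\<And>k. (\<Sum>i\<in>E. z (i - k)) = (0::int)"
  shows "z i = 0"
proof -
  have pow: "int q ^ n dvd z i" for n i
    using per ker
  proof (induction n arbitrary: z i)
    case (Suc n)
    have d: "int q dvd z i" for i using circulant_kernel_divisible[OF q _ E] Suc.prems by blast
    define y where "y i = z i div int q" for i
    have zy: "z i = int q * y i" for i using d by (simp add: y_def)
    have "int q * (\<Sum>i\<in>E. y (i - k)) = 0" for k
      using Suc.prems(2)[of k] by (simp add: zy sum_distrib_left)
    then have "(\<Sum>i\<in>E. y (i - k)) = 0" for k using q by (simp add: prime_gt_0_nat)
    moreover have "y (i + int q) = y i" for i using Suc.prems(1) by (simp add: y_def)
    ultimately have "int q ^ n dvd y i" by (intro Suc.IH) auto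
    then show ?case by (simp add: zy mult_dvd_mono)
  qed simp
  show ?thesis
  proof (rule ccontr)
    assume nz: "z i \<noteq> 0"
    let ?n = "nat \<bar>z i\<bar>"
    have "int q ^ ?n \<le> \<bar>z i\<bar>" using dvd_imp_le_int[OF nz pow[of ?n i]] by simp
    moreover have "(2::int) ^ ?n \<le> int q ^ ?n"
      using prime_ge_2_nat[OF q(1)] by (intro power_mono) auto
    moreover have "int ?n < 2 ^ ?n" using of_nat_less_two_power[where 'a=int] by blast
    ultimately show False by linarith
  qed
qed

text \<open>By simultaneous Diophantine approximation, an integer multiple of a real element of the kernel is close to an
integer valued function. The sums of the latter over the translates of \<open>E\<close> are integers of modulus
less than 1, so it lies in the kernel too.\<close>

lemma circulant_real_injective:
  fixes r :: "int \<Rightarrow> real"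
  assumes q: "Factorial_Ring.prime q" "odd q"
    and per: "\<And>i j. i mod int q = j mod int q \<Longrightarrow> r i = r j"
    and E: "E \<subseteq> {0..<int q}" "coprime (card E) q"
    and ker: "\<And>k. (\<Sum>i\<in>E. r (i - k)) = 0"
  shows "r j = 0"
proof (rule ccontr)
  assume nz: "r j \<noteq> 0"
  have q0: "0 < q" using q prime_gt_0_nat by blast
  define s where "s i = r i / \<bar>r j\<bar>" for i
  define N where "N = 2 * q"
  have N0: "0 < N" using q0 by (simp add: N_def)
  obtain Q p where Q: "0 < Q"
    and app: "\<And>i. i < q \<Longrightarrow> \<bar>of_int Q * s (int i) - of_int (p i)\<bar> < 1 / real N"
    using Dirichlet_approx_simult[OF N0, of q "\<lambda>i. s (int i)"] by blast
  define z where "z i = p (nat (i mod int q))" for i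
  have close: "\<bar>of_int Q * s i - of_int (z i)\<bar> < 1 / real N" for i
  proof -
    have "s i = s (int (nat (i mod int q)))" using per[of i "i mod int q"] q0 by (simp add: s_def)
    moreover have "nat (i mod int q) < q" using q0 by (simp add: nat_less_iff)
    ultimately show ?thesis using app unfolding z_def by (simp only:)
  qed
  have fE: "finite E" using E finite_subset by blast
  have cE: "card E \<le> q" using card_mono[OF _ E(1)] by simp
  have "(\<Sum>i\<in>E. z (i - k)) = 0" for k
  proof -
    have "(\<Sum>i\<in>E. s (i - k)) = 0" using ker[of k] by (simp add: s_def sum_divide_distrib[symmetric])
    then have "real_of_int (\<Sum>i\<in>E. z (i - k)) = - (\<Sum>i\<in>E. of_int Q * s (i - k) - of_int (z (i - k)))"
      by (simp add: sum_subtractf sum_distrib_left[symmetric])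
    then have "\<bar>real_of_int (\<Sum>i\<in>E. z (i - k))\<bar>
        \<le> (\<Sum>i\<in>E. \<bar>of_int Q * s (i - k) - of_int (z (i - k))\<bar>)"
      by (simp only: abs_minus_cancel sum_abs)
    also have "\<dots> \<le> (\<Sum>i\<in>E. 1 / real N)" using close by (intro sum_mono less_imp_le)
    also have "\<dots> = real (card E) / real N" by simp
    also have "\<dots> < 1" using cE q0 by (simp add: N_def)
    finally show ?thesis by linarith
  qed
  moreover have "z (i + int q) = z i" for i by (simp add: z_def)
  ultimately have "z j = 0" using circulant_int_injective[OF q _ E(2)] by blast
  then have "real_of_int Q * \<bar>s j\<bar> < 1 / real N" using close[of j] Q by (simp add: abs_mult)
  moreover have "\<bar>s j\<bar> = 1" using nz by (simp add: s_def)
  moreover have "1 / real N \<le> 1" using q0 by (simp add: N_def)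
  ultimately show False using Q by simp
qed

lemma shifted_sums_distinguish:
  fixes r :: "int \<Rightarrow> real"
  assumes q: "Factorial_Ring.prime q" "odd q"
    and per: "\<And>i j. i mod int q = j mod int q \<Longrightarrow> r i = r j"
    and E: "E \<subset> {0..<int q}" "E \<noteq> {}"
    and nc: "r a \<noteq> r b"
  shows "\<exists>k. (\<Sum>i\<in>E. r (i - k)) \<noteq> (\<Sum>i\<in>E. r i)"
proof (rule ccontr)
  assume "\<not> ?thesis"
  then have const: "(\<Sum>i\<in>E. r (i - k)) = (\<Sum>i\<in>E. r i)" for k by blast
  have fE: "finite E" using E finite_subset by blast
  have "0 < card E" using E fE by (simp add: card_gt_0_iff)
  moreover have "card E < q" using psubset_card_mono[OF _ E(1)] by simp
  ultimately have "\<not> q dvd card E" by (simp add: nat_dvd_not_less)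
  then have co: "coprime (card E) q" using q by (simp add: prime_imp_coprime coprime_commute)
  define m where "m = (\<Sum>i\<in>E. r i) / card E"
  have "r j - m = 0" for j
  proof (rule circulant_real_injective[OF q _ _ co])
    show "(\<Sum>i\<in>E. r (i - k) - m) = 0" for k
      using const[of k] \<open>0 < card E\<close> by (simp add: sum_subtractf m_def)
    show "E \<subseteq> {0..<int q}" using E by blast
    show "r i - m = r j - m" if "i mod int q = j mod int q" for i j
      by (simp only: per[OF that])
  qed
  then show False using nc by (metis eq_iff_diff_eq_0)
qed

text \<open>At an eigenvalue \<open>\<xi>\<close> of \<open>g\<close> other than 1, the Bass cyclic unit of \<open>g\<close> with \<open>k = 2\<close> has the eigenvalue
\<open>(1 + \<xi>)^m\<close>, and \<open>(1 + \<xi>)^2 = \<xi> (2 + 2 Re \<xi>)\<close> on the unit circle. At the eigenvalue 1 the second summand of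
the unit brings the value back to 1.\<close>

definition bass_rate :: "complex \<Rightarrow> real" where
  "bass_rate \<xi> = (if \<xi> = 1 then 1 else 2 + 2 * Re \<xi>)"

context
  fixes \<xi> :: complex and d :: nat
  assumes root: "\<xi> ^ d = 1" and d: "coprime d 6"
begin

lemma root_order_pos: "0 < d"
  using d by (cases "d = 0") auto

lemma root_norm: "cmod \<xi> = 1"
proof -
  have "cmod \<xi> ^ d = 1 ^ d" by (simp add: norm_power[symmetric] root)
  then show ?thesis using power_eq_imp_eq_base[of "cmod \<xi>" d 1] root_order_pos by simp
qed

lemma root_coprime_power:
  assumes "\<xi> ^ n = 1" "coprime n d" shows "\<xi> = 1"
proof -
  have "gcd d n = 1" using assms(2) by (simp add: coprime_iff_gcd_eq_1 gcd.commute)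
  then obtain x y where xy: "d * x = n * y + 1"
    using bezout_nat[of d n] root_order_pos by auto
  have "\<xi> ^ (d * x) = 1" using root by (simp add: power_mult)
  then show ?thesis unfolding xy using assms(1) by (simp add: power_add power_mult)
qed

lemma root_quadratic: "\<xi> ^ 2 + 1 = \<xi> * of_real (2 * Re \<xi>)"
proof -
  have "\<xi> * cnj \<xi> = 1" using complex_norm_square[of \<xi>] root_norm by simp
  moreover have "\<xi> + cnj \<xi> = of_real (2 * Re \<xi>)" by (rule complex_add_cnj)
  ultimately show ?thesis by (metis distrib_left power2_eq_square)
qed

lemma root_Re_less_1: "\<xi> \<noteq> 1 \<Longrightarrow> Re \<xi> < 1"
proof -
  assume "\<xi> \<noteq> 1"
  have "Re \<xi> \<le> 1" using root_norm complex_Re_le_cmod[of \<xi>] by simp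
  moreover have "Re \<xi> \<noteq> 1"
  proof
    assume "Re \<xi> = 1"
    moreover have "Re \<xi> ^ 2 + Im \<xi> ^ 2 = 1" using root_norm by (simp add: cmod_def)
    ultimately show False using \<open>\<xi> \<noteq> 1\<close> by (simp add: complex_eq_iff)
  qed
  ultimately show ?thesis by simp
qed

text \<open>The value \<open>2 + 2 Re \<xi> = 1\<close> is attained only at the primitive third roots of unity.\<close>

lemma bass_rate_eq_1_iff: "bass_rate \<xi> = 1 \<longleftrightarrow> \<xi> = 1"
proof
  assume a: "bass_rate \<xi> = 1"
  show "\<xi> = 1"
  proof (rule ccontr)
    assume "\<xi> \<noteq> 1"
    then have "2 * Re \<xi> = -1" using a by (simp add: bass_rate_def)
    then have "\<xi> ^ 2 + 1 = - \<xi>" using root_quadratic by simp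
    moreover have "\<xi> ^ 2 + \<xi> + 1 = (\<xi> ^ 2 + 1) + \<xi>" by simp
    ultimately have "\<xi> ^ 2 + \<xi> + 1 = 0" by (simp only: add.left_inverse)
    moreover have "\<xi> ^ 3 - 1 = (\<xi> - 1) * (\<xi> ^ 2 + \<xi> + 1)"
      by (simp add: algebra_simps power2_eq_square power3_eq_cube)
    ultimately have "\<xi> ^ 3 = 1" by simp
    moreover have "coprime 3 d"
      using d coprime_mult_right_iff[of d 2 3] by (simp add: coprime_commute)
    ultimately show False using root_coprime_power \<open>\<xi> \<noteq> 1\<close> by blast
  qed
qed (simp add: bass_rate_def)

lemma bass_rate_pos: "0 < bass_rate \<xi>"
proof (cases "\<xi> = 1")
  case False
  have "-1 \<le> Re \<xi>" using root_norm abs_Re_le_cmod[of \<xi>] by simp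
  moreover have "Re \<xi> \<noteq> -1"
  proof
    assume r: "Re \<xi> = -1"
    then have "\<xi> ^ 2 + 1 = - (2 * \<xi>)" using root_quadratic by simp
    moreover have "(\<xi> + 1) ^ 2 = (\<xi> ^ 2 + 1) + 2 * \<xi>"
      by (simp add: power2_eq_square algebra_simps)
    ultimately have "(\<xi> + 1) ^ 2 = 0" by (simp only: add.left_inverse)
    then have "\<xi> ^ 2 = 1" by (simp add: add_eq_0_iff2)
    moreover have "coprime 2 d"
      using d coprime_mult_right_iff[of d 2 3] by (simp add: coprime_commute)
    ultimately show False using root_coprime_power False by blast
  qed
  ultimately show ?thesis using False by (simp add: bass_rate_def)
qed (simp add: bass_rate_def)

lemma bass_rate_power:
  assumes "\<xi> \<noteq> 1" "d dvd m"
  shows "(1 + \<xi>) ^ (2 * m) = of_real (bass_rate \<xi> ^ m)"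
proof -
  have "(1 + \<xi>) ^ 2 = \<xi> * of_real (bass_rate \<xi>)"
    using root_quadratic assms by (simp add: bass_rate_def power2_eq_square algebra_simps)
  moreover have "\<xi> ^ m = 1" using assms(2) root by (auto simp: power_mult)
  ultimately show ?thesis by (simp add: power_mult power_mult_distrib)
qed

end

text \<open>The largest values for \<open>True\<close> and the smallest for \<open>False\<close>: the coordinates that dominate for positive and
for negative exponents.\<close>

definition extremal :: "bool \<Rightarrow> ('i \<Rightarrow> real) \<Rightarrow> 'i set \<Rightarrow> 'i set" where
  "extremal e s I = {i \<in> I. \<forall>j\<in>I. if e then s j \<le> s i else s i \<le> s j}"

lemma extremal_nonempty:
  assumes "finite I" "I \<noteq> {}"
  shows "extremal e s I \<noteq> {}"
proof (cases e)
  case True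
  have "Max (s ` I) \<in> s ` I" using assms by (intro Max_in) auto
  then obtain i where "i \<in> I" "s i = Max (s ` I)" by auto
  then have "i \<in> extremal e s I" using True assms by (auto simp: extremal_def)
  then show ?thesis by blast
next
  case False
  have "Min (s ` I) \<in> s ` I" using assms by (intro Min_in) auto
  then obtain i where "i \<in> I" "s i = Min (s ` I)" by auto
  then have "i \<in> extremal e s I" using False assms by (auto simp: extremal_def)
  then show ?thesis by blast
qed

text \<open>A residue that is not 0 generates the integers modulo a prime.\<close>

lemma invariant_under_shift_prime:
  assumes q: "Factorial_Ring.prime q" and k: "\<not> int q dvd k"
    and per: "\<And>i j. i mod int q = j mod int q \<Longrightarrow> P i = P j"
    and inv: "\<And>i. P i \<Longrightarrow> P (i - k)" and "P i"
  shows "P j"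
proof -
  have it: "P (i - int n * k)" for n
  proof (induction n)
    case (Suc n)
    then show ?case using inv[of "i - int n * k"] by (simp add: algebra_simps)
  qed (simp add: \<open>P i\<close>)
  have "coprime (int q) k" using q k by (intro prime_imp_coprime) auto
  then have "coprime k (int q)" by (simp add: coprime_commute)
  then obtain x where x: "[k * x = 1] (mod int q)" using cong_solve_coprime_int by blast
  define n where "n = nat ((x * (i - j)) mod int q)"
  have q0: "0 < int q" using q prime_gt_0_nat by simp
  have "[int n = x * (i - j)] (mod int q)" using q0 by (simp add: n_def unique_euclidean_semiring_class.cong_def)
  then have "[int n * k = x * (i - j) * k] (mod int q)" by (rule cong_scalar_right)
  also have "x * (i - j) * k = (k * x) * (i - j)" by (simp add: algebra_simps)
  also have "[(k * x) * (i - j) = 1 * (i - j)] (mod int q)" using x by (rule cong_scalar_right)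
  finally have "[i - int n * k = i - 1 * (i - j)] (mod int q)" by (intro cong_diff cong_refl)
  moreover have "i - 1 * (i - j) = j" by simp
  ultimately have "(i - int n * k) mod int q = j mod int q" by (simp only: unique_euclidean_semiring_class.cong_def)
  then show ?thesis using per it by blast
qed

text \<open>The shift \<open>k\<close> is chosen for the set of the indices of maximal rate. For the minimal rate every \<open>k\<close> prime to
\<open>q\<close> will do. If the minimum is the rate of the value 1, then it is attained only at that value, and all
other values have smaller real parts. Otherwise it is attained exactly where the real part is
minimal, because the rate increases with the real part away from 1, and 1 has the largest real
part. So in either case the real parts of the summands have the same sign; they do not all vanish,
because the set of indices is not invariant under the shift by \<open>k\<close>.\<close>

lemma extremal_shift_sums:
  fixes \<psi> :: "int \<Rightarrow> complex"
  assumes q: "Factorial_Ring.prime q" "odd q" and d: "coprime d 6"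
    and root: "\<And>i. \<psi> i ^ d = 1"
    and per: "\<And>i j. i mod int q = j mod int q \<Longrightarrow> \<psi> i = \<psi> j"
    and nc: "bass_rate (\<psi> a) \<noteq> bass_rate (\<psi> b)"
  defines "I \<equiv> {0..<int q}" and "s \<equiv> \<lambda>i. bass_rate (\<psi> i)"
  shows "\<exists>k. \<not> int q dvd k \<and> (\<forall>e. (\<Sum>i\<in>extremal e s I. \<psi> i - \<psi> (i - k)) \<noteq> 0)"
proof -
  have q0: "0 < q" using q prime_gt_0_nat by blast
  have I: "finite I" "I \<noteq> {}" using q0 by (auto simp: I_def)
  have modI: "i mod int q \<in> I" for i using q0 by (simp add: I_def)
  have pers: "s i = s j" if "i mod int q = j mod int q" for i j
    using per[OF that] by (simp add: s_def)
  have smod: "s (i mod int q) = s i" for i by (rule pers) simp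
  have nc': "\<exists>i\<in>I. s i \<noteq> x" for x
    using nc modI smod by (metis s_def)
  have ex_proper: "extremal e s I \<subset> I" for e
  proof -
    have "extremal e s I \<noteq> I"
    proof
      assume eq: "extremal e s I = I"
      then have "s i = s j" if "i \<in> I" "j \<in> I" for i j
      proof -
        have "i \<in> extremal e s I" "j \<in> extremal e s I" using eq that by auto
        then have "(if e then s i \<le> s j else s j \<le> s i)" "(if e then s j \<le> s i else s i \<le> s j)"
          using that by (simp_all add: extremal_def)
        then show ?thesis by (cases e) simp_all
      qed
      then show False using nc' I by blast
    qed
    then show ?thesis unfolding extremal_def by blast
  qed
  define r where "r i = Re (\<psi> i)" for i
  have perr: "r i = r j" if "i mod int q = j mod int q" for i j
    using per[OF that] by (simp add: r_def)
  have "r a \<noteq> r b"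
  proof
    assume eq: "r a = r b"
    show False
    proof (cases "\<psi> a = 1 \<or> \<psi> b = 1")
      case True
      have "\<psi> i = 1 \<longleftrightarrow> r i = 1" for i
        using root_Re_less_1[OF root d, of i] by (cases "\<psi> i = 1") (auto simp: r_def)
      then have "\<psi> a = 1" "\<psi> b = 1" using eq True by auto
      then show False using nc by simp
    next
      case False
      then show False using nc eq by (simp add: bass_rate_def r_def)
    qed
  qed
  moreover have "extremal True s I \<subset> {0..<int q}" using ex_proper I_def by blast
  ultimately obtain k where k: "(\<Sum>i\<in>extremal True s I. r (i - k)) \<noteq> (\<Sum>i\<in>extremal True s I. r i)"
    using shifted_sums_distinguish[where r=r, OF q perr] extremal_nonempty[OF I] by metis
  have nk: "\<not> int q dvd k"
  proof
    assume "int q dvd k"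
    then have "r (i - k) = r i" for i by (intro perr) (metis diff_zero mod_diff_right_eq dvd_imp_mod_0)
    then show False using k by simp
  qed
  have Re_sum: "Re (\<Sum>i\<in>E. \<psi> i - \<psi> (i - k)) = (\<Sum>i\<in>E. r i - r (i - k))" for E
    by (simp add: r_def)
  have "(\<Sum>i\<in>extremal True s I. \<psi> i - \<psi> (i - k)) \<noteq> 0"
  proof
    assume "(\<Sum>i\<in>extremal True s I. \<psi> i - \<psi> (i - k)) = 0"
    then have "(\<Sum>i\<in>extremal True s I. r i - r (i - k)) = 0" by (metis Re_sum zero_complex.sel(1))
    then show False using k by (simp add: sum_subtractf)
  qed
  moreover have "(\<Sum>i\<in>extremal False s I. \<psi> i - \<psi> (i - k)) \<noteq> 0"
  proof -
    let ?E = "extremal False s I"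
    have fE: "finite ?E" using ex_proper[of False] I finite_subset by blast
    obtain i0 where i0: "i0 \<in> ?E" using extremal_nonempty[OF I, of False s] by blast
    have min: "s i0 \<le> s j" for j
      using i0 modI[of j] smod[of j] by (auto simp: extremal_def)
    have Eiff: "i \<in> ?E \<longleftrightarrow> i \<in> I \<and> s i = s i0" for i
      using i0 min by (auto simp: extremal_def intro: antisym)
    have "\<exists>i. s i = s i0 \<and> s (i - k) \<noteq> s i0"
    proof (rule ccontr)
      assume "\<not> ?thesis"
      then have inv: "s (i - k) = s i0" if "s i = s i0" for i using that by blast
      have "s j = s i0" for j
      proof (rule invariant_under_shift_prime[OF q(1) nk, of "\<lambda>i. s i = s i0" i0 j])
        show "(s i = s i0) = (s j = s i0)" if "i mod int q = j mod int q" for i j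
          by (simp only: pers[OF that])
      qed (simp_all only: inv)
      then show False using nc' by blast
    qed
    then obtain i where i: "s i = s i0" "s (i - k) \<noteq> s i0" by blast
    have i1: "i mod int q \<in> ?E" using Eiff modI smod i by auto
    have i2: "s (i mod int q - k) \<noteq> s i0"
      using i pers[of "i mod int q - k" "i - k"] by (simp add: mod_diff_left_eq)
    show ?thesis
    proof (cases "\<psi> i0 = 1")
      case True
      then have s0: "s i0 = 1" by (simp add: s_def bass_rate_def)
      have one: "\<psi> j = 1 \<longleftrightarrow> s j = s i0" for j
        using bass_rate_eq_1_iff[OF root d, of j] s0 by (simp add: s_def)
      have le: "r j \<le> 1" for j using root_Re_less_1[OF root d, of j] by (cases "\<psi> j = 1") (auto simp: r_def)
      have "0 < (\<Sum>i\<in>?E. r i - r (i - k))"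
      proof (rule sum_pos2[OF fE i1])
        have "\<psi> (i mod int q) = 1" "\<psi> (i mod int q - k) \<noteq> 1" using one i1 i2 Eiff by blast+
        then show "0 < r (i mod int q) - r (i mod int q - k)"
          using root_Re_less_1[OF root d, of "i mod int q - k"] by (simp add: r_def)
        show "0 \<le> r j - r (j - k)" if "j \<in> ?E" for j
        proof -
          have "\<psi> j = 1" using that Eiff one by blast
          then have "r j = 1" by (simp add: r_def)
          then show ?thesis using le[of "j - k"] by simp
        qed
      qed
      then show ?thesis using Re_sum[of ?E] by force
    next
      case False
      then have s0: "s i0 \<noteq> 1" using bass_rate_eq_1_iff[OF root d, of i0] by (simp add: s_def)
      have rE: "r j = r i0" if "s j = s i0" for j
      proof -
        have "\<psi> j \<noteq> 1" using that s0 by (auto simp: s_def bass_rate_def)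
        then show ?thesis using that False by (simp add: s_def bass_rate_def r_def)
      qed
      have lt: "r i0 < r j" if "s j \<noteq> s i0" for j
      proof (cases "\<psi> j = 1")
        case True
        then show ?thesis using root_Re_less_1[OF root d False] by (simp add: r_def)
      next
        case j: False
        then show ?thesis using min[of j] that False by (simp add: s_def bass_rate_def r_def)
      qed
      have "0 < (\<Sum>i\<in>?E. r (i - k) - r i)"
      proof (rule sum_pos2[OF fE i1])
        show "0 < r (i mod int q - k) - r (i mod int q)"
          using i1 lt[OF i2] rE[of "i mod int q"] Eiff by auto
        show "0 \<le> r (j - k) - r j" if "j \<in> ?E" for j
          using that Eiff rE[of j] rE[of "j - k"] lt[of "j - k"] by (cases "s (j - k) = s i0") auto
      qed
      then have "(\<Sum>i\<in>?E. r i - r (i - k)) \<noteq> 0" by (simp add: sum_subtractf)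
      then show ?thesis using Re_sum[of ?E] by force
    qed
  qed
  ultimately have "(\<Sum>i\<in>extremal e s I. \<psi> i - \<psi> (i - k)) \<noteq> 0" for e by (cases e) auto
  then show ?thesis using nk by blast
qed

text \<open>After division by \<open>L^n\<close> only the indices with \<open>\<mu> i = L\<close> survive in the limit.\<close>

lemma dominant_powers:
  fixes \<mu> :: "'i \<Rightarrow> real" and v :: "'i \<Rightarrow> complex"
  assumes I: "finite I" and L: "0 < L" and pos: "\<And>i. i \<in> I \<Longrightarrow> 0 < \<mu> i"
    and le: "\<And>i. i \<in> I \<Longrightarrow> \<mu> i \<le> L"
    and nz: "(\<Sum>i\<in>{i\<in>I. \<mu> i = L}. v i) \<noteq> 0"
  shows "\<exists>c>0. \<exists>N. \<forall>n\<ge>N. c * L ^ n \<le> cmod (\<Sum>i\<in>I. of_real (\<mu> i ^ n) * v i)"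
proof -
  let ?S = "\<Sum>i\<in>{i\<in>I. \<mu> i = L}. v i"
  let ?f = "\<lambda>n. \<Sum>i\<in>I. of_real ((\<mu> i / L) ^ n) * v i"
  have t: "(\<lambda>n. of_real ((\<mu> i / L) ^ n) * v i) \<longlonglongrightarrow> (if \<mu> i = L then v i else 0)" if "i \<in> I" for i
  proof (cases "\<mu> i = L")
    case True
    then show ?thesis using L by simp
  next
    case False
    then have "\<mu> i < L" using le[OF that] by simp
    then have "norm (\<mu> i / L) < 1" using pos[OF that] L by simp
    then have "(\<lambda>n. (\<mu> i / L) ^ n) \<longlonglongrightarrow> 0" by (rule LIMSEQ_power_zero)
    then have "(\<lambda>n. of_real ((\<mu> i / L) ^ n) * v i) \<longlonglongrightarrow> of_real 0 * v i"
      by (intro tendsto_mult tendsto_of_real tendsto_const)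
    then show ?thesis using False by simp
  qed
  have "?f \<longlonglongrightarrow> (\<Sum>i\<in>I. if \<mu> i = L then v i else 0)" by (intro tendsto_sum t)
  also have "(\<Sum>i\<in>I. if \<mu> i = L then v i else 0) = ?S" using I by (simp add: sum.inter_filter)
  finally have "(\<lambda>n. cmod (?f n)) \<longlonglongrightarrow> cmod ?S" by (rule tendsto_norm)
  moreover have "cmod ?S / 2 < cmod ?S" using nz by simp
  ultimately have "\<forall>\<^sub>F n in sequentially. cmod ?S / 2 < cmod (?f n)" by (rule order_tendstoD)
  then obtain N where N: "\<And>n. n \<ge> N \<Longrightarrow> cmod ?S / 2 < cmod (?f n)"
    by (auto simp: eventually_sequentially)
  have "cmod ?S / 2 * L ^ n \<le> cmod (\<Sum>i\<in>I. of_real (\<mu> i ^ n) * v i)" if "n \<ge> N" for n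
  proof -
    have "(\<Sum>i\<in>I. of_real (\<mu> i ^ n) * v i) = of_real (L ^ n) * ?f n"
      unfolding sum_distrib_left using L by (intro sum.cong) (auto simp: power_divide)
    then have "cmod (\<Sum>i\<in>I. of_real (\<mu> i ^ n) * v i) = L ^ n * cmod (?f n)"
      using L by (simp add: norm_mult norm_power del: of_real_power)
    then show ?thesis using N[OF that] L by (simp add: mult.commute)
  qed
  moreover have "0 < cmod ?S / 2" using nz by simp
  ultimately show ?thesis by blast
qed

section \<open>The integral group ring of a finite group\<close>

locale finite_group = group G for G (structure) +
  assumes fin: "finite (carrier G)"
begin

abbreviation ZG :: "('a \<Rightarrow> int) ring" where "ZG \<equiv> group_ring G"

lemma gr_carrier: "a \<in> carrier ZG \<longleftrightarrow> (\<forall>x. x \<notin> carrier G \<longrightarrow> a x = 0)"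
proof -
  have "{x. a x \<noteq> 0} \<subseteq> carrier G \<Longrightarrow> finite {x. a x \<noteq> 0}" using fin by (rule finite_subset[rotated])
  moreover have "{x. a x \<noteq> 0} \<subseteq> carrier G \<longleftrightarrow> (\<forall>x. x \<notin> carrier G \<longrightarrow> a x = 0)" by blast
  ultimately show ?thesis by (simp add: group_ring_def) blast
qed

lemma cancel_inv:
  assumes "w \<in> carrier G" "x \<in> carrier G"
  shows "w \<otimes> (inv w \<otimes> x) = x" "inv w \<otimes> (w \<otimes> x) = x"
  using assms by (simp_all add: m_assoc[symmetric])

lemma gr_add: "(a \<oplus>\<^bsub>ZG\<^esub> b) = (\<lambda>x. a x + b x)"
  and gr_zero: "\<zero>\<^bsub>ZG\<^esub> = (\<lambda>x. 0)"
  and gr_one: "\<one>\<^bsub>ZG\<^esub> = gr_embed \<one>"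
  by (simp_all add: group_ring_def gr_embed_def)

lemma gr_mult:
  assumes a: "a \<in> carrier ZG" and b: "b \<in> carrier ZG"
  shows "(a \<otimes>\<^bsub>ZG\<^esub> b) x =
    (if x \<in> carrier G then \<Sum>y\<in>carrier G. a y * b (inv y \<otimes> x) else 0)"
proof -
  have sa: "{x. a x \<noteq> 0} \<subseteq> carrier G" and sb: "{x. b x \<noteq> 0} \<subseteq> carrier G"
    using a b gr_carrier by auto
  have "(a \<otimes>\<^bsub>ZG\<^esub> b) x = (\<Sum>y | a y \<noteq> 0. \<Sum>z | b z \<noteq> 0. if y \<otimes> z = x then a y * b z else 0)"
    by (simp add: group_ring_def)
  also have "\<dots> = (\<Sum>y | a y \<noteq> 0. \<Sum>z\<in>carrier G. if y \<otimes> z = x then a y * b z else 0)"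
    using sb by (intro sum.cong refl sum.mono_neutral_left fin) auto
  also have "\<dots> = (\<Sum>y\<in>carrier G. \<Sum>z\<in>carrier G. if y \<otimes> z = x then a y * b z else 0)"
    using sa by (intro sum.mono_neutral_left fin) (auto intro!: sum.neutral)
  also have "\<dots> = (\<Sum>y\<in>carrier G. if x \<in> carrier G then a y * b (inv y \<otimes> x) else 0)"
  proof (rule sum.cong[OF refl])
    fix y assume y: "y \<in> carrier G"
    show "(\<Sum>z\<in>carrier G. if y \<otimes> z = x then a y * b z else 0) =
        (if x \<in> carrier G then a y * b (inv y \<otimes> x) else 0)"
    proof (cases "x \<in> carrier G")
      case True
      then have "(\<Sum>z\<in>carrier G. if y \<otimes> z = x then a y * b z else 0) =
          (\<Sum>z\<in>carrier G. if inv y \<otimes> x = z then a y * b z else 0)"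
        using y by (intro sum.cong refl) (metis inv_solve_left)
      then show ?thesis using True y fin by simp
    next
      case False
      then show ?thesis using y by (intro trans[OF sum.neutral]) auto
    qed
  qed
  also have "\<dots> = (if x \<in> carrier G then \<Sum>y\<in>carrier G. a y * b (inv y \<otimes> x) else 0)" by simp
  finally show ?thesis .
qed

lemma gr_mult_closed: "a \<in> carrier ZG \<Longrightarrow> b \<in> carrier ZG \<Longrightarrow> a \<otimes>\<^bsub>ZG\<^esub> b \<in> carrier ZG"
  by (simp add: gr_carrier[of "a \<otimes>\<^bsub>ZG\<^esub> b"] gr_mult)

lemma gr_embed_closed: "g \<in> carrier G \<Longrightarrow> gr_embed g \<in> carrier ZG"
  by (auto simp: gr_carrier gr_embed_def)

lemma gr_embed_mult:
  assumes g: "g \<in> carrier G" and a: "a \<in> carrier ZG" and x: "x \<in> carrier G"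
  shows "(gr_embed g \<otimes>\<^bsub>ZG\<^esub> a) x = a (inv g \<otimes> x)"
proof -
  have "(gr_embed g \<otimes>\<^bsub>ZG\<^esub> a) x = (\<Sum>y\<in>carrier G. if y = g then a (inv y \<otimes> x) else 0)"
    unfolding gr_mult[OF gr_embed_closed[OF g] a] using x by (auto simp: gr_embed_def intro!: sum.cong)
  then show ?thesis using g fin by simp
qed

lemma gr_embed_mult_embed:
  assumes "g \<in> carrier G" "h \<in> carrier G"
  shows "gr_embed g \<otimes>\<^bsub>ZG\<^esub> gr_embed h = gr_embed (g \<otimes> h)"
proof
  fix x
  show "(gr_embed g \<otimes>\<^bsub>ZG\<^esub> gr_embed h) x = gr_embed (g \<otimes> h) x"
  proof (cases "x \<in> carrier G")
    case True
    then have "inv g \<otimes> x = h \<longleftrightarrow> x = g \<otimes> h" using assms by (metis inv_solve_left)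
    then show ?thesis using True assms by (simp add: gr_embed_mult gr_embed_closed) (simp add: gr_embed_def)
  next
    case False
    then have "x \<noteq> g \<otimes> h" using assms by auto
    then show ?thesis using False assms by (simp add: gr_mult gr_embed_closed) (simp add: gr_embed_def)
  qed
qed

lemma ring_ZG: "ring ZG"
proof (rule ringI)
  show "abelian_group ZG"
  proof (rule abelian_groupI)
    fix a assume a: "a \<in> carrier ZG"
    show "\<exists>y\<in>carrier ZG. y \<oplus>\<^bsub>ZG\<^esub> a = \<zero>\<^bsub>ZG\<^esub>"
      using a by (intro bexI[of _ "\<lambda>x. - a x"]) (auto simp: gr_add gr_zero gr_carrier)
  qed (auto simp: gr_carrier gr_add gr_zero algebra_simps)
  show "monoid ZG"
  proof (rule monoidI)
    fix a b c assume abc: "a \<in> carrier ZG" "b \<in> carrier ZG" "c \<in> carrier ZG"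
    show "a \<otimes>\<^bsub>ZG\<^esub> b \<otimes>\<^bsub>ZG\<^esub> c = a \<otimes>\<^bsub>ZG\<^esub> (b \<otimes>\<^bsub>ZG\<^esub> c)"
    proof
      fix x
      show "(a \<otimes>\<^bsub>ZG\<^esub> b \<otimes>\<^bsub>ZG\<^esub> c) x = (a \<otimes>\<^bsub>ZG\<^esub> (b \<otimes>\<^bsub>ZG\<^esub> c)) x"
      proof (cases "x \<in> carrier G")
        case False
        then show ?thesis using abc by (simp add: gr_mult gr_mult_closed)
      next
        case x: True
        have "(a \<otimes>\<^bsub>ZG\<^esub> b \<otimes>\<^bsub>ZG\<^esub> c) x =
            (\<Sum>y\<in>carrier G. \<Sum>w\<in>carrier G. a w * b (inv w \<otimes> y) * c (inv y \<otimes> x))"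
          using x abc by (simp add: gr_mult gr_mult_closed sum_distrib_right)
        also have "\<dots> = (\<Sum>w\<in>carrier G. \<Sum>y\<in>carrier G. a w * b (inv w \<otimes> y) * c (inv y \<otimes> x))"
          by (rule sum.swap)
        also have "\<dots> = (\<Sum>w\<in>carrier G. \<Sum>v\<in>carrier G. a w * (b v * c (inv v \<otimes> (inv w \<otimes> x))))"
        proof (rule sum.cong[OF refl])
          fix w assume w: "w \<in> carrier G"
          show "(\<Sum>y\<in>carrier G. a w * b (inv w \<otimes> y) * c (inv y \<otimes> x)) =
              (\<Sum>v\<in>carrier G. a w * (b v * c (inv v \<otimes> (inv w \<otimes> x))))"
            by (rule sum.reindex_bij_witness[where i="\<lambda>v. w \<otimes> v" and j="\<lambda>y. inv w \<otimes> y"])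
              (use w x in \<open>simp_all add: m_assoc inv_mult_group cancel_inv\<close>)
        qed
        also have "\<dots> = (a \<otimes>\<^bsub>ZG\<^esub> (b \<otimes>\<^bsub>ZG\<^esub> c)) x"
          using x abc by (simp add: gr_mult gr_mult_closed sum_distrib_left)
        finally show ?thesis .
      qed
    qed
  next
    fix a assume a: "a \<in> carrier ZG"
    show "\<one>\<^bsub>ZG\<^esub> \<otimes>\<^bsub>ZG\<^esub> a = a"
    proof
      fix x show "(\<one>\<^bsub>ZG\<^esub> \<otimes>\<^bsub>ZG\<^esub> a) x = a x"
        using a gr_embed_mult[OF one_closed a, of x] gr_mult_closed[OF gr_embed_closed[OF one_closed] a]
        by (cases "x \<in> carrier G") (auto simp: gr_one gr_carrier)
    qed
    show "a \<otimes>\<^bsub>ZG\<^esub> \<one>\<^bsub>ZG\<^esub> = a"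
    proof
      fix x
      show "(a \<otimes>\<^bsub>ZG\<^esub> \<one>\<^bsub>ZG\<^esub>) x = a x"
      proof (cases "x \<in> carrier G")
        case True
        have "(a \<otimes>\<^bsub>ZG\<^esub> gr_embed \<one>) x = (\<Sum>y\<in>carrier G. if y = x then a y else 0)"
          using True unfolding gr_mult[OF a gr_embed_closed[OF one_closed]]
          by (auto simp: gr_embed_def intro!: sum.cong) (metis inv_equality inv_inv inv_closed)
        then show ?thesis using True fin by (simp add: gr_one)
      next
        case False
        then show ?thesis using a by (simp add: gr_one gr_mult gr_embed_closed) (simp add: gr_carrier)
      qed
    qed
  qed (auto simp: gr_mult_closed gr_one gr_embed_closed)
  fix a b c assume abc: "a \<in> carrier ZG" "b \<in> carrier ZG" "c \<in> carrier ZG"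
  have add_cl: "(\<lambda>x. a x + b x) \<in> carrier ZG" using abc by (simp add: gr_carrier)
  show "(a \<oplus>\<^bsub>ZG\<^esub> b) \<otimes>\<^bsub>ZG\<^esub> c = a \<otimes>\<^bsub>ZG\<^esub> c \<oplus>\<^bsub>ZG\<^esub> b \<otimes>\<^bsub>ZG\<^esub> c"
    using abc add_cl by (auto simp: gr_add gr_mult fun_eq_iff sum.distrib algebra_simps)
  show "c \<otimes>\<^bsub>ZG\<^esub> (a \<oplus>\<^bsub>ZG\<^esub> b) = c \<otimes>\<^bsub>ZG\<^esub> a \<oplus>\<^bsub>ZG\<^esub> c \<otimes>\<^bsub>ZG\<^esub> b"
    using abc add_cl by (auto simp: gr_add gr_mult fun_eq_iff sum.distrib algebra_simps)
qed

sublocale R: ring ZG by (rule ring_ZG)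

lemma gr_minus:
  assumes "a \<in> carrier ZG" shows "\<ominus>\<^bsub>ZG\<^esub> a = (\<lambda>x. - a x)"
proof -
  have "(\<lambda>x. - a x) \<in> carrier ZG" using assms by (simp add: gr_carrier)
  moreover have "(\<lambda>x. - a x) \<oplus>\<^bsub>ZG\<^esub> a = \<zero>\<^bsub>ZG\<^esub>" by (simp add: gr_add gr_zero)
  ultimately show ?thesis using assms R.minus_equality by blast
qed

lemma gr_diff: "a \<in> carrier ZG \<Longrightarrow> b \<in> carrier ZG \<Longrightarrow> a \<ominus>\<^bsub>ZG\<^esub> b = (\<lambda>x. a x - b x)"
  by (simp add: a_minus_def gr_minus gr_add)

lemma gr_add_pow:
  assumes a: "a \<in> carrier ZG" shows "add_pow ZG (k::int) a = (\<lambda>x. k * a x)"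
proof -
  have nat: "add_pow ZG (n::nat) a = (\<lambda>x. int n * a x)" for n
    by (induction n) (simp_all add: a gr_zero gr_add algebra_simps)
  show ?thesis
  proof (cases "0 \<le> k")
    case True
    then have "add_pow ZG k a = add_pow ZG (nat k) a"
      by (rule add_pow_int_ge)
    then show ?thesis using True by (simp add: nat)
  next
    case False
    then have "add_pow ZG k a = \<ominus>\<^bsub>ZG\<^esub> (add_pow ZG (nat (- k)) a)"
      by (simp add: add_pow_int_lt)
    moreover have "add_pow ZG (nat (- k)) a \<in> carrier ZG" using a by (rule R.add.nat_pow_closed)
    ultimately show ?thesis using False by (simp add: gr_minus nat)
  qed
qed

lemma gr_finsum:
  assumes "\<And>i. i < n \<Longrightarrow> f i \<in> carrier ZG"
  shows "(\<Oplus>\<^bsub>ZG\<^esub>i\<in>{..<n::nat}. f i) = (\<lambda>x. \<Sum>i<n. f i x)"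
  using assms
proof (induction n)
  case (Suc n)
  have "(\<Oplus>\<^bsub>ZG\<^esub>i\<in>{..<Suc n}. f i) = f n \<oplus>\<^bsub>ZG\<^esub> (\<Oplus>\<^bsub>ZG\<^esub>i\<in>{..<n}. f i)"
    unfolding lessThan_Suc using Suc.prems by (intro R.finsum_insert) auto
  then show ?case using Suc by (simp add: gr_add add.commute)
qed (simp add: gr_zero)

lemma gr_geom_eq:
  assumes "g \<in> carrier G"
  shows "gr_geom G g n = (\<lambda>x. \<Sum>i<n. gr_embed (g [^] i) x)"
  unfolding gr_geom_def using assms by (intro gr_finsum gr_embed_closed) auto

lemma gr_geom_closed: "g \<in> carrier G \<Longrightarrow> gr_geom G g n \<in> carrier ZG"
  unfolding gr_geom_def by (intro R.finsum_closed) (auto intro: gr_embed_closed)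

text \<open>Identities in the subring generated by \<open>g\<close> are proved for polynomials, where arithmetic is commutative, and
carried over by this ring homomorphism.\<close>

definition gr_eval :: "'a \<Rightarrow> int poly \<Rightarrow> 'a \<Rightarrow> int" where
  "gr_eval g p = (\<lambda>x. \<Sum>l\<le>Polynomial.degree p. Polynomial.coeff p l * gr_embed (g [^] l) x)"

context
  fixes g assumes g: "g \<in> carrier G"
begin

lemma gr_eval_bound:
  assumes "Polynomial.degree p \<le> n"
  shows "gr_eval g p x = (\<Sum>l\<le>n. Polynomial.coeff p l * gr_embed (g [^] l) x)"
  unfolding gr_eval_def using assms
  by (intro sum.mono_neutral_left) (auto simp: Polynomial.coeff_eq_0)

lemma gr_eval_closed: "gr_eval g p \<in> carrier ZG"
  unfolding gr_carrier gr_eval_def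
  using gr_embed_closed[OF nat_pow_closed[OF g]] by (auto simp: gr_carrier intro!: sum.neutral)

lemma gr_eval_add: "gr_eval g (p + r) = gr_eval g p \<oplus>\<^bsub>ZG\<^esub> gr_eval g r"
proof
  fix x
  let ?n = "max (Polynomial.degree p) (Polynomial.degree r)"
  show "gr_eval g (p + r) x = (gr_eval g p \<oplus>\<^bsub>ZG\<^esub> gr_eval g r) x"
    using gr_eval_bound[of p ?n x] gr_eval_bound[of r ?n x] gr_eval_bound[of "p + r" ?n x]
    by (simp add: gr_add Polynomial.degree_add_le sum.distrib algebra_simps)
qed

lemma gr_eval_smult: "gr_eval g (Polynomial.smult c p) = (\<lambda>x. c * gr_eval g p x)"
  using gr_eval_bound[of "Polynomial.smult c p" "Polynomial.degree p"]
  by (simp add: fun_eq_iff gr_eval_def sum_distrib_left mult.assoc degree_smult_le)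

lemma gr_eval_monom: "gr_eval g (Polynomial.monom c n) = (\<lambda>x. c * gr_embed (g [^] n) x)"
  using gr_eval_bound[of "Polynomial.monom c n" n] Polynomial.degree_monom_le[of c n]
  by (simp add: fun_eq_iff if_distrib[of "\<lambda>a. a * _"] cong: if_cong)

lemma gr_eval_0: "gr_eval g 0 = \<zero>\<^bsub>ZG\<^esub>"
  by (simp add: gr_eval_def gr_zero)

lemma gr_eval_1: "gr_eval g 1 = \<one>\<^bsub>ZG\<^esub>"
  by (simp add: gr_eval_def gr_one)

lemma gr_eval_pCons_0: "gr_eval g (pCons 0 p) = gr_embed g \<otimes>\<^bsub>ZG\<^esub> gr_eval g p"
proof
  fix x
  have cl: "gr_embed (g [^] l) \<in> carrier ZG" for l :: nat using g by (simp add: gr_embed_closed)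
  have "gr_eval g (pCons 0 p) x =
      (\<Sum>l\<le>Suc (Polynomial.degree p). Polynomial.coeff (pCons 0 p) l * gr_embed (g [^] l) x)"
    by (intro gr_eval_bound) (simp add: Polynomial.degree_pCons_le)
  also have "\<dots> = (\<Sum>l\<le>Polynomial.degree p. Polynomial.coeff p l * gr_embed (g [^] Suc l) x)"
    by (subst sum.atMost_Suc_shift) simp
  also have "\<dots> = (\<Sum>l\<le>Polynomial.degree p. Polynomial.coeff p l * (gr_embed g \<otimes>\<^bsub>ZG\<^esub> gr_embed (g [^] l)) x)"
    using g by (simp add: gr_embed_mult_embed nat_pow_Suc2[symmetric] del: nat_pow_Suc)
  also have "\<dots> = (gr_embed g \<otimes>\<^bsub>ZG\<^esub> gr_eval g p) x"
  proof (cases "x \<in> carrier G")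
    case True
    then show ?thesis
      using g cl gr_eval_closed by (simp add: gr_embed_mult) (simp add: gr_eval_def)
  next
    case False
    then show ?thesis using g cl gr_eval_closed gr_embed_closed[OF g] by (simp add: gr_mult)
  qed
  finally show "gr_eval g (pCons 0 p) x = (gr_embed g \<otimes>\<^bsub>ZG\<^esub> gr_eval g p) x" .
qed

lemma gr_eval_mult: "gr_eval g (p * r) = gr_eval g p \<otimes>\<^bsub>ZG\<^esub> gr_eval g r"
proof (induction p)
  case 0
  then show ?case by (simp add: gr_eval_0 gr_eval_closed)
next
  case (pCons c p)
  have ge: "gr_embed g \<in> carrier ZG" using g by (rule gr_embed_closed)
  have c_act: "gr_eval g (Polynomial.smult c r) = gr_eval g [:c:] \<otimes>\<^bsub>ZG\<^esub> gr_eval g r"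
  proof -
    have "gr_eval g [:c:] = (\<lambda>x. c * gr_embed \<one> x)" by (simp add: gr_eval_def fun_eq_iff)
    moreover have "(\<lambda>x. c * gr_embed \<one> x) \<otimes>\<^bsub>ZG\<^esub> a = (\<lambda>x. c * a x)" if a: "a \<in> carrier ZG" for a
    proof -
      have e: "gr_embed \<one> \<in> carrier ZG" by (simp add: gr_embed_closed)
      have "(\<lambda>x. c * gr_embed \<one> x) \<otimes>\<^bsub>ZG\<^esub> a = add_pow ZG c (gr_embed \<one>) \<otimes>\<^bsub>ZG\<^esub> a"
        by (simp add: gr_add_pow[OF e])
      also have "\<dots> = add_pow ZG c a"
        using R.add_pow_ldistr_int[OF e a, of c] a by (simp add: gr_one[symmetric])
      finally show ?thesis by (simp add: gr_add_pow[OF a])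
    qed
    ultimately show ?thesis by (simp add: gr_eval_smult gr_eval_closed)
  qed
  have split: "pCons c p = [:c:] + pCons 0 p" by simp
  have "gr_eval g (pCons c p * r) = gr_eval g (Polynomial.smult c r) \<oplus>\<^bsub>ZG\<^esub> gr_eval g (pCons 0 (p * r))"
    by (simp add: gr_eval_add[symmetric])
  also have "\<dots> = gr_eval g [:c:] \<otimes>\<^bsub>ZG\<^esub> gr_eval g r
      \<oplus>\<^bsub>ZG\<^esub> (gr_embed g \<otimes>\<^bsub>ZG\<^esub> gr_eval g p) \<otimes>\<^bsub>ZG\<^esub> gr_eval g r"
    by (simp add: c_act gr_eval_pCons_0 pCons.IH R.m_assoc ge gr_eval_closed)
  also have "\<dots> = gr_eval g (pCons c p) \<otimes>\<^bsub>ZG\<^esub> gr_eval g r"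
    by (simp only: split gr_eval_add gr_eval_pCons_0 R.l_distr gr_eval_closed R.m_closed ge)
  finally show ?case .
qed

lemma gr_eval_power: "gr_eval g (p ^ n) = gr_eval g p [^]\<^bsub>ZG\<^esub> n"
  by (induction n) (simp_all add: gr_eval_1 gr_eval_mult power_Suc2 del: power_Suc)

lemma gr_eval_sum_monom: "gr_eval g (\<Sum>i<n. Polynomial.monom 1 i) = gr_geom G g n"
  by (induction n) (simp_all add: gr_eval_0 gr_eval_add gr_eval_monom gr_geom_eq[OF g] gr_zero gr_add add.commute)

end

end

section \<open>Bass cyclic units, bicyclic units and a monomial representation\<close>

lemma dvd_diff_mult:
  fixes w :: "'a::comm_ring_1"
  assumes "w dvd a - b" "w dvd c - e"
  shows "w dvd a * c - b * e"
proof -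
  have "a * c - b * e = (a - b) * c + b * (c - e)" by (simp add: algebra_simps)
  then show ?thesis using assms by simp
qed

lemma dvd_diff_trans:
  fixes w :: "'a::comm_ring_1"
  assumes "w dvd a - b" "w dvd b - c"
  shows "w dvd a - c"
  using dvd_add[OF assms] by simp

lemma dvd_diff_add:
  fixes w :: "'a::comm_ring_1"
  assumes "w dvd a - b" "w dvd c - e"
  shows "w dvd (a + c) - (b + e)"
  using dvd_add[OF assms] by (simp add: algebra_simps)

lemma dvd_diff_power:
  fixes w :: "'a::comm_ring_1"
  assumes "w dvd a - b"
  shows "w dvd a ^ n - b ^ n"
  using assms by (induction n) (auto intro: dvd_diff_mult)

text \<open>Modulo \<open>x^d - 1\<close>, multiplying a polynomial by \<open>N\<close> amounts to multiplying its value at 1 by \<open>N\<close>. As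
\<open>2 l = d + 1\<close>, the product of \<open>1 + x\<close> and the sum of the \<open>x^(2 i)\<close> with \<open>i < l\<close> is the sum of the powers up to \<open>x^d\<close>,
that is, \<open>1 + N\<close>. So the whole product is 1 plus a multiple of \<open>N\<close>, and \<open>c\<close> and \<open>c'\<close> are such that
the multiplier is 0.\<close>

lemma cyclotomic_bass_inverse:
  fixes x :: "'a::comm_ring_1" and d l m :: nat and c c' :: int
  assumes d: "0 < d" and l: "2 * l = d + 1"
    and c: "int d * c = 1 - 2 ^ m" and c': "int d * c' = 1 - int l ^ m"
  defines "N \<equiv> \<Sum>i<d. x ^ i"
  shows "x ^ d - 1 dvd ((1 + x) ^ m + of_int c * N) * ((\<Sum>i<l. x ^ (2 * i)) ^ m + of_int c' * N) - 1"
proof -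
  let ?w = "x ^ d - 1" and ?S = "1 + x" and ?S' = "\<Sum>i<l. x ^ (2 * i)"
  have NX: "N * x - N = ?w"
    using power_diff_1_eq[of x d] by (simp add: N_def algebra_simps)
  have absorb_x: "?w dvd x ^ n * N - N" for n
  proof (induction n)
    case (Suc n)
    have "?w dvd x * (x ^ n * N) - x * N" by (rule dvd_diff_mult[OF _ Suc]) simp
    moreover have "?w dvd x * N - N" using NX by (simp add: mult.commute)
    ultimately have "?w dvd x * (x ^ n * N) - N" by (rule dvd_diff_trans)
    then show ?case by (simp add: mult.assoc)
  qed simp
  have absorb_sum: "?w dvd (\<Sum>i<k. x ^ f i) * N - of_int (int k) * N" for k :: nat and f :: "nat \<Rightarrow> nat"
  proof (induction k)
    case (Suc k)
    have "?w dvd ((\<Sum>i<k. x ^ f i) * N + x ^ f k * N) - (of_int (int k) * N + N)"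
      by (intro dvd_diff_add Suc absorb_x)
    then show ?case by (simp add: algebra_simps)
  qed simp
  have absorb_pow: "?w dvd a ^ n * N - of_int (k ^ n) * N" if "?w dvd a * N - of_int k * N" for a n k
  proof (induction n)
    case (Suc n)
    have "?w dvd a * (a ^ n * N) - a * (of_int (k ^ n) * N)" by (rule dvd_diff_mult[OF _ Suc]) simp
    moreover have "?w dvd of_int (k ^ n) * (a * N) - of_int (k ^ n) * (of_int k * N)"
      by (rule dvd_diff_mult[OF _ that]) simp
    moreover have "a * (of_int (k ^ n) * N) = of_int (k ^ n) * (a * N)" by (rule mult.left_commute)
    ultimately have "?w dvd a * (a ^ n * N) - of_int (k ^ n) * (of_int k * N)"
      using dvd_diff_trans by metis
    moreover have "a ^ Suc n * N = a * (a ^ n * N)" by (simp add: mult.assoc)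
    moreover have "of_int (k ^ Suc n) * N = of_int (k ^ n) * (of_int k * N)"
      by (simp add: mult.assoc mult.left_commute)
    ultimately show ?case by (simp only:)
  qed simp
  have NN: "?w dvd N * N - of_int (int d) * N"
    using absorb_sum[of "\<lambda>i. i" d] by (simp add: N_def)
  have SN: "?w dvd ?S ^ m * N - of_int (2 ^ m) * N"
  proof (rule absorb_pow)
    have "(\<Sum>i<(2::nat). x ^ i) = ?S" by (simp add: numeral_2_eq_2)
    then show "?w dvd ?S * N - of_int 2 * N" using absorb_sum[of "\<lambda>i. i" 2] by simp
  qed
  have S'N: "?w dvd ?S' ^ m * N - of_int (int l ^ m) * N"
    by (rule absorb_pow) (rule absorb_sum)
  have SS': "?S * ?S' = 1 + N + ?w"
  proof -
    have "?S * ?S' = (\<Sum>i<2 * l. x ^ i)"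
      by (induction l) (simp_all add: algebra_simps)
    also have "\<dots> = N + x ^ d" unfolding l N_def by simp
    finally show ?thesis by simp
  qed
  have "?w dvd (?S * ?S') ^ m - (1 + N) ^ m" by (rule dvd_diff_power) (simp add: SS')
  moreover have "\<exists>e. int d * e = (1 + int d) ^ n - 1 \<and> ?w dvd (1 + N) ^ n - (1 + of_int e * N)" for n
  proof (induction n)
    case 0
    show ?case by (intro exI[of _ 0]) simp
  next
    case (Suc n)
    then obtain e where e: "int d * e = (1 + int d) ^ n - 1"
      and de: "?w dvd (1 + N) ^ n - (1 + of_int e * N)" by blast
    let ?e = "1 + e + e * int d"
    have "int d * ?e = int d + (1 + int d) * (int d * e)" by (simp add: algebra_simps)
    then have 1: "int d * ?e = (1 + int d) ^ Suc n - 1" unfolding e by (simp add: algebra_simps)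
    have "?w dvd (1 + N) * (1 + N) ^ n - (1 + N) * (1 + of_int e * N)"
      by (rule dvd_diff_mult[OF _ de]) simp
    moreover have "(1 + N) * (1 + of_int e * N) - (1 + of_int ?e * N)
        = of_int e * (N * N - of_int (int d) * N)" by (simp add: algebra_simps)
    then have "?w dvd (1 + N) * (1 + of_int e * N) - (1 + of_int ?e * N)" using NN by simp
    ultimately have "?w dvd (1 + N) * (1 + N) ^ n - (1 + of_int ?e * N)" by (rule dvd_diff_trans)
    then show ?case using 1 by (intro exI[of _ ?e]) simp
  qed
  ultimately obtain e where e: "int d * e = (1 + int d) ^ m - 1"
    and de: "?w dvd (?S * ?S') ^ m - (1 + of_int e * N)" using dvd_diff_trans by metis
  \<comment> \<open>the multiplier of \<open>N\<close> in the product\<close>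
  let ?t = "e + c * int l ^ m + c' * 2 ^ m + c * c' * int d"
  have "1 + int d = 2 * int l" using l by simp
  then have "int d * ?t = ((2 * int l) ^ m - 1) + (int d * c) * int l ^ m + (int d * c') * 2 ^ m
      + (int d * c) * (int d * c')"
    using e by (simp add: algebra_simps)
  also have "\<dots> = 0" unfolding c c' by (simp add: algebra_simps power_mult_distrib)
  finally have t: "?t = 0" using d by simp
  have p1: "?w dvd of_int c * (?S' ^ m * N) - of_int c * (of_int (int l ^ m) * N)"
    by (rule dvd_diff_mult[OF _ S'N]) simp
  have p2: "?w dvd of_int c' * (?S ^ m * N) - of_int c' * (of_int (2 ^ m) * N)"
    by (rule dvd_diff_mult[OF _ SN]) simp
  have p3: "?w dvd of_int (c * c') * (N * N) - of_int (c * c') * (of_int (int d) * N)"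
    by (rule dvd_diff_mult[OF _ NN]) simp
  have "?w dvd ((?S * ?S') ^ m + of_int c * (?S' ^ m * N) + of_int c' * (?S ^ m * N)
       + of_int (c * c') * (N * N))
     - ((1 + of_int e * N) + of_int c * (of_int (int l ^ m) * N) + of_int c' * (of_int (2 ^ m) * N)
       + of_int (c * c') * (of_int (int d) * N))"
    by (intro dvd_diff_add de p1 p2 p3)
  moreover have "(?S * ?S') ^ m + of_int c * (?S' ^ m * N) + of_int c' * (?S ^ m * N)
       + of_int (c * c') * (N * N) = (?S ^ m + of_int c * N) * (?S' ^ m + of_int c' * N)"
    unfolding power_mult_distrib of_int_mult by (simp add: algebra_simps)
  moreover have "(1 + of_int e * N) + of_int c * (of_int (int l ^ m) * N) + of_int c' * (of_int (2 ^ m) * N)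
       + of_int (c * c') * (of_int (int d) * N) = 1 + of_int ?t * N"
    by (simp add: algebra_simps)
  then have "(1 + of_int e * N) + of_int c * (of_int (int l ^ m) * N) + of_int c' * (of_int (2 ^ m) * N)
       + of_int (c * c') * (of_int (int d) * N) = 1"
    by (simp only: t of_int_0 mult_zero_left add_0_right)
  ultimately show ?thesis by (simp only:)
qed

context finite_group
begin

lemma ord_pos: "g \<in> carrier G \<Longrightarrow> 0 < ord g"
  using ord_ge_1[OF fin] by force

lemma gr_eval_cyclotomic:
  assumes g: "g \<in> carrier G"
  shows "gr_eval g (Polynomial.monom 1 (ord g) - 1) = \<zero>\<^bsub>ZG\<^esub>"
proof -
  have "Polynomial.monom 1 (ord g) - 1 = Polynomial.monom 1 (ord g) + Polynomial.smult (- 1) (1 :: int poly)"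
    by (simp add: one_pCons)
  then show ?thesis
    using g by (simp only: gr_eval_add[OF g] gr_eval_smult[OF g] gr_eval_monom[OF g] gr_eval_1[OF g])
      (simp add: gr_add gr_one gr_zero pow_ord_eq_1)
qed

lemma gr_eval_eq_one:
  assumes g: "g \<in> carrier G" and dvd: "Polynomial.monom 1 (ord g) - 1 dvd p - 1"
  shows "gr_eval g p = \<one>\<^bsub>ZG\<^esub>"
proof -
  obtain r where "p - 1 = (Polynomial.monom 1 (ord g) - 1) * r" using dvd by blast
  then have "p = 1 + (Polynomial.monom 1 (ord g) - 1) * r" by (simp add: algebra_simps)
  then show ?thesis
    by (simp only: gr_eval_add[OF g] gr_eval_mult[OF g] gr_eval_cyclotomic[OF g] gr_eval_1[OF g])
      (simp add: gr_eval_closed[OF g])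
qed

text \<open>With \<open>2 l = d + 1\<close>, the inverse is the Bass cyclic unit of \<open>g^2\<close> for \<open>k = l\<close>; it appears here as a polynomial in \<open>g\<close>.\<close>

lemma bass_unit_in_Units:
  assumes g: "g \<in> carrier G" and odd: "odd (ord g)" and m: "totient (ord g) dvd m"
  shows "bass_unit G 2 m g \<in> Units ZG"
proof -
  let ?d = "ord g"
  define l where "l = (?d + 1) div 2"
  have l: "2 * l = ?d + 1" using odd by (auto simp: l_def elim!: oddE)
  let ?c = "(1 - 2 ^ m) div int ?d" and ?c' = "(1 - int l ^ m) div int ?d"
  have "coprime l ?d"
  proof (rule coprimeI)
    fix e assume "e dvd l" "e dvd ?d"
    then have "e dvd (?d + 1)" using l by (metis dvd_mult)
    then show "is_unit e" using \<open>e dvd ?d\<close> by (metis dvd_add_right_iff)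
  qed
  then have c': "int ?d * ?c' = 1 - int l ^ m"
    using bass_coefficient_exact[OF _ m] by simp
  have "coprime 2 ?d" using odd by simp
  then have c: "int ?d * ?c = 1 - 2 ^ m"
    using bass_coefficient_exact[of 2, OF _ m] by simp
  define pX where "pX = Polynomial.monom (1 :: int) 1"
  let ?p = "(1 + pX) ^ m + of_int ?c * (\<Sum>i<?d. pX ^ i)"
  let ?r = "(\<Sum>i<l. pX ^ (2 * i)) ^ m + of_int ?c' * (\<Sum>i<?d. pX ^ i)"
  have Xn: "pX ^ n = Polynomial.monom 1 n" for n
    by (induction n) (simp_all add: pX_def mult_monom)
  have "pX ^ ?d - 1 dvd ?p * ?r - 1"
    by (rule cyclotomic_bass_inverse[OF ord_pos[OF g] l c c'])
  then have pr: "gr_eval g (?p * ?r) = \<one>\<^bsub>ZG\<^esub>" unfolding Xn[of ?d] by (rule gr_eval_eq_one[OF g])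
  have geom: "gr_eval g (\<Sum>i<n. pX ^ i) = gr_geom G g n" for n
    unfolding Xn by (rule gr_eval_sum_monom[OF g])
  have "(1 + pX) = (\<Sum>i<2. pX ^ i)" by (simp add: numeral_2_eq_2)
  then have "gr_eval g ?p = bass_unit G 2 m g"
    unfolding bass_unit_def
    by (simp add: gr_eval_add[OF g] gr_eval_power[OF g] geom gr_add_pow[OF gr_geom_closed[OF g]]
        of_int_poly gr_eval_smult[OF g])
  then have "bass_unit G 2 m g \<otimes>\<^bsub>ZG\<^esub> gr_eval g ?r = \<one>\<^bsub>ZG\<^esub>"
    and "gr_eval g ?r \<otimes>\<^bsub>ZG\<^esub> bass_unit G 2 m g = \<one>\<^bsub>ZG\<^esub>" "bass_unit G 2 m g \<in> carrier ZG"
    using pr gr_eval_mult[OF g, of ?p ?r] gr_eval_mult[OF g, of ?r ?p] gr_eval_closed[OF g, of ?p]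
    by (simp_all add: mult.commute)
  then show ?thesis using gr_eval_closed[OF g] unfolding Units_def by blast
qed

definition bicyclic_nilpotent :: "'a \<Rightarrow> 'a \<Rightarrow> ('a \<Rightarrow> int)" where
  "bicyclic_nilpotent h x =
     (\<one>\<^bsub>ZG\<^esub> \<ominus>\<^bsub>ZG\<^esub> gr_embed h) \<otimes>\<^bsub>ZG\<^esub> gr_embed x \<otimes>\<^bsub>ZG\<^esub> gr_geom G h (ord h)"

text \<open>The sum of the powers of \<open>h\<close> is annihilated by \<open>1 - h\<close> on its right, so the square of \<open>bicyclic_nilpotent h x\<close> is 0.\<close>

lemma bicyclic_in_Units:
  assumes h: "h \<in> carrier G" and x: "x \<in> carrier G"
  shows "\<one>\<^bsub>ZG\<^esub> \<oplus>\<^bsub>ZG\<^esub> bicyclic_nilpotent h x \<in> Units ZG"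
proof -
  let ?m = "\<one>\<^bsub>ZG\<^esub> \<ominus>\<^bsub>ZG\<^esub> gr_embed h" and ?s = "gr_geom G h (ord h)"
  let ?t = "bicyclic_nilpotent h x"
  define pX where "pX = Polynomial.monom (1 :: int) 1"
  have cl: "?m \<in> carrier ZG" "?s \<in> carrier ZG" "gr_embed x \<in> carrier ZG"
    using h x by (simp_all add: gr_embed_closed gr_geom_closed)
  then have tc: "?t \<in> carrier ZG" by (simp add: bicyclic_nilpotent_def)
  have Xn: "pX ^ n = Polynomial.monom 1 n" for n
    by (induction n) (simp_all add: pX_def mult_monom)
  have "1 - pX = 1 + Polynomial.smult (- 1) (Polynomial.monom 1 1)" by (simp add: pX_def)
  then have m: "gr_eval h (1 - pX) = ?m"
    using h by (simp only: gr_eval_add[OF h] gr_eval_smult[OF h] gr_eval_1[OF h] gr_eval_monom[OF h])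
      (simp add: gr_add gr_diff gr_one gr_embed_closed)
  have "(\<Sum>i<n. pX ^ i) * (1 - pX) = 1 - pX ^ n" for n
    using power_diff_1_eq[of pX n] by (simp add: algebra_simps)
  then have "(\<Sum>i\<in>{..<ord h}. Polynomial.monom 1 i) * (1 - pX) = (Polynomial.monom 1 (ord h) - 1) * (- 1)"
    unfolding Xn by simp
  then have "?s \<otimes>\<^bsub>ZG\<^esub> ?m = gr_eval h ((Polynomial.monom 1 (ord h) - 1) * (- 1))"
    unfolding m[symmetric] gr_eval_sum_monom[OF h, symmetric] by (metis gr_eval_mult[OF h])
  then have sm: "?s \<otimes>\<^bsub>ZG\<^esub> ?m = \<zero>\<^bsub>ZG\<^esub>"
    by (simp only: gr_eval_mult[OF h] gr_eval_cyclotomic[OF h]) (simp add: gr_eval_closed[OF h])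
  have "?t \<otimes>\<^bsub>ZG\<^esub> ?t = ?m \<otimes>\<^bsub>ZG\<^esub> gr_embed x \<otimes>\<^bsub>ZG\<^esub> (?s \<otimes>\<^bsub>ZG\<^esub> ?m) \<otimes>\<^bsub>ZG\<^esub> gr_embed x \<otimes>\<^bsub>ZG\<^esub> ?s"
    using cl by (simp add: bicyclic_nilpotent_def R.m_assoc)
  then have tt: "?t \<otimes>\<^bsub>ZG\<^esub> ?t = \<zero>\<^bsub>ZG\<^esub>" using cl by (simp add: sm)
  have "(\<one>\<^bsub>ZG\<^esub> \<oplus>\<^bsub>ZG\<^esub> ?t) \<otimes>\<^bsub>ZG\<^esub> (\<one>\<^bsub>ZG\<^esub> \<ominus>\<^bsub>ZG\<^esub> ?t) = \<one>\<^bsub>ZG\<^esub>"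
    and "(\<one>\<^bsub>ZG\<^esub> \<ominus>\<^bsub>ZG\<^esub> ?t) \<otimes>\<^bsub>ZG\<^esub> (\<one>\<^bsub>ZG\<^esub> \<oplus>\<^bsub>ZG\<^esub> ?t) = \<one>\<^bsub>ZG\<^esub>"
    using tc tt
    by (simp_all add: a_minus_def R.l_distr R.r_distr R.l_minus R.r_minus R.a_assoc R.r_neg R.l_neg)
  then show ?thesis using tc unfolding Units_def by blast
qed

end

lemma sum_period_shift:
  fixes f :: "int \<Rightarrow> 'b::comm_monoid_add"
  assumes q: "0 < q" and per: "\<And>i j. i mod int q = j mod int q \<Longrightarrow> f i = f j"
  shows "(\<Sum>i\<in>{0..<int q}. f (i - k)) = (\<Sum>i\<in>{0..<int q}. f i)"
proof (rule sum.reindex_bij_witness[where i="\<lambda>i. (i + k) mod int q" and j="\<lambda>i. (i - k) mod int q"])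
  fix i assume "i \<in> {0..<int q}"
  then show "((i - k) mod int q + k) mod int q = i" "((i + k) mod int q - k) mod int q = i"
    by (simp_all add: mod_simps)
  show "f ((i - k) mod int q) = f (i - k)" by (rule per) simp
qed (use q in auto)

text \<open>A progression whose step is prime to \<open>q\<close> runs through all residues once in every \<open>q\<close> steps.\<close>

lemma sum_arith_progression:
  fixes f :: "int \<Rightarrow> complex"
  assumes q: "Factorial_Ring.prime q" and k: "\<not> int q dvd k"
    and per: "\<And>i j. i mod int q = j mod int q \<Longrightarrow> f i = f j"
  shows "(\<Sum>l<q * r. f (i - k * int l)) = of_nat r * (\<Sum>j\<in>{0..<int q}. f j)"
proof (induction r)
  case (Suc r)
  have q0: "0 < q" using q prime_gt_0_nat by blast
  have "(\<Sum>l<q * Suc r. f (i - k * int l)) =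
      (\<Sum>l<q * r. f (i - k * int l)) + (\<Sum>l\<in>{q * r..<q * r + q}. f (i - k * int l))"
    by (simp add: lessThan_atLeast0 sum.atLeastLessThan_concat add.commute)
  also have "(\<Sum>l\<in>{q * r..<q * r + q}. f (i - k * int l)) = (\<Sum>l<q. f (i - k * int l))"
  proof (rule sum.reindex_bij_witness[where i="\<lambda>l. l + q * r" and j="\<lambda>l. l - q * r"])
    fix l assume "l \<in> {q * r..<q * r + q}"
    then have "l = (l - q * r) + q * r" by simp
    then have "int l = int (l - q * r) + int q * int r" by (metis of_nat_add of_nat_mult)
    then have "i - k * int l = (i - k * int (l - q * r)) + int q * (- (k * int r))"
      by (simp add: algebra_simps)
    then have "(i - k * int l) mod int q = (i - k * int (l - q * r)) mod int q"
      by (simp only: mod_mult_self2)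
    then show "f (i - k * int (l - q * r)) = f (i - k * int l)" by (rule per[OF sym])
  qed auto
  also have "\<dots> = (\<Sum>j\<in>{0..<int q}. f j)"
  proof -
    have inj: "inj_on (\<lambda>l. (i - k * int l) mod int q) {..<q}"
    proof (rule inj_onI)
      fix l l' assume l: "l \<in> {..<q}" "l' \<in> {..<q}"
        and eq: "(i - k * int l) mod int q = (i - k * int l') mod int q"
      then have "int q dvd (i - k * int l) - (i - k * int l')" by (simp add: mod_eq_dvd_iff)
      then have "int q dvd k * (int l' - int l)" by (simp add: algebra_simps)
      then have "int q dvd int l' - int l" using k q prime_dvd_mult_iff[of "int q"] by auto
      then have "int l' mod int q = int l mod int q" by (simp add: mod_eq_dvd_iff)
      then show "l = l'" using l by simp
    qed
    have sub: "(\<lambda>l. (i - k * int l) mod int q) ` {..<q} \<subseteq> {0..<int q}" using q0 by auto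
    have "(\<lambda>l. (i - k * int l) mod int q) ` {..<q} = {0..<int q}"
      by (rule card_subset_eq[OF _ sub]) (simp_all add: card_image[OF inj])
    then have "(\<Sum>j\<in>{0..<int q}. f j) = (\<Sum>l<q. f ((i - k * int l) mod int q))"
      using sum.reindex[OF inj, of f] by simp
    also have "\<dots> = (\<Sum>l<q. f (i - k * int l))" by (intro sum.cong refl per) simp
    finally show ?thesis by simp
  qed
  finally show ?case using Suc by (simp add: algebra_simps)
qed simp

text \<open>The representation induced from the character \<open>chi\<close>, for the group generated by \<open>A\<close> and \<open>b\<close>. There is no separate
representation space: \<open>coord\<close> reads the coordinates off from the group ring element itself, and the
representation consists of the effect of left multiplication on these coordinates. The indices are
all integers, and the coordinates have period \<open>q\<close>, which avoids reductions modulo \<open>q\<close>.\<close>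

locale induced_rep = finite_group +
  fixes A :: "'a set" and b :: 'a and q :: nat and chi :: "'a \<Rightarrow> complex"
  assumes A: "subgroup A G" and b: "b \<in> carrier G" and q: "0 < q" and bq: "b [^] q \<in> A"
    and chi_mult: "\<And>x y. x \<in> A \<Longrightarrow> y \<in> A \<Longrightarrow> chi (x \<otimes> y) = chi x * chi y"
    and chi_one: "chi \<one> = 1" and chi_bq: "chi (b [^] q) = 1"
    and normal: "\<And>i a. a \<in> A \<Longrightarrow> inv (b [^] (i::int)) \<otimes> a \<otimes> b [^] i \<in> A"
begin

definition coord :: "('a \<Rightarrow> int) \<Rightarrow> int \<Rightarrow> complex" where
  "coord \<alpha> i = (\<Sum>a\<in>A. of_int (\<alpha> (b [^] i \<otimes> a)) * chi a)"

text \<open>The character \<open>chi\<close> conjugated by \<open>b^i\<close>: the diagonal entries of the elements of \<open>A\<close>.\<close>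

definition conj_chi :: "'a \<Rightarrow> int \<Rightarrow> complex" where
  "conj_chi y i = chi (inv (b [^] i) \<otimes> y \<otimes> b [^] i)"

lemma A_sub: "a \<in> A \<Longrightarrow> a \<in> carrier G"
  using A subgroup.subset by blast

lemma bi [simp]: "b [^] (i::int) \<in> carrier G"
  using b by simp

lemma coord_add: "coord (\<alpha> \<oplus>\<^bsub>ZG\<^esub> \<beta>) i = coord \<alpha> i + coord \<beta> i"
  by (simp add: coord_def gr_add sum.distrib algebra_simps)

lemma coord_sum: "coord (\<lambda>x. \<Sum>l<n. \<alpha> l x) i = (\<Sum>l<n::nat. coord (\<alpha> l) i)"
  unfolding coord_def by (simp add: sum_distrib_right) (rule sum.swap)

lemma coord_scale: "coord (\<lambda>x. c * \<alpha> x) i = of_int c * coord \<alpha> i"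
  by (simp add: coord_def sum_distrib_left mult.assoc)

lemma sum_translate:
  assumes "c \<in> A"
  shows "(\<Sum>a\<in>A. f (c \<otimes> a)) = (\<Sum>a\<in>A. f a)"
  using assms A_sub subgroup.m_inv_closed[OF A] subgroup.m_closed[OF A]
  by (intro sum.reindex_bij_witness[where i="\<lambda>a. inv c \<otimes> a" and j="\<lambda>a. c \<otimes> a"])
    (auto simp: cancel_inv)

lemma coord_period1: "coord \<alpha> (i + int q) = coord \<alpha> i"
proof -
  have "coord \<alpha> (i + int q) = (\<Sum>a\<in>A. of_int (\<alpha> (b [^] i \<otimes> (b [^] q \<otimes> a))) * chi (b [^] q \<otimes> a))"
    unfolding coord_def using b bq A_sub
    by (intro sum.cong) (auto simp: int_pow_mult int_pow_int m_assoc chi_mult chi_bq)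
  also have "\<dots> = coord \<alpha> i"
    unfolding coord_def by (rule sum_translate[OF bq, of "\<lambda>a. of_int (\<alpha> (b [^] i \<otimes> a)) * chi a"])
  finally show ?thesis .
qed

lemma period_mod:
  fixes f :: "int \<Rightarrow> 'c"
  assumes "\<And>i. f (i + int q) = f i" and "i mod int q = j mod int q"
  shows "f i = f j"
proof -
  have up: "f (i + int q * int n) = f i" for i n
  proof (induction n)
    case (Suc n)
    then show ?case using assms(1)[of "i + int q * int n"] by (simp add: algebra_simps)
  qed simp
  have m: "f (i mod int q) = f i" for i
  proof (cases "0 \<le> i div int q")
    case True
    then show ?thesis using up[of "i mod int q" "nat (i div int q)"] by simp
  next
    case False
    have "i + int q * (- (i div int q)) = i mod int q" by (simp add: minus_div_mult_eq_mod[symmetric] mult.commute)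
    then show ?thesis using False up[of i "nat (- (i div int q))"] by simp
  qed
  show ?thesis using m[of i] m[of j] assms(2) by simp
qed

lemma coord_period: "i mod int q = j mod int q \<Longrightarrow> coord \<alpha> i = coord \<alpha> j"
  by (rule period_mod[of "coord \<alpha>"]) (simp_all add: coord_period1)

lemma coord_shift:
  assumes \<alpha>: "\<alpha> \<in> carrier ZG"
  shows "coord (gr_embed (b [^] (k::int)) \<otimes>\<^bsub>ZG\<^esub> \<alpha>) i = coord \<alpha> (i - k)"
  unfolding coord_def
proof (intro sum.cong refl)
  fix a assume a: "a \<in> A"
  have "inv (b [^] k) \<otimes> (b [^] i \<otimes> a) = b [^] (i - k) \<otimes> a"
    using a A_sub b by (simp add: m_assoc[symmetric] int_pow_neg[symmetric] int_pow_mult[symmetric])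
  then show "of_int ((gr_embed (b [^] k) \<otimes>\<^bsub>ZG\<^esub> \<alpha>) (b [^] i \<otimes> a)) * chi a
      = of_int (\<alpha> (b [^] (i - k) \<otimes> a)) * chi a"
    using a A_sub \<alpha> by (simp add: gr_embed_mult)
qed

lemma coord_diagonal:
  assumes \<alpha>: "\<alpha> \<in> carrier ZG" and y: "y \<in> A"
  shows "coord (gr_embed y \<otimes>\<^bsub>ZG\<^esub> \<alpha>) i = conj_chi y i * coord \<alpha> i"
proof -
  let ?B = "b [^] i"
  let ?c = "inv ?B \<otimes> y \<otimes> ?B"
  have c: "?c \<in> A" "inv ?c \<in> A" using normal[OF y] subgroup.m_inv_closed[OF A] by auto
  have "coord (gr_embed y \<otimes>\<^bsub>ZG\<^esub> \<alpha>) i = (\<Sum>a\<in>A. of_int (\<alpha> (?B \<otimes> (inv ?c \<otimes> a))) * (chi ?c * chi (inv ?c \<otimes> a)))"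
    unfolding coord_def
  proof (intro sum.cong refl)
    fix a assume a: "a \<in> A"
    have "inv y \<otimes> (?B \<otimes> a) = ?B \<otimes> (inv ?c \<otimes> a)"
      using a A_sub y by (simp add: inv_mult_group m_assoc cancel_inv)
    moreover have "chi a = chi ?c * chi (inv ?c \<otimes> a)"
      using chi_mult[OF c(1), of "inv ?c \<otimes> a"] a c A_sub subgroup.m_closed[OF A c(2) a]
      by (simp add: cancel_inv)
    ultimately show "of_int ((gr_embed y \<otimes>\<^bsub>ZG\<^esub> \<alpha>) (?B \<otimes> a)) * chi a
        = of_int (\<alpha> (?B \<otimes> (inv ?c \<otimes> a))) * (chi ?c * chi (inv ?c \<otimes> a))"
      using a A_sub y \<alpha> by (simp add: gr_embed_mult)
  qed
  also have "\<dots> = (\<Sum>a\<in>A. of_int (\<alpha> (?B \<otimes> a)) * (chi ?c * chi a))"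
    by (rule sum_translate[OF c(2), of "\<lambda>a. of_int (\<alpha> (?B \<otimes> a)) * (chi ?c * chi a)"])
  also have "\<dots> = chi ?c * coord \<alpha> i"
    unfolding coord_def sum_distrib_left by (intro sum.cong refl mult.left_commute)
  finally show ?thesis by (simp add: conj_chi_def)
qed

lemma chi_power: "a \<in> A \<Longrightarrow> chi (a [^] (n::nat)) = chi a ^ n"
proof (induction n)
  case (Suc n)
  have "a [^] n \<in> A" using A Suc.prems by (induction n) (auto simp: subgroup.one_closed subgroup.m_closed)
  then show ?case using Suc by (simp add: chi_mult)
qed (simp add: chi_one)

lemma conj_power:
  assumes "y \<in> carrier G" "g \<in> carrier G"
  shows "(inv g \<otimes> y \<otimes> g) [^] (n::nat) = inv g \<otimes> y [^] n \<otimes> g"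
proof (induction n)
  case (Suc n)
  then show ?case using assms by (simp add: m_assoc cancel_inv)
qed (simp add: assms)

lemma conj_chi_power: "y \<in> A \<Longrightarrow> conj_chi (y [^] (n::nat)) i = conj_chi y i ^ n"
  unfolding conj_chi_def
  using conj_power[of y "b [^] i" n] A_sub chi_power[OF normal[of y i], of n] by simp

lemma conj_chi_root: "y \<in> A \<Longrightarrow> conj_chi y i ^ ord y = 1"
  using conj_chi_power[of y "ord y" i] A_sub[of y] by (simp add: pow_ord_eq_1 conj_chi_def chi_one)

lemma power_in_A: "y \<in> A \<Longrightarrow> y [^] (n::nat) \<in> A"
  using A by (induction n) (auto simp: subgroup.one_closed subgroup.m_closed)

lemma coord_geom:
  assumes \<alpha>: "\<alpha> \<in> carrier ZG" and g: "g \<in> carrier G"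
  shows "coord (gr_geom G g n \<otimes>\<^bsub>ZG\<^esub> \<alpha>) i = (\<Sum>l<n. coord (gr_embed (g [^] l) \<otimes>\<^bsub>ZG\<^esub> \<alpha>) i)"
proof (induction n)
  case 0
  have "gr_geom G g 0 = \<zero>\<^bsub>ZG\<^esub>" using g by (simp add: gr_geom_eq gr_zero)
  then have "gr_geom G g 0 \<otimes>\<^bsub>ZG\<^esub> \<alpha> = \<zero>\<^bsub>ZG\<^esub>" using \<alpha> by simp
  then show ?case by (simp only:) (simp add: coord_def gr_zero)
next
  case (Suc n)
  have "gr_geom G g (Suc n) = gr_geom G g n \<oplus>\<^bsub>ZG\<^esub> gr_embed (g [^] n)"
    using g by (simp add: gr_geom_eq gr_add)
  then show ?case using Suc \<alpha> g
    by (simp add: R.l_distr gr_geom_closed gr_embed_closed coord_add)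
qed

text \<open>The sum of all powers of \<open>g\<close> acts as 0 in the coordinates where \<open>g\<close> does not act as 1. In the others it acts as
\<open>ord g\<close>, and the coefficient of this sum in the unit turns the eigenvalue \<open>2^m\<close> into 1.\<close>

lemma coord_bass_unit:
  assumes \<alpha>: "\<alpha> \<in> carrier ZG" and g: "g \<in> A" and odd: "odd (ord g)"
    and m: "totient (ord g) dvd m"
  shows "coord (bass_unit G 2 m g \<otimes>\<^bsub>ZG\<^esub> \<alpha>) i =
    (if conj_chi g i = 1 then 1 else (1 + conj_chi g i) ^ m) * coord \<alpha> i"
proof -
  let ?x = "conj_chi g i" and ?d = "ord g"
  have gc: "g \<in> carrier G" using g A_sub by blast
  have geom: "coord (gr_geom G g n \<otimes>\<^bsub>ZG\<^esub> \<gamma>) i = (\<Sum>l<n. ?x ^ l) * coord \<gamma> i"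
    if "\<gamma> \<in> carrier ZG" for n \<gamma>
    using coord_geom[OF that gc] coord_diagonal[OF that power_in_A[OF g]]
    by (simp add: conj_chi_power[OF g] sum_distrib_right)
  have S: "gr_geom G g 2 \<in> carrier ZG" using gc by (rule gr_geom_closed)
  have pow: "coord (gr_geom G g 2 [^]\<^bsub>ZG\<^esub> n \<otimes>\<^bsub>ZG\<^esub> \<gamma>) i = (1 + ?x) ^ n * coord \<gamma> i"
    if "\<gamma> \<in> carrier ZG" for n \<gamma>
    using that
  proof (induction n arbitrary: \<gamma>)
    case (Suc n)
    have "gr_geom G g 2 [^]\<^bsub>ZG\<^esub> Suc n \<otimes>\<^bsub>ZG\<^esub> \<gamma> = gr_geom G g 2 [^]\<^bsub>ZG\<^esub> n \<otimes>\<^bsub>ZG\<^esub> (gr_geom G g 2 \<otimes>\<^bsub>ZG\<^esub> \<gamma>)"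
      using Suc.prems S by (simp add: R.m_assoc)
    then show ?case using Suc S geom[of \<gamma> 2] by (simp add: numeral_2_eq_2)
  qed simp
  let ?c = "(1 - int 2 ^ m) div int ?d"
  have ap: "add_pow ZG ?c (gr_geom G g ?d) \<in> carrier ZG" using gr_geom_closed[OF gc] by simp
  have "add_pow ZG ?c (gr_geom G g ?d) \<otimes>\<^bsub>ZG\<^esub> \<alpha> = add_pow ZG ?c (gr_geom G g ?d \<otimes>\<^bsub>ZG\<^esub> \<alpha>)"
    using R.add_pow_ldistr_int[OF gr_geom_closed[OF gc] \<alpha>] .
  then have "coord (add_pow ZG ?c (gr_geom G g ?d) \<otimes>\<^bsub>ZG\<^esub> \<alpha>) i = of_int ?c * ((\<Sum>l<?d. ?x ^ l) * coord \<alpha> i)"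
    using geom[OF \<alpha>] \<alpha> gc by (simp add: gr_add_pow gr_geom_closed coord_scale)
  then have eq: "coord (bass_unit G 2 m g \<otimes>\<^bsub>ZG\<^esub> \<alpha>) i =
      ((1 + ?x) ^ m + of_int ?c * (\<Sum>l<?d. ?x ^ l)) * coord \<alpha> i"
    unfolding bass_unit_def using \<alpha> S ap pow[OF \<alpha>]
    by (simp add: R.l_distr coord_add algebra_simps)
  show ?thesis
  proof (cases "?x = 1")
    case True
    have "int ?d dvd 1 - int 2 ^ m" using odd m by (intro bass_coefficient_exact) auto
    then have "int ?d * ?c = 1 - 2 ^ m" by simp
    then have "complex_of_int (int ?d * ?c) = of_int (1 - 2 ^ m)" by (rule arg_cong)
    then show ?thesis using eq True by (simp add: algebra_simps)
  next
    case False
    have "(?x - 1) * (\<Sum>l<?d. ?x ^ l) = 0"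
      using power_diff_1_eq[of ?x ?d] conj_chi_root[OF g, of i] by simp
    then have "(\<Sum>l<?d. ?x ^ l) = 0" using False by simp
    then show ?thesis using eq False by simp
  qed
qed

text \<open>The powers of \<open>h = b^k\<close> shift the coordinates through all residues equally often. So the sum of these powers
replaces every coordinate by one and the same multiple of the coordinate sum: an operator of rank
one.\<close>

lemma coord_bicyclic:
  assumes qp: "Factorial_Ring.prime q" and k: "\<not> int q dvd k"
    and dvd: "q dvd ord (b [^] k)"
    and \<alpha>: "\<alpha> \<in> carrier ZG" and y: "y \<in> A"
  shows "coord ((\<one>\<^bsub>ZG\<^esub> \<oplus>\<^bsub>ZG\<^esub> bicyclic_nilpotent (b [^] k) y) \<otimes>\<^bsub>ZG\<^esub> \<alpha>) i =
     coord \<alpha> i + of_nat (ord (b [^] k) div q) * (\<Sum>j\<in>{0..<int q}. coord \<alpha> j)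
       * (conj_chi y i - conj_chi y (i - k))"
proof -
  let ?h = "b [^] k" and ?s = "gr_geom G (b [^] k) (ord (b [^] k))"
  let ?D = "ord (b [^] k)"
  let ?F = "of_nat (?D div q) * (\<Sum>j\<in>{0..<int q}. coord \<alpha> j)"
  have h: "?h \<in> carrier G" by simp
  have yc: "y \<in> carrier G" using y A_sub by blast
  have cl: "?s \<in> carrier ZG" "gr_embed y \<in> carrier ZG" "gr_embed ?h \<in> carrier ZG"
    using yc by (simp_all add: gr_geom_closed gr_embed_closed)
  have s: "coord (?s \<otimes>\<^bsub>ZG\<^esub> \<alpha>) j = ?F" for j
  proof -
    have "coord (?s \<otimes>\<^bsub>ZG\<^esub> \<alpha>) j = (\<Sum>l<?D. coord (gr_embed (b [^] (k * int l)) \<otimes>\<^bsub>ZG\<^esub> \<alpha>) j)"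
      unfolding coord_geom[OF \<alpha> h] using b by (simp add: int_pow_pow[symmetric] int_pow_int)
    also have "\<dots> = (\<Sum>l<q * (?D div q). coord \<alpha> (j - k * int l))"
      using dvd by (simp add: coord_shift[OF \<alpha>])
    also have "\<dots> = ?F" by (rule sum_arith_progression[OF qp k coord_period])
    finally show ?thesis .
  qed
  let ?\<gamma> = "gr_embed y \<otimes>\<^bsub>ZG\<^esub> (?s \<otimes>\<^bsub>ZG\<^esub> \<alpha>)"
  have g: "coord ?\<gamma> j = conj_chi y j * ?F" for j
    using coord_diagonal[OF _ y, of "?s \<otimes>\<^bsub>ZG\<^esub> \<alpha>"] cl \<alpha> s by simp
  have "bicyclic_nilpotent ?h y \<otimes>\<^bsub>ZG\<^esub> \<alpha> = (\<one>\<^bsub>ZG\<^esub> \<ominus>\<^bsub>ZG\<^esub> gr_embed ?h) \<otimes>\<^bsub>ZG\<^esub> ?\<gamma>"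
    unfolding bicyclic_nilpotent_def using cl \<alpha> by (simp add: R.m_assoc)
  also have "\<dots> = ?\<gamma> \<oplus>\<^bsub>ZG\<^esub> (\<lambda>x. (-1) * (gr_embed ?h \<otimes>\<^bsub>ZG\<^esub> ?\<gamma>) x)"
    using cl \<alpha> by (simp add: a_minus_def R.l_distr R.l_minus gr_minus[of "gr_embed ?h \<otimes>\<^bsub>ZG\<^esub> ?\<gamma>"])
  finally have "coord (bicyclic_nilpotent ?h y \<otimes>\<^bsub>ZG\<^esub> \<alpha>) i = coord ?\<gamma> i - coord ?\<gamma> (i - k)"
    using cl \<alpha> by (simp only: coord_add coord_scale) (simp add: coord_shift)
  moreover have "bicyclic_nilpotent ?h y \<in> carrier ZG"
    unfolding bicyclic_nilpotent_def using cl by simp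
  ultimately show ?thesis using \<alpha> g by (simp add: R.l_distr coord_add algebra_simps)
qed

lemma coord_one:
  assumes nA: "\<And>i. 0 < i \<Longrightarrow> i < q \<Longrightarrow> b [^] i \<notin> A"
  shows "coord (\<lambda>x. \<Sum>l<q. gr_embed (b [^] l) x) i = 1"
proof -
  have b0: "coord (gr_embed \<one>) (int j) = (if j = 0 then 1 else 0)" if j: "j < q" for j
  proof (cases "j = 0")
    case True
    have "coord (gr_embed \<one>) 0 = (\<Sum>a\<in>A. if a = \<one> then chi a else 0)"
      unfolding coord_def using A_sub by (intro sum.cong) (auto simp: gr_embed_def)
    also have "\<dots> = 1" using subgroup.one_closed[OF A] finite_subset[OF subgroup.subset[OF A] fin]
      by (simp add: chi_one)
    finally show ?thesis using True by simp
  next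
    case False
    have "b [^] j \<otimes> a \<noteq> \<one>" if a: "a \<in> A" for a
    proof
      assume "b [^] j \<otimes> a = \<one>"
      then have "b [^] j = inv a" using a A_sub b by (metis inv_equality nat_pow_closed inv_inv)
      then show False using nA[of j] j False a subgroup.m_inv_closed[OF A a] by simp
    qed
    then show ?thesis using False by (simp add: coord_def int_pow_int gr_embed_def)
  qed
  have e: "gr_embed \<one> \<in> carrier ZG" by (simp add: gr_embed_closed)
  have sh: "coord (gr_embed (b [^] l)) i = coord (gr_embed \<one>) (i - int l)" for l :: nat
    using coord_shift[OF e, of "int l" i] b gr_embed_mult_embed[of "b [^] l" \<one>] by (simp add: int_pow_int)
  define r where "r = nat (i mod int q)"
  have r: "r < q" "int r = i mod int q" using q by (auto simp: r_def nat_less_iff)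
  have "(\<Sum>l<q. coord (gr_embed (b [^] l)) i) = (\<Sum>l<q. if l = r then 1 else 0)"
  proof (intro sum.cong refl)
    fix l assume "l \<in> {..<q}"
    then have l: "l < q" by simp
    define j where "j = nat ((i - int l) mod int q)"
    have j: "j < q" "int j = (i - int l) mod int q" using q by (auto simp: j_def nat_less_iff)
    have "coord (gr_embed \<one>) (i - int l) = coord (gr_embed \<one>) (int j)"
      by (rule coord_period) (simp add: j)
    moreover have "j = 0 \<longleftrightarrow> l = r"
    proof -
      have "j = 0 \<longleftrightarrow> (i - int l) mod int q = 0" using j by linarith
      also have "\<dots> \<longleftrightarrow> i mod int q = int l mod int q" by (simp add: mod_eq_dvd_iff dvd_eq_mod_eq_0)
      also have "\<dots> \<longleftrightarrow> l = r" using l r by auto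
      finally show ?thesis .
    qed
    ultimately show "coord (gr_embed (b [^] l)) i = (if l = r then 1 else 0)"
      using b0[OF j(1)] sh by simp
  qed
  then show ?thesis using r by (simp add: coord_sum)
qed

end

section \<open>Characters of finite abelian subgroups\<close>

lemma complex_root_exists:
  fixes w :: complex
  assumes "0 < n" shows "\<exists>z. z ^ n = w"
proof (cases "w = 0")
  case True
  then show ?thesis using assms by (intro exI[of _ 0]) simp
next
  case False
  then have "card {z. z ^ n = w} = n" using assms by (rule card_nth_roots)
  then have "{z. z ^ n = w} \<noteq> {}" using assms by (metis card.empty less_irrefl)
  then show ?thesis by blast
qed

context finite_group
begin

definition commuting :: "'a set \<Rightarrow> bool" where
  "commuting S \<longleftrightarrow> (\<forall>x\<in>S. \<forall>y\<in>S. x \<otimes> y = y \<otimes> x)"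

definition adjoin :: "'a set \<Rightarrow> 'a \<Rightarrow> 'a set" where
  "adjoin K a = {k \<otimes> a [^] (i::nat) | k i. k \<in> K}"

lemma commute_pow:
  assumes "x \<in> carrier G" "y \<in> carrier G" "x \<otimes> y = y \<otimes> x"
  shows "x \<otimes> y [^] (n::nat) = y [^] n \<otimes> x"
proof (induction n)
  case (Suc n)
  have "x \<otimes> y [^] Suc n = (x \<otimes> y [^] n) \<otimes> y" using assms by (simp add: m_assoc)
  also have "\<dots> = y [^] n \<otimes> (x \<otimes> y)" unfolding Suc using assms by (simp add: m_assoc)
  also have "\<dots> = y [^] Suc n \<otimes> x" unfolding assms(3) using assms by (simp add: m_assoc)
  finally show ?case .
qed (use assms in simp)

lemma commute_inv:
  assumes "x \<in> carrier G" "y \<in> carrier G" "x \<otimes> y = y \<otimes> x"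
  shows "x \<otimes> inv y = inv y \<otimes> x"
  using assms by (metis inv_closed inv_solve_left inv_solve_right m_assoc m_closed)

lemma commute_mult:
  assumes "x \<in> carrier G" "y \<in> carrier G" "z \<in> carrier G" "x \<otimes> y = y \<otimes> x" "x \<otimes> z = z \<otimes> x"
  shows "x \<otimes> (y \<otimes> z) = (y \<otimes> z) \<otimes> x"
  using assms by (metis m_assoc)

lemma inv_pow_nat:
  assumes "a \<in> carrier G"
  shows "inv (a [^] (i::nat)) = a [^] ((ord a - 1) * i)"
proof (rule inv_equality)
  have "(ord a - 1) * i + i = ord a * i" using ord_pos[OF assms]
    by (metis Suc_pred' add.commute mult_Suc)
  then have "a [^] ((ord a - 1) * i) \<otimes> a [^] i = a [^] (ord a * i)" using assms by (simp add: nat_pow_mult)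
  also have "\<dots> = \<one>" using assms by (simp add: nat_pow_pow[symmetric] pow_ord_eq_1)
  finally show "a [^] ((ord a - 1) * i) \<otimes> a [^] i = \<one>" .
qed (use assms in auto)

lemma subgroup_elem: "subgroup K G \<Longrightarrow> k \<in> K \<Longrightarrow> k \<in> carrier G"
  using subgroup.subset by blast

lemma subgroup_pow: "subgroup K G \<Longrightarrow> x \<in> K \<Longrightarrow> x [^] (n::nat) \<in> K"
  by (induction n) (auto simp: subgroup.one_closed subgroup.m_closed)

context
  fixes K a
  assumes K: "subgroup K G" and a: "a \<in> carrier G" and com: "\<And>k. k \<in> K \<Longrightarrow> k \<otimes> a = a \<otimes> k"
begin

lemma com_pow: "k \<in> K \<Longrightarrow> k \<otimes> a [^] (i::nat) = a [^] i \<otimes> k"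
  using commute_pow com a subgroup_elem[OF K] by blast

lemma adjoin_mult:
  assumes "k \<in> K" "k' \<in> K"
  shows "(k \<otimes> a [^] (i::nat)) \<otimes> (k' \<otimes> a [^] (j::nat)) = (k \<otimes> k') \<otimes> a [^] (i + j)"
proof -
  have "(k \<otimes> a [^] i) \<otimes> (k' \<otimes> a [^] j) = k \<otimes> (a [^] i \<otimes> k') \<otimes> a [^] j"
    using assms subgroup_elem[OF K] a by (simp add: m_assoc)
  also have "\<dots> = k \<otimes> (k' \<otimes> a [^] i) \<otimes> a [^] j" using com_pow[OF assms(2), of i] by simp
  finally show ?thesis using assms subgroup_elem[OF K] a by (simp add: m_assoc nat_pow_mult)
qed

lemma adjoin_subgroup: "subgroup (adjoin K a) G"
proof (rule subgroupI)
  show "adjoin K a \<subseteq> carrier G" using subgroup_elem[OF K] a by (auto simp: adjoin_def)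
  show "adjoin K a \<noteq> {}" using subgroup.one_closed[OF K] by (auto simp: adjoin_def)
  fix x assume "x \<in> adjoin K a"
  then obtain k i where x: "x = k \<otimes> a [^] (i::nat)" "k \<in> K" by (auto simp: adjoin_def)
  have ik: "inv k \<in> K" using x K by (simp add: subgroup.m_inv_closed)
  have "inv x = a [^] ((ord a - 1) * i) \<otimes> inv k"
    using x subgroup_elem[OF K] a by (simp add: inv_mult_group inv_pow_nat)
  also have "\<dots> = inv k \<otimes> a [^] ((ord a - 1) * i)" using com_pow[OF ik] by simp
  finally show "inv x \<in> adjoin K a" using ik by (auto simp: adjoin_def)
next
  fix x y assume "x \<in> adjoin K a" "y \<in> adjoin K a"
  then show "x \<otimes> y \<in> adjoin K a"
  proof -
    obtain k i k' j where "x = k \<otimes> a [^] (i::nat)" "k \<in> K" "y = k' \<otimes> a [^] (j::nat)" "k' \<in> K"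
      using \<open>x \<in> adjoin K a\<close> \<open>y \<in> adjoin K a\<close> by (auto simp: adjoin_def)
    moreover have "k \<otimes> k' \<in> K" using calculation subgroup.m_closed[OF K] by blast
    ultimately show ?thesis unfolding adjoin_def by (auto simp: adjoin_mult)
  qed
qed

lemma adjoin_contains: "K \<subseteq> adjoin K a" "a \<in> adjoin K a"
proof -
  have "k = k \<otimes> a [^] (0::nat)" if "k \<in> K" for k using subgroup_elem[OF K that] by simp
  then show "K \<subseteq> adjoin K a" unfolding adjoin_def by blast
  have "a = \<one> \<otimes> a [^] (1::nat)" using a by simp
  then show "a \<in> adjoin K a" unfolding adjoin_def using subgroup.one_closed[OF K] by blast
qed

lemma adjoin_subset: "subgroup L G \<Longrightarrow> K \<subseteq> L \<Longrightarrow> a \<in> L \<Longrightarrow> adjoin K a \<subseteq> L"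
  using subgroup.m_closed[of L G] subgroup_pow[of L a] by (auto simp: adjoin_def)

lemma adjoin_commuting:
  assumes c: "commuting K" shows "commuting (adjoin K a)"
proof -
  have "(k \<otimes> a [^] (i::nat)) \<otimes> (k' \<otimes> a [^] (j::nat)) = (k' \<otimes> a [^] j) \<otimes> (k \<otimes> a [^] i)"
    if "k \<in> K" "k' \<in> K" for k k' i j
  proof -
    have "k \<otimes> k' = k' \<otimes> k" using c that by (simp add: commuting_def)
    then show ?thesis using that by (simp add: adjoin_mult add.commute)
  qed
  then show ?thesis unfolding commuting_def adjoin_def by blast
qed

end

lemma conj_adjoin_closed:
  assumes K: "subgroup K G" and L: "subgroup L G" and a: "a \<in> carrier G" and b: "b \<in> carrier G"
    and cK: "\<And>k. k \<in> K \<Longrightarrow> inv b \<otimes> k \<otimes> b \<in> L" and ca: "inv b \<otimes> a \<otimes> b \<in> L"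
    and x: "x \<in> adjoin K a"
  shows "inv b \<otimes> x \<otimes> b \<in> L"
proof -
  have hom: "inv b \<otimes> (x \<otimes> y) \<otimes> b = (inv b \<otimes> x \<otimes> b) \<otimes> (inv b \<otimes> y \<otimes> b)"
    if "x \<in> carrier G" "y \<in> carrier G" for x y
    using that b by (simp add: m_assoc cancel_inv)
  have p: "inv b \<otimes> a [^] (i::nat) \<otimes> b \<in> L" for i
  proof (induction i)
    case 0
    then show ?case using b subgroup.one_closed[OF L] by simp
  next
    case (Suc i)
    have "inv b \<otimes> a [^] Suc i \<otimes> b = (inv b \<otimes> a [^] i \<otimes> b) \<otimes> (inv b \<otimes> a \<otimes> b)"
      using hom[of "a [^] i" a] a by simp
    then show ?case using Suc ca subgroup.m_closed[OF L] by simp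
  qed
  obtain k i where "x = k \<otimes> a [^] (i::nat)" "k \<in> K" using x by (auto simp: adjoin_def)
  moreover have "k \<in> carrier G" using calculation K subgroup.subset by blast
  ultimately show ?thesis
    using hom[of k "a [^] i"] a cK p subgroup.m_closed[OF L] by simp
qed

definition character_on :: "'a set \<Rightarrow> ('a \<Rightarrow> complex) \<Rightarrow> bool" where
  "character_on K chi \<longleftrightarrow> chi \<one> = 1 \<and> (\<forall>x\<in>K. \<forall>y\<in>K. chi (x \<otimes> y) = chi x * chi y)"

text \<open>The value at \<open>a\<close> is constrained only by the least positive power of \<open>a\<close> that falls into \<open>K\<close>.\<close>

lemma character_extend:
  assumes K: "subgroup K G" and a: "a \<in> carrier G" "a \<notin> K"
    and com: "\<And>k. k \<in> K \<Longrightarrow> k \<otimes> a = a \<otimes> k"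
    and chi: "character_on K chi"
  shows "\<exists>n>1. a [^] n \<in> K \<and> (\<forall>\<eta>. \<eta> ^ n = chi (a [^] n) \<longrightarrow>
     (\<exists>chi'. character_on (adjoin K a) chi' \<and> chi' a = \<eta> \<and> (\<forall>k\<in>K. chi' k = chi k)))"
proof -
  note Ks = subgroup_elem[OF K]
  define n :: nat where "n = (LEAST n. 0 < n \<and> a [^] n \<in> K)"
  have ex: "\<exists>n::nat. 0 < n \<and> a [^] n \<in> K"
    by (rule exI[of _ "ord a"]) (simp only: ord_pos[OF a(1)] subgroup.one_closed[OF K] pow_ord_eq_1[OF a(1)] simp_thms)
  have n: "0 < n" "a [^] n \<in> K" using LeastI_ex[OF ex] unfolding n_def by blast+
  have min: "n \<le> i" if "0 < i" "a [^] i \<in> K" for i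
    unfolding n_def using that by (intro Least_le) auto
  have "n \<noteq> 1" using n a by auto
  then have n1: "1 < n" using n by simp
  have powK: "(a [^] n) [^] (j::nat) \<in> K" for j
    using subgroup_pow[OF K n(2)] by blast
  have dvd: "n dvd i" if "a [^] i \<in> K" for i
  proof -
    have "a [^] i = (a [^] n) [^] (i div n) \<otimes> a [^] (i mod n)"
      using a by (simp add: nat_pow_pow nat_pow_mult)
    then have "a [^] (i mod n) = inv ((a [^] n) [^] (i div n)) \<otimes> a [^] i"
      using a by (simp add: cancel_inv)
    then have "a [^] (i mod n) \<in> K"
      using that powK K by (simp add: subgroup.m_closed subgroup.m_inv_closed)
    moreover have "i mod n < n" using n by simp
    ultimately have "i mod n = 0" using min[of "i mod n"] by fastforce
    then show ?thesis by auto
  qed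
  have chim: "chi (x \<otimes> y) = chi x * chi y" if "x \<in> K" "y \<in> K" for x y
    using chi that by (simp add: character_on_def)
  have chi1: "chi \<one> = 1" using chi by (simp add: character_on_def)
  have chip: "chi (x [^] (j::nat)) = chi x ^ j" if x: "x \<in> K" for x j
  proof (induction j)
    case (Suc j)
    have "x [^] j \<in> K" using subgroup_pow[OF K x] by blast
    then show ?case using Suc x by (simp add: chim)
  qed (simp add: chi1)
  show ?thesis
  proof (intro exI[of _ n] conjI n1 n(2) allI impI)
    fix \<eta> assume \<eta>: "\<eta> ^ n = chi (a [^] n)"
    have aK: "chi (a [^] i) = \<eta> ^ i" if aK: "a [^] i \<in> K" for i
    proof -
      obtain j where j: "i = n * j" using dvd[OF aK] by blast
      have "chi (a [^] i) = chi (a [^] n) ^ j" using a chip[OF n(2)] by (simp add: j nat_pow_pow[symmetric])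
      then show ?thesis by (simp add: j \<eta>[symmetric] power_mult)
    qed
    have wd': "chi k * \<eta> ^ i = chi k' * \<eta> ^ j"
      if k: "k \<in> K" "k' \<in> K" and eq: "k \<otimes> a [^] i = k' \<otimes> a [^] j" and ij: "i \<le> j" for k k' i j
    proof -
      have "k \<otimes> a [^] i = k' \<otimes> a [^] (j - i) \<otimes> a [^] i"
        using eq ij k Ks a by (simp add: m_assoc nat_pow_mult)
      then have kk: "k = k' \<otimes> a [^] (j - i)" using k Ks a by simp
      then have "a [^] (j - i) = inv k' \<otimes> k" using k Ks a by (simp add: cancel_inv)
      then have "a [^] (j - i) \<in> K" using k K by (simp add: subgroup.m_closed subgroup.m_inv_closed)
      then have "chi k = chi k' * \<eta> ^ (j - i)" using kk chim[OF k(2)] aK by metis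
      then show ?thesis using ij by (simp add: power_add[symmetric])
    qed
    have wd: "chi k * \<eta> ^ i = chi k' * \<eta> ^ j"
      if "k \<in> K" "k' \<in> K" "k \<otimes> a [^] i = k' \<otimes> a [^] j" for k k' i j
      using wd'[of k k' i j] wd'[of k' k j i] that by (cases "i \<le> j") auto
    define chi' where "chi' x = (SOME c. \<exists>k\<in>K. \<exists>i. x = k \<otimes> a [^] (i::nat) \<and> c = chi k * \<eta> ^ i)" for x
    have val: "chi' (k \<otimes> a [^] i) = chi k * \<eta> ^ i" if "k \<in> K" for k and i :: nat
      unfolding chi'_def
    proof (rule some_equality)
      fix c assume "\<exists>k'\<in>K. \<exists>j. k \<otimes> a [^] i = k' \<otimes> a [^] (j::nat) \<and> c = chi k' * \<eta> ^ j"
      then show "c = chi k * \<eta> ^ i" using wd[OF that] by metis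
    qed (use that in blast)
    have vK: "chi' k = chi k" if "k \<in> K" for k using val[OF that, of 0] Ks[OF that] by simp
    moreover have "chi' a = \<eta>" using val[OF subgroup.one_closed[OF K], of 1] a by (simp add: chi1)
    moreover have "character_on (adjoin K a) chi'"
      unfolding character_on_def
    proof (intro conjI ballI)
      show "chi' \<one> = 1" using vK[OF subgroup.one_closed[OF K]] by (simp add: chi1)
      fix x y assume "x \<in> adjoin K a" "y \<in> adjoin K a"
      then obtain k i k' j where x: "x = k \<otimes> a [^] (i::nat)" "k \<in> K" and y: "y = k' \<otimes> a [^] (j::nat)" "k' \<in> K"
        by (auto simp: adjoin_def)
      have "x \<otimes> y = (k \<otimes> k') \<otimes> a [^] (i + j)"
        unfolding x y by (rule adjoin_mult[OF K a(1) com x(2) y(2)])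
      then show "chi' (x \<otimes> y) = chi' x * chi' y"
        using val[of "k \<otimes> k'" "i + j"] val x y subgroup.m_closed[OF K] chim
        by (simp add: power_add)
    qed
    ultimately show "\<exists>chi'. character_on (adjoin K a) chi' \<and> chi' a = \<eta> \<and> (\<forall>k\<in>K. chi' k = chi k)"
      by blast
  qed
qed

lemma obtain_max_card:
  assumes "finite F" "K0 \<in> F"
  shows "\<exists>K\<in>F. \<forall>L\<in>F. card L \<le> card K"
proof -
  have "Max (card ` F) \<in> card ` F" using assms by (intro Max_in) auto
  then obtain K where K: "K \<in> F" "card K = Max (card ` F)" by auto
  then show ?thesis using assms by (intro bexI[of _ K]) auto
qed

text \<open>The trivial character of \<open>B\<close> extends to the group generated by \<open>B\<close> and \<open>z\<close> with a nontrivial root of unity as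
its value at \<open>z\<close>, and then step by step to \<open>A\<close>.\<close>

lemma character_separates:
  assumes A: "subgroup A G" "commuting A" and B: "subgroup B G" "B \<subseteq> A" and z: "z \<in> A" "z \<notin> B"
  shows "\<exists>chi. character_on A chi \<and> (\<forall>x\<in>B. chi x = 1) \<and> chi z \<noteq> 1"
proof -
  have As: "x \<in> carrier G" if "x \<in> A" for x using that A subgroup.subset by blast
  have com: "x \<otimes> y = y \<otimes> x" if "x \<in> A" "y \<in> A" for x y using that A by (simp add: commuting_def)
  define F where "F = {K. subgroup K G \<and> B \<subseteq> K \<and> K \<subseteq> A \<and> z \<in> K \<and>
      (\<exists>chi. character_on K chi \<and> (\<forall>x\<in>B. chi x = 1) \<and> chi z \<noteq> 1)}"
  have step: "subgroup (adjoin K a) G" "K \<subseteq> adjoin K a" "a \<in> adjoin K a" "adjoin K a \<subseteq> A"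
    if "subgroup K G" "K \<subseteq> A" "a \<in> A" for K a
  proof -
    have c: "\<And>k. k \<in> K \<Longrightarrow> k \<otimes> a = a \<otimes> k" using com that by blast
    show "subgroup (adjoin K a) G" "K \<subseteq> adjoin K a" "a \<in> adjoin K a" "adjoin K a \<subseteq> A"
      using adjoin_subgroup[OF that(1) As[OF that(3)] c] adjoin_contains[OF that(1) As[OF that(3)] c]
        adjoin_subset[OF that(1) As[OF that(3)] c A(1) that(2,3)] by auto
  qed
  have "adjoin B z \<in> F"
  proof -
    have "character_on B (\<lambda>_. 1)" by (simp add: character_on_def)
    moreover have "k \<otimes> z = z \<otimes> k" if "k \<in> B" for k using that com B z by blast
    ultimately obtain n where n: "1 < n" and ext: "\<And>\<eta>. \<eta> ^ n = 1 \<Longrightarrow>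
        \<exists>chi'. character_on (adjoin B z) chi' \<and> chi' z = \<eta> \<and> (\<forall>k\<in>B. chi' k = 1)"
      using character_extend[OF B(1) As[OF z(1)] z(2), of "\<lambda>_. 1"] by auto
    let ?\<eta> = "cis (2 * pi / n)"
    have "?\<eta> ^ n = cis (real n * (2 * pi / real n))" by (rule Complex.DeMoivre)
    also have "real n * (2 * pi / real n) = 2 * pi" using n by simp
    finally have "?\<eta> ^ n = 1" by simp
    moreover have "?\<eta> \<noteq> 1"
    proof
      assume "?\<eta> = 1"
      then have "cos (2 * pi / n) = 1" by (simp add: complex_eq_iff)
      then obtain k :: int where "2 * pi / n = of_int k * 2 * pi" using cos_one_2pi_int by auto
      then have "1 = of_int k * real n" using n by (simp add: field_simps)
      then have "k * int n = 1" by (metis of_int_eq_1_iff of_int_mult of_int_of_nat_eq)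
      then show False using n by (simp add: zmult_eq_1_iff)
    qed
    ultimately show ?thesis using ext[of ?\<eta>] step[OF B z(1)] by (auto simp: F_def)
  qed
  moreover have "finite F"
    by (rule finite_subset[of _ "Pow (carrier G)"]) (use As fin in \<open>auto simp: F_def\<close>)
  ultimately have "\<exists>K\<in>F. \<forall>L\<in>F. card L \<le> card K" by (intro obtain_max_card)
  then obtain K where K: "K \<in> F" and max: "\<And>L. L \<in> F \<Longrightarrow> card L \<le> card K" by blast
  then obtain chi where Kp: "subgroup K G" "B \<subseteq> K" "K \<subseteq> A" "z \<in> K"
    and chi: "character_on K chi" "\<forall>x\<in>B. chi x = 1" "chi z \<noteq> 1" by (auto simp: F_def)
  have "K = A"
  proof (rule ccontr)
    assume "K \<noteq> A"
    then obtain a where a: "a \<in> A" "a \<notin> K" using Kp by blast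
    have "k \<otimes> a = a \<otimes> k" if "k \<in> K" for k using that com Kp a by blast
    then obtain n where n: "1 < n" and ext: "\<And>\<eta>. \<eta> ^ n = chi (a [^] n) \<Longrightarrow>
        \<exists>chi'. character_on (adjoin K a) chi' \<and> chi' a = \<eta> \<and> (\<forall>k\<in>K. chi' k = chi k)"
      using character_extend[OF Kp(1) As[OF a(1)] a(2) _ chi(1)] by auto
    obtain \<eta> where "\<eta> ^ n = chi (a [^] n)" using complex_root_exists[of n "chi (a [^] n)"] n by auto
    then obtain chi' where chi': "character_on (adjoin K a) chi'" "\<forall>k\<in>K. chi' k = chi k" using ext by blast
    have "adjoin K a \<in> F"
      unfolding F_def using step[OF Kp(1,3) a(1)] chi' chi Kp by (auto intro!: exI[of _ chi'])
    then have "card (adjoin K a) \<le> card K" by (rule max)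
    moreover have "finite (adjoin K a)" using step(4)[OF Kp(1,3) a(1)] As fin by (meson finite_subset subsetI)
    ultimately have "adjoin K a = K" using step(2)[OF Kp(1,3) a(1)] by (metis card_seteq)
    then show False using step(3)[OF Kp(1,3) a(1)] a by simp
  qed
  then show ?thesis using chi by blast
qed

end

section \<open>Normalizers of abelian subgroups in a nonabelian group\<close>

context finite_group
begin

definition conjugate :: "'a \<Rightarrow> 'a \<Rightarrow> 'a" where
  "conjugate g x = g \<otimes> x \<otimes> inv g"

lemma conjugate_closed [simp]: "g \<in> carrier G \<Longrightarrow> x \<in> carrier G \<Longrightarrow> conjugate g x \<in> carrier G"
  by (simp add: conjugate_def)

lemma conjugate_mult:
  "g \<in> carrier G \<Longrightarrow> x \<in> carrier G \<Longrightarrow> y \<in> carrier G \<Longrightarrow>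
     conjugate g (x \<otimes> y) = conjugate g x \<otimes> conjugate g y"
  by (simp add: conjugate_def m_assoc cancel_inv)

lemma conjugate_conjugate:
  "g \<in> carrier G \<Longrightarrow> h \<in> carrier G \<Longrightarrow> x \<in> carrier G \<Longrightarrow>
     conjugate g (conjugate h x) = conjugate (g \<otimes> h) x"
  by (simp add: conjugate_def m_assoc inv_mult_group)

lemma conjugate_inv_cancel [simp]:
  assumes "g \<in> carrier G" "x \<in> carrier G"
  shows "conjugate (inv g) (conjugate g x) = x" "conjugate g (conjugate (inv g) x) = x"
  using assms by (simp_all add: conjugate_conjugate) (simp_all add: conjugate_def)

lemma conjugate_image_subgroup:
  assumes M: "subgroup M G" and g: "g \<in> carrier G"
  shows "subgroup (conjugate g ` M) G"
proof (rule subgroupI)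
  have Ms: "x \<in> carrier G" if "x \<in> M" for x using that M subgroup_elem by blast
  show "conjugate g ` M \<subseteq> carrier G" using Ms g by auto
  show "conjugate g ` M \<noteq> {}" using subgroup.one_closed[OF M] by auto
  show "inv x \<in> conjugate g ` M" if x: "x \<in> conjugate g ` M" for x
  proof -
    obtain m where m: "x = conjugate g m" "m \<in> M" using x by blast
    have "inv x = conjugate g (inv m)"
      using m Ms g by (simp add: conjugate_def inv_mult_group m_assoc)
    then show ?thesis using m subgroup.m_inv_closed[OF M] by blast
  qed
  show "x \<otimes> y \<in> conjugate g ` M" if xy: "x \<in> conjugate g ` M" "y \<in> conjugate g ` M" for x y
  proof -
    obtain m n where "x = conjugate g m" "m \<in> M" "y = conjugate g n" "n \<in> M" using xy by blast
    then have "x \<otimes> y = conjugate g (m \<otimes> n)" "m \<otimes> n \<in> M"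
      using Ms g conjugate_mult subgroup.m_closed[OF M] by auto
    then show ?thesis by blast
  qed
qed

lemma conjugate_image_commuting:
  assumes "M \<subseteq> carrier G" "g \<in> carrier G" "commuting M"
  shows "commuting (conjugate g ` M)"
  using assms unfolding commuting_def
  by (auto simp: conjugate_mult[symmetric] subset_iff) 

definition centralizer_in :: "'a set \<Rightarrow> 'a \<Rightarrow> 'a set" where
  "centralizer_in H x = {y \<in> H. y \<otimes> x = x \<otimes> y}"

lemma centralizer_in_subgroup:
  assumes H: "subgroup H G" and x: "x \<in> carrier G"
  shows "subgroup (centralizer_in H x) G"
proof (rule subgroupI)
  have Hs: "y \<in> carrier G" if "y \<in> H" for y using that H subgroup_elem by blast
  show "centralizer_in H x \<subseteq> carrier G" using Hs by (auto simp: centralizer_in_def)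
  show "centralizer_in H x \<noteq> {}" using subgroup.one_closed[OF H] x by (auto simp: centralizer_in_def)
  show "inv y \<in> centralizer_in H x" if "y \<in> centralizer_in H x" for y
    using that Hs x subgroup.m_inv_closed[OF H] commute_inv[of x y] by (auto simp: centralizer_in_def)
  show "y \<otimes> z \<in> centralizer_in H x" if "y \<in> centralizer_in H x" "z \<in> centralizer_in H x" for y z
    using that Hs x subgroup.m_closed[OF H] commute_mult[of x y z] by (auto simp: centralizer_in_def)
qed

definition normalizes :: "'a \<Rightarrow> 'a set \<Rightarrow> bool" where
  "normalizes g A \<longleftrightarrow> g \<in> carrier G \<and> (\<forall>a\<in>A. conjugate (inv g) a \<in> A)"

text \<open>Suppose there is no such subgroup, and let \<open>H\<close> be a nonabelian subgroup of least order, with center \<open>Z\<close>.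
The maximal abelian subgroups of \<open>H\<close> are self-normalizing in \<open>H\<close>, and any two of them meet in \<open>Z\<close>, because
the centralizer of a common noncentral element would be a proper, hence abelian, subgroup
containing both. So the conjugates of one of them, \<open>M\<close>, contain altogether
\<open>card H * (card M - card Z) / card M\<close> noncentral elements. This is at least half of \<open>card H\<close>, but
not all noncentral elements. A maximal abelian subgroup through a missed element accounts for as many
again, which together with \<open>Z\<close> is more than there is.\<close>

lemma abelian_subgroup_noncentral_normalizer:
  assumes nonab: "\<not> commuting (carrier G)"
  shows "\<exists>A g. subgroup A G \<and> commuting A \<and> normalizes g A \<and> (\<exists>a\<in>A. a \<otimes> g \<noteq> g \<otimes> a)"
proof (rule ccontr)
  assume "\<not> ?thesis"
  then have NC: "a \<otimes> g = g \<otimes> a"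
    if "subgroup A G" "commuting A" "normalizes g A" "a \<in> A" for A g a
    using that by blast
  \<comment> \<open>\<open>H\<close> is nonabelian of least order, so all its proper subgroups are abelian.\<close>
  define P where "P = (\<lambda>H. subgroup H G \<and> \<not> commuting H)"
  have "P (carrier G)" using nonab subgroup_self by (simp add: P_def)
  then obtain H where PH: "P H" and Hmin: "\<And>K. P K \<Longrightarrow> card H \<le> card K"
    using ex_has_least_nat[of P "carrier G" card] by blast
  have H: "subgroup H G" and Hn: "\<not> commuting H" using PH by (auto simp: P_def)
  have Hs: "x \<in> carrier G" if "x \<in> H" for x using that H subgroup_elem by blast
  have fH: "finite H" using Hs fin by (meson finite_subset subsetI)
  have proper: "commuting K" if "subgroup K G" "K \<subset> H" for K
  proof (rule ccontr)
    assume "\<not> commuting K"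
    then have "card H \<le> card K" using Hmin that by (simp add: P_def)
    moreover have "card K < card H" using that fH by (rule_tac psubset_card_mono)
    ultimately show False by simp
  qed
  define Z where "Z = {x \<in> H. \<forall>y\<in>H. x \<otimes> y = y \<otimes> x}"
  have ZH: "Z \<subseteq> H" by (auto simp: Z_def)
  \<comment> \<open>the maximal abelian subgroups of \<open>H\<close>: those that contain their own centralizers in \<open>H\<close>\<close>
  define mab where "mab M \<longleftrightarrow> subgroup M G \<and> M \<subseteq> H \<and> commuting M \<and>
     (\<forall>g\<in>H. (\<forall>m\<in>M. m \<otimes> g = g \<otimes> m) \<longrightarrow> g \<in> M)" for M
  have mab_ex: "\<exists>M. mab M \<and> y \<in> M" if y: "y \<in> H" for y
  proof -
    define F where "F = {M. subgroup M G \<and> M \<subseteq> H \<and> commuting M \<and> y \<in> M}"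
    have c1: "commuting {\<one>}" by (simp add: commuting_def)
    have yc: "y \<in> carrier G" using Hs y by blast
    have k1: "\<And>k. k \<in> {\<one>} \<Longrightarrow> k \<otimes> y = y \<otimes> k" using yc by simp
    note t = triv_subgroup
    have "adjoin {\<one>} y \<in> F"
      unfolding F_def using adjoin_subgroup[OF t yc k1] adjoin_contains(2)[OF t yc k1]
        adjoin_commuting[OF t yc k1 c1] adjoin_subset[OF t yc k1 H _ y] subgroup.one_closed[OF H] by simp
    moreover have "finite F"
      by (rule finite_subset[of _ "Pow H"]) (use fH in \<open>auto simp: F_def\<close>)
    ultimately have "\<exists>M\<in>F. \<forall>L\<in>F. card L \<le> card M" by (intro obtain_max_card)
    then obtain M where M: "M \<in> F" and max: "\<And>L. L \<in> F \<Longrightarrow> card L \<le> card M" by blast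
    have Mp: "subgroup M G" "M \<subseteq> H" "commuting M" "y \<in> M" using M by (auto simp: F_def)
    have "g \<in> M" if g: "g \<in> H" and c: "\<forall>m\<in>M. m \<otimes> g = g \<otimes> m" for g
    proof -
      have c': "\<And>m. m \<in> M \<Longrightarrow> m \<otimes> g = g \<otimes> m" using c by blast
      note gc = Hs[OF g]
      have "adjoin M g \<in> F"
        unfolding F_def using adjoin_subgroup[OF Mp(1) gc c'] adjoin_contains(1)[OF Mp(1) gc c']
          adjoin_commuting[OF Mp(1) gc c' Mp(3)] adjoin_subset[OF Mp(1) gc c' H Mp(2) g] Mp(4) by auto
      then have le: "card (adjoin M g) \<le> card M" and "adjoin M g \<subseteq> H" using max by (auto simp: F_def)
      then have "finite (adjoin M g)" using fH finite_subset by blast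
      then have "M = adjoin M g" using adjoin_contains(1)[OF Mp(1) gc c'] le by (intro card_seteq) auto
      then show ?thesis using adjoin_contains(2)[OF Mp(1) gc c'] by simp
    qed
    then show ?thesis using Mp by (auto simp: mab_def)
  qed
  have mabD: "subgroup M G" "M \<subseteq> H" "commuting M" if "mab M" for M using that by (auto simp: mab_def)
  have mab_max: "g \<in> M" if "mab M" "g \<in> H" "\<And>m. m \<in> M \<Longrightarrow> m \<otimes> g = g \<otimes> m" for M g
    using that by (auto simp: mab_def)
  have ZM: "Z \<subseteq> M" if "mab M" for M
    using mab_max[OF that] mabD(2)[OF that] by (fastforce simp: Z_def)
  have inter: "x \<in> Z" if M: "mab M" "mab N" "M \<noteq> N" and x: "x \<in> M" "x \<in> N" for M N x
  proof -
    have xH: "x \<in> H" using mabD(2)[OF M(1)] x by blast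
    have C: "subgroup (centralizer_in H x) G" using centralizer_in_subgroup[OF H Hs[OF xH]] .
    have MC: "K \<subseteq> centralizer_in H x" if "mab K" "x \<in> K" for K
      using mabD(2,3)[OF that(1)] that(2) by (auto simp: centralizer_in_def commuting_def)
    have "centralizer_in H x = H"
    proof (rule ccontr)
      assume "centralizer_in H x \<noteq> H"
      then have "centralizer_in H x \<subset> H" by (auto simp: centralizer_in_def)
      then have cc: "commuting (centralizer_in H x)" using proper C by blast
      have "centralizer_in H x \<subseteq> K" if K: "mab K" "x \<in> K" for K
      proof
        fix g assume g: "g \<in> centralizer_in H x"
        then have "g \<in> H" by (simp add: centralizer_in_def)
        moreover have "m \<otimes> g = g \<otimes> m" if "m \<in> K" for m
          using that MC[OF K] cc g by (auto simp: commuting_def)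
        ultimately show "g \<in> K" by (rule mab_max[OF K(1)])
      qed
      then show False using MC M x by blast
    qed
    then have "y \<otimes> x = x \<otimes> y" if "y \<in> H" for y
      using that unfolding centralizer_in_def by blast
    then show ?thesis using xH by (simp add: Z_def)
  qed
  have self_norm: "g \<in> M" if M: "mab M" and g: "g \<in> H" and n: "conjugate g ` M = M" for M g
  proof -
    have gc: "g \<in> carrier G" using Hs g by blast
    have Ms: "m \<in> carrier G" if "m \<in> M" for m using mabD(2)[OF M] that Hs by blast
    have "conjugate (inv g) a \<in> M" if aM: "a \<in> M" for a
    proof -
      obtain m where "m \<in> M" "a = conjugate g m" using n aM by blast
      then show ?thesis using gc Ms by simp
    qed
    then have "normalizes g M" using gc by (simp add: normalizes_def)
    then show ?thesis using mab_max[OF M g] NC[OF mabD(1,3)[OF M]] by blast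
  qed
  have conj_H: "conjugate g x \<in> H" if "g \<in> H" "x \<in> H" for g x
    using that subgroup.m_closed[OF H] subgroup.m_inv_closed[OF H] by (simp add: conjugate_def)
  have conj_mab: "mab (conjugate g ` M)" if M: "mab M" and g: "g \<in> H" for M g
    unfolding mab_def
  proof (intro conjI ballI impI)
    have gc: "g \<in> carrier G" using Hs g by blast
    have MG: "M \<subseteq> carrier G" using mabD(2)[OF M] Hs by blast
    show "subgroup (conjugate g ` M) G" using conjugate_image_subgroup[OF mabD(1)[OF M] gc] .
    show "conjugate g ` M \<subseteq> H" using conj_H[OF g] mabD(2)[OF M] by blast
    show "commuting (conjugate g ` M)" using conjugate_image_commuting[OF MG gc mabD(3)[OF M]] .
    fix x assume x: "x \<in> H" and c: "\<forall>m\<in>conjugate g ` M. m \<otimes> x = x \<otimes> m"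
    have xc: "x \<in> carrier G" using Hs x by blast
    have "inv g \<in> H" using subgroup.m_inv_closed[OF H] g by blast
    then have "conjugate (inv g) x \<in> H" using conj_H x by blast
    moreover have "m \<otimes> conjugate (inv g) x = conjugate (inv g) x \<otimes> m" if m: "m \<in> M" for m
    proof -
      have mc: "m \<in> carrier G" using MG m by blast
      have "conjugate (inv g) (conjugate g m \<otimes> x) = conjugate (inv g) (x \<otimes> conjugate g m)"
        using c m by simp
      then show ?thesis using mc xc gc by (simp add: conjugate_mult)
    qed
    ultimately have "conjugate (inv g) x \<in> M" by (rule mab_max[OF M])
    then have "conjugate g (conjugate (inv g) x) \<in> conjugate g ` M" by blast
    then show "x \<in> conjugate g ` M" using gc xc by simp
  qed
  \<comment> \<open>the noncentral elements of the conjugates of a maximal abelian subgroup\<close>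
  define S where "S M = (\<lambda>(g, m). conjugate g m) ` (H \<times> (M - Z))" for M
  have SH: "S M \<subseteq> H - Z" if M: "mab M" for M
  proof
    fix y assume "y \<in> S M"
    then obtain g m where gm: "g \<in> H" "m \<in> M" "m \<notin> Z" "y = conjugate g m" by (auto simp: S_def)
    have yH: "y \<in> H" using gm conj_H mabD(2)[OF M] by blast
    have "y \<notin> Z"
    proof
      assume yZ: "y \<in> Z"
      have mc: "m \<in> carrier G" "g \<in> carrier G" using gm mabD(2)[OF M] Hs by blast+
      have ig: "inv g \<in> H" using subgroup.m_inv_closed[OF H] gm by blast
      have "m = conjugate (inv g) y" using gm mc by simp
      also have "\<dots> = y"
      proof -
        have "inv g \<otimes> y = y \<otimes> inv g" using yZ ig by (simp add: Z_def)
        then show ?thesis using mc Hs[OF yH] by (simp add: conjugate_def m_assoc)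
      qed
      finally show False using yZ gm by simp
    qed
    then show "y \<in> H - Z" using yH by simp
  qed
  have count: "card (S M) * card M = card H * (card M - card Z)" if M: "mab M" for M
  proof -
    let ?f = "\<lambda>(g, m). conjugate g m"
    let ?D = "H \<times> (M - Z)"
    have Ms: "m \<in> carrier G" if "m \<in> M" for m using mabD(2)[OF M] that Hs by blast
    have fM: "finite M" using mabD(2)[OF M] fH finite_subset by blast
    have fD: "finite ?D" using fH fM by simp
    have fib: "card {p \<in> ?D. ?f p = y} = card M" if y: "y \<in> S M" for y
    proof -
      obtain g0 m0 where g0: "g0 \<in> H" and m0: "m0 \<in> M" "m0 \<notin> Z" and y0: "y = conjugate g0 m0"
        using y by (auto simp: S_def)
      note g0c = Hs[OF g0] and m0c = Ms[OF m0(1)]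
      have fix_m0: "conjugate k m0 = m0" if "k \<in> M" for k
      proof -
        have "k \<otimes> m0 = m0 \<otimes> k" using that m0 mabD(3)[OF M] by (auto simp: commuting_def)
        then show ?thesis using Ms[OF that] m0c by (simp add: conjugate_def m_assoc)
      qed
      have "{p \<in> ?D. ?f p = y} = (\<lambda>k. (g0 \<otimes> k, m0)) ` M"
      proof (intro equalityI subsetI)
        fix p assume "p \<in> {p \<in> ?D. ?f p = y}"
        then obtain g m where p: "p = (g, m)" "g \<in> H" "m \<in> M" "m \<notin> Z" "conjugate g m = y" by auto
        note gc = Hs[OF p(2)] and mc = Ms[OF p(3)]
        let ?k = "inv g0 \<otimes> g"
        have kH: "?k \<in> H" using g0 p subgroup.m_closed[OF H] subgroup.m_inv_closed[OF H] by blast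
        have km: "conjugate ?k m = m0"
        proof -
          have "conjugate ?k m = conjugate (inv g0) (conjugate g m)"
            using g0c gc mc by (simp add: conjugate_conjugate)
          then show ?thesis using p y0 g0c m0c by simp
        qed
        have "conjugate ?k ` M = M"
        proof (rule ccontr)
          assume "conjugate ?k ` M \<noteq> M"
          then have "m0 \<in> Z" using inter[OF conj_mab[OF M kH] M _ _ m0(1)] km p(3) by blast
          then show False using m0 by simp
        qed
        then have kM: "?k \<in> M" using self_norm[OF M kH] by blast
        have "m = m0"
        proof -
          have "?k \<otimes> m = m \<otimes> ?k" using kM p(3) mabD(3)[OF M] by (auto simp: commuting_def)
          then have "conjugate ?k m = m" using Ms[OF kM] mc by (simp add: conjugate_def m_assoc)
          then show ?thesis using km by simp
        qed
        moreover have "g = g0 \<otimes> ?k" using g0c gc by (simp add: cancel_inv)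
        ultimately show "p \<in> (\<lambda>k. (g0 \<otimes> k, m0)) ` M" using p(1) kM by blast
      next
        fix p assume "p \<in> (\<lambda>k. (g0 \<otimes> k, m0)) ` M"
        then obtain k where k: "k \<in> M" "p = (g0 \<otimes> k, m0)" by blast
        have "g0 \<otimes> k \<in> H" using subgroup.m_closed[OF H g0] mabD(2)[OF M] k by blast
        moreover have "conjugate (g0 \<otimes> k) m0 = y"
          using conjugate_conjugate[OF g0c Ms[OF k(1)] m0c] fix_m0[OF k(1)] y0 by simp
        ultimately show "p \<in> {p \<in> ?D. ?f p = y}" using k m0 by simp
      qed
      moreover have "inj_on (\<lambda>k. (g0 \<otimes> k, m0)) M" using g0c Ms by (auto intro!: inj_onI)
      ultimately show ?thesis by (simp add: card_image)
    qed
    have "card ?D = (\<Sum>y\<in>S M. card {p \<in> ?D. ?f p = y})"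
      using fD unfolding S_def by (subst card_eq_sum, subst sum.image_gen[OF fD, of _ ?f]) simp
    also have "\<dots> = card (S M) * card M" using fib by simp
    finally show ?thesis
      using card_Diff_subset[of Z M] ZM[OF M] fM finite_subset[OF ZM[OF M] fM]
      by (simp add: card_cartesian_product)
  qed
  have half: "card H \<le> 2 * card (S M)" if M: "mab M" and y: "y \<in> M" "y \<notin> Z" for M y
  proof -
    have Ms: "m \<in> carrier G" if "m \<in> M" for m using mabD(2)[OF M] that Hs by blast
    have fM: "finite M" using mabD(2)[OF M] fH finite_subset by blast
    have fZ: "finite Z" using ZM[OF M] fM finite_subset by blast
    have yH: "y \<in> H" using mabD(2)[OF M] y by blast
    have inv_part: "y \<otimes> z \<notin> Z" if z: "z \<in> Z" for z
    proof
      assume yz: "y \<otimes> z \<in> Z"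
      have zH: "z \<in> H" using z ZH by blast
      note zc = Hs[OF zH] and yc = Hs[OF yH]
      have "y \<otimes> w = w \<otimes> y" if w: "w \<in> H" for w
      proof -
        note wc = Hs[OF w]
        have zw: "z \<otimes> w = w \<otimes> z" using z w by (simp add: Z_def)
        have "y \<otimes> w \<otimes> z = y \<otimes> z \<otimes> w" using zc yc wc zw by (simp add: m_assoc)
        also have "\<dots> = w \<otimes> (y \<otimes> z)" using yz w by (simp add: Z_def)
        also have "\<dots> = w \<otimes> y \<otimes> z" using zc yc wc by (simp add: m_assoc)
        finally show ?thesis using zc yc wc by simp
      qed
      then show False using y yH by (simp add: Z_def)
    qed
    have "Z \<union> (\<lambda>z. y \<otimes> z) ` Z \<subseteq> M"
      using ZM[OF M] y subgroup.m_closed[OF mabD(1)[OF M]] by blast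
    then have "card (Z \<union> (\<lambda>z. y \<otimes> z) ` Z) \<le> card M" using fM card_mono by blast
    moreover have "card (Z \<union> (\<lambda>z. y \<otimes> z) ` Z) = card Z + card ((\<lambda>z. y \<otimes> z) ` Z)"
      using fZ inv_part by (intro card_Un_disjoint) auto
    moreover have "card ((\<lambda>z. y \<otimes> z) ` Z) = card Z"
      using Hs yH ZH by (intro card_image inj_onI) (auto simp: subset_iff)
    ultimately have ZM2: "2 * card Z \<le> card M" by simp
    have M0: "0 < card M" using fM y by (auto simp: card_gt_0_iff)
    have "card H * card M \<le> card H * (2 * (card M - card Z))" using ZM2 by (intro mult_left_mono) auto
    also have "\<dots> = 2 * card (S M) * card M" using count[OF M] by simp
    finally show ?thesis using M0 by simp
  qed
  obtain y0 where y0: "y0 \<in> H" "y0 \<notin> Z" using Hn by (auto simp: commuting_def Z_def)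
  obtain M where M: "mab M" "y0 \<in> M" using mab_ex[OF y0(1)] by blast
  have Z0: "\<one> \<in> Z" using subgroup.one_closed[OF H] Hs by (simp add: Z_def)
  have fZ: "finite Z" using fH ZH finite_subset by blast
  have cZ: "0 < card Z" using Z0 fZ by (auto simp: card_gt_0_iff)
  have cHZ: "card (H - Z) = card H - card Z" using ZH fZ by (simp add: card_Diff_subset)
  have ZHle: "card Z \<le> card H" using ZH fH card_mono by blast
  have "S M \<noteq> H - Z"
  proof
    assume eq: "S M = H - Z"
    have "M \<noteq> H" using Hn mabD(3)[OF M(1)] by auto
    then have lt: "card M < card H" using mabD(2)[OF M(1)] fH by (intro psubset_card_mono) auto
    have "(card H - card Z) * card M = card H * (card M - card Z)" using count[OF M(1)] eq cHZ by simp
    then have "card H * card M - card Z * card M = card H * card M - card H * card Z"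
      by (simp add: diff_mult_distrib diff_mult_distrib2)
    moreover have "card Z * card M \<le> card H * card M" using ZHle by simp
    moreover have "card H * card Z \<le> card H * card M"
      using ZM[OF M(1)] card_mono[of M Z] finite_subset[OF mabD(2)[OF M(1)] fH] by simp
    ultimately have "card Z * card M = card H * card Z" by linarith
    then have "card Z * card M = card Z * card H" by (simp only: mult.commute)
    then show False using cZ lt by simp
  qed
  then obtain y1 where y1: "y1 \<in> H" "y1 \<notin> Z" "y1 \<notin> S M" using SH[OF M(1)] by blast
  obtain N where N: "mab N" "y1 \<in> N" using mab_ex[OF y1(1)] by blast
  have "S M \<inter> S N = {}"
  proof (rule ccontr)
    assume "S M \<inter> S N \<noteq> {}"
    then obtain x where xS: "x \<in> S M" and xN: "x \<in> S N" by blast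
    obtain g m where gm: "g \<in> H" "m \<in> M" "x = conjugate g m" using xS unfolding S_def by auto
    obtain h n where hn: "h \<in> H" "n \<in> N" "x = conjugate h n" using xN unfolding S_def by auto
    have "x \<notin> Z" using SH[OF M(1)] xS by blast
    then have eq: "conjugate g ` M = conjugate h ` N"
      using inter[OF conj_mab[OF M(1) gm(1)] conj_mab[OF N(1) hn(1)]] gm hn by blast
    note gc = Hs[OF gm(1)] and hc = Hs[OF hn(1)] and yc = Hs[OF y1(1)]
    have "conjugate h y1 \<in> conjugate g ` M" using eq N by blast
    then obtain m' where m': "m' \<in> M" "conjugate h y1 = conjugate g m'" by blast
    have m'c: "m' \<in> carrier G" using m' mabD(2)[OF M(1)] Hs by blast
    have "y1 = conjugate (inv h) (conjugate g m')" using m' yc hc by (metis conjugate_inv_cancel(1))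
    then have ym: "y1 = conjugate (inv h \<otimes> g) m'" using gc hc m'c by (simp add: conjugate_conjugate)
    have kH: "inv h \<otimes> g \<in> H" using gm hn subgroup.m_closed[OF H] subgroup.m_inv_closed[OF H] by blast
    have "m' \<notin> Z"
    proof
      assume m'Z: "m' \<in> Z"
      then have "m' \<otimes> (inv h \<otimes> g) = (inv h \<otimes> g) \<otimes> m'" using kH by (simp add: Z_def)
      then have "conjugate (inv h \<otimes> g) m' = m'"
        using Hs[OF kH] m'c unfolding conjugate_def by (metis inv_solve_right m_closed)
      then show False using ym m'Z y1 by simp
    qed
    then have "y1 \<in> S M" unfolding S_def using kH m' ym by (intro image_eqI[of _ _ "(inv h \<otimes> g, m')"]) auto
    then show False using y1 by simp
  qed
  then have "card (S M \<union> S N) = card (S M) + card (S N)"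
    using SH[OF M(1)] SH[OF N(1)] fH by (intro card_Un_disjoint) (auto intro: finite_subset)
  moreover have "card (S M \<union> S N) \<le> card (H - Z)"
    using SH[OF M(1)] SH[OF N(1)] fH by (intro card_mono) auto
  ultimately show False
    using half[OF M(1,2) y0(2)] half[OF N(1,2) y1(2)] cHZ cZ ZHle by linarith
qed

end

section \<open>Pairs with central commutator\<close>

lemma prime_power_of_unique_prime_factor:
  assumes "0 < (n::nat)" "Factorial_Ring.prime q" "\<And>r. Factorial_Ring.prime r \<Longrightarrow> r dvd n \<Longrightarrow> r = q"
  shows "\<exists>m. n = q ^ m"
proof -
  obtain k where k: "n = q ^ multiplicity q n * k" "\<not> q dvd k"
    using multiplicity_decompose'[of n q] assms(1,2) by (metis less_irrefl not_prime_unit)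
  have "k = 1"
  proof (rule ccontr)
    assume "k \<noteq> 1"
    then obtain r where r: "Factorial_Ring.prime r" "r dvd k" using prime_factor_nat by blast
    then have "r dvd n" using k(1) by (metis dvd_mult)
    then have "r = q" using assms(3) r by blast
    then show False using r k by simp
  qed
  then show ?thesis using k by auto
qed

context finite_group
begin

lemma conjugate_inv_nat_pow:
  assumes b: "b \<in> carrier G" and A: "A \<subseteq> carrier G" and n: "\<And>a. a \<in> A \<Longrightarrow> conjugate (inv b) a \<in> A"
  shows "a \<in> A \<Longrightarrow> conjugate (inv (b [^] (n::nat))) a \<in> A"
proof (induction n arbitrary: a)
  case 0
  then show ?case using A by (auto simp: conjugate_def)
next
  case (Suc n)
  have ac: "a \<in> carrier G" using A Suc.prems by blast
  have "conjugate (inv (b [^] Suc n)) a = conjugate (inv b) (conjugate (inv (b [^] n)) a)"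
    using b ac by (simp add: conjugate_conjugate inv_mult_group)
  then show ?case using Suc n by simp
qed

text \<open>The commutator \<open>z\<close> of \<open>a\<close> and \<open>b\<close> is central in the subgroup that they generate, and has prime order
when \<open>q\<close> is prime.\<close>

definition class_two_pair :: "nat \<Rightarrow> 'a \<Rightarrow> 'a \<Rightarrow> 'a \<Rightarrow> bool" where
  "class_two_pair q a b z \<longleftrightarrow> a \<in> carrier G \<and> b \<in> carrier G \<and> z \<in> carrier G \<and> a \<otimes> b = b \<otimes> a \<otimes> z \<and>
     z \<otimes> a = a \<otimes> z \<and> z \<otimes> b = b \<otimes> z \<and> z \<noteq> \<one> \<and> z [^] q = \<one>"

lemma class_two_swap:
  assumes "class_two_pair q a b z" shows "class_two_pair q b a (inv z)"
proof -
  have c: "a \<in> carrier G" "b \<in> carrier G" "z \<in> carrier G" "a \<otimes> b = b \<otimes> a \<otimes> z"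
    "z \<otimes> a = a \<otimes> z" "z \<otimes> b = b \<otimes> z" "z \<noteq> \<one>" "z [^] q = \<one>"
    using assms by (auto simp: class_two_pair_def)
  have "b \<otimes> a = a \<otimes> b \<otimes> inv z" unfolding c(4) using c by (simp add: m_assoc)
  moreover have "inv z \<otimes> a = a \<otimes> inv z" using commute_inv[of a z] c by simp
  moreover have "inv z \<otimes> b = b \<otimes> inv z" using commute_inv[of b z] c by simp
  moreover have "inv z [^] q = \<one>" using c by (simp add: nat_pow_inv)
  ultimately show ?thesis using c by (auto simp: class_two_pair_def)
qed

lemma commutator_power_left:
  assumes "a \<in> carrier G" "b \<in> carrier G" "z \<in> carrier G" "a \<otimes> b = b \<otimes> a \<otimes> z" "z \<otimes> a = a \<otimes> z"
  shows "a [^] (i::nat) \<otimes> b = b \<otimes> a [^] i \<otimes> z [^] i"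
proof (induction i)
  case (Suc i)
  have za: "z [^] i \<otimes> a = a \<otimes> z [^] i" using commute_pow[of a z i] assms by simp
  have "a [^] Suc i \<otimes> b = a [^] i \<otimes> (a \<otimes> b)" using assms by (simp add: m_assoc)
  also have "\<dots> = (a [^] i \<otimes> b) \<otimes> a \<otimes> z" unfolding assms(4) using assms by (simp add: m_assoc)
  also have "\<dots> = b \<otimes> a [^] i \<otimes> (z [^] i \<otimes> a) \<otimes> z" unfolding Suc using assms by (simp add: m_assoc)
  also have "\<dots> = b \<otimes> a [^] Suc i \<otimes> z [^] Suc i" unfolding za using assms by (simp add: m_assoc)
  finally show ?case .
qed (use assms in simp)

lemma commutator_power_right:
  assumes "a \<in> carrier G" "b \<in> carrier G" "z \<in> carrier G" "a \<otimes> b = b \<otimes> a \<otimes> z" "z \<otimes> b = b \<otimes> z"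
  shows "a \<otimes> b [^] (j::nat) = b [^] j \<otimes> a \<otimes> z [^] j"
proof (induction j)
  case (Suc j)
  have zb: "z [^] j \<otimes> b = b \<otimes> z [^] j" using commute_pow[of b z j] assms by simp
  have "a \<otimes> b [^] Suc j = (a \<otimes> b [^] j) \<otimes> b" using assms by (simp add: m_assoc)
  also have "\<dots> = b [^] j \<otimes> a \<otimes> (z [^] j \<otimes> b)" unfolding Suc using assms by (simp add: m_assoc)
  also have "\<dots> = b [^] j \<otimes> (a \<otimes> b) \<otimes> z [^] j" unfolding zb using assms(1-3) by (simp add: m_assoc)
  also have "\<dots> = b [^] j \<otimes> b \<otimes> a \<otimes> (z \<otimes> z [^] j)"
    unfolding assms(4) using assms(1-3) by (simp add: m_assoc)
  also have "\<dots> = b [^] Suc j \<otimes> a \<otimes> z [^] Suc j"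
    by (simp only: nat_pow_Suc2[OF assms(3), symmetric]) simp
  finally show ?case .
qed (use assms in simp)

text \<open>Moving the \<open>n\<close> factors \<open>y\<close> past the factors \<open>x\<close> to their right takes \<open>n * (n - 1) div 2\<close> transpositions, and each
contributes a factor \<open>w\<close>.\<close>

lemma mult_pow_class_two:
  assumes c: "x \<in> carrier G" "y \<in> carrier G" "w \<in> carrier G" and yx: "y \<otimes> x = x \<otimes> y \<otimes> w"
    and wx: "w \<otimes> x = x \<otimes> w" and wy: "w \<otimes> y = y \<otimes> w"
  shows "(x \<otimes> y) [^] (n::nat) = x [^] n \<otimes> y [^] n \<otimes> w [^] (n * (n - 1) div 2)"
proof (induction n)
  case (Suc n)
  let ?t = "n * (n - 1) div 2"
  have t: "Suc n * (Suc n - 1) div 2 = ?t + n"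
  proof -
    have "Suc n * (Suc n - 1) = n * (n - 1) + 2 * n" by (cases n) (auto simp: algebra_simps)
    then show ?thesis by simp
  qed
  have wxp: "w [^] i \<otimes> x = x \<otimes> w [^] i" and wyp: "w [^] i \<otimes> y = y \<otimes> w [^] i" for i :: nat
    using commute_pow[of x w i] commute_pow[of y w i] c wx wy by simp_all
  have yp: "y [^] n \<otimes> x = x \<otimes> y [^] n \<otimes> w [^] n" by (rule commutator_power_left[OF c(2,1,3) yx wy])
  have "(x \<otimes> y) [^] Suc n = x [^] n \<otimes> y [^] n \<otimes> (w [^] ?t \<otimes> x) \<otimes> y"
    using Suc c by (simp add: m_assoc)
  also have "\<dots> = x [^] n \<otimes> (y [^] n \<otimes> x) \<otimes> (w [^] ?t \<otimes> y)" unfolding wxp using c by (simp add: m_assoc)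
  also have "\<dots> = x [^] n \<otimes> x \<otimes> y [^] n \<otimes> (w [^] n \<otimes> y) \<otimes> w [^] ?t"
    unfolding yp wyp[of ?t] using c by (simp add: m_assoc)
  also have "\<dots> = x [^] Suc n \<otimes> y [^] Suc n \<otimes> (w [^] n \<otimes> w [^] ?t)" unfolding wyp[of n] using c by (simp add: m_assoc)
  also have "\<dots> = x [^] Suc n \<otimes> y [^] Suc n \<otimes> w [^] (Suc n * (Suc n - 1) div 2)"
    unfolding t using c by (simp add: nat_pow_mult add.commute)
  finally show ?case .
qed simp

lemma ord_prime_eq:
  assumes "Factorial_Ring.prime q" "z \<in> carrier G" "z \<noteq> \<one>" "z [^] q = \<one>"
  shows "ord z = q"
proof -
  have "ord z dvd q" using assms by (simp add: pow_eq_id[symmetric])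
  moreover have "ord z \<noteq> 1" using ord_eq_1[OF assms(2)] assms(3) by blast
  ultimately show ?thesis using assms(1) by (metis prime_nat_iff)
qed

lemma class_two_pair_power:
  assumes q: "Factorial_Ring.prime q" and p: "class_two_pair q a b z" and i: "\<not> q dvd i"
  shows "class_two_pair q (a [^] i) b (z [^] i)"
proof -
  have c: "a \<in> carrier G" "b \<in> carrier G" "z \<in> carrier G" "a \<otimes> b = b \<otimes> a \<otimes> z"
    "z \<otimes> a = a \<otimes> z" "z \<otimes> b = b \<otimes> z" "z \<noteq> \<one>" "z [^] q = \<one>"
    using p by (auto simp: class_two_pair_def)
  have "ord z = q" by (rule ord_prime_eq[OF q c(3,7,8)])
  then have "z [^] i \<noteq> \<one>" using c(3) i by (simp add: pow_eq_id)
  moreover have "(z [^] i) [^] q = \<one>" using c by (simp add: nat_pow_pow mult.commute[of i]) (simp add: nat_pow_pow[symmetric])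
  moreover have "z [^] i \<otimes> b = b \<otimes> z [^] i" using commute_pow[of b z i] c by simp
  moreover have "z [^] i \<otimes> a [^] i = a [^] i \<otimes> z [^] i"
  proof -
    have "a \<otimes> z [^] i = z [^] i \<otimes> a" using commute_pow[of a z i] c by simp
    then show ?thesis using commute_pow[of "z [^] i" a i] c by simp
  qed
  ultimately show ?thesis using c commutator_power_left[OF c(1-5)] by (simp add: class_two_pair_def)
qed

text \<open>Raising \<open>a\<close> to a prime \<open>r\<close> other than \<open>q\<close> keeps the commutator nontrivial, so minimality leaves no such prime in the
order of \<open>a\<close>.\<close>

lemma class_two_pair_minimal_prime_power:
  assumes q: "Factorial_Ring.prime q" and p: "class_two_pair q a b z"
    and min: "\<forall>a' b' z'. class_two_pair q a' b' z' \<longrightarrow> ord a + ord b \<le> ord a' + ord b'"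
  shows "\<exists>m. ord a = q ^ m"
proof (rule prime_power_of_unique_prime_factor[OF _ q])
  have a: "a \<in> carrier G" using p by (simp add: class_two_pair_def)
  show "0 < ord a" using ord_pos[OF a] .
  fix r assume r: "Factorial_Ring.prime r" "r dvd ord a"
  show "r = q"
  proof (rule ccontr)
    assume "r \<noteq> q"
    then have "\<not> q dvd r" using q r primes_dvd_imp_eq by blast
    then have "ord a + ord b \<le> ord (a [^] r) + ord b" using min class_two_pair_power[OF q p] by blast
    moreover have "ord (a [^] r) = ord a div r" using r a by (intro ord_pow) (auto simp: prime_gt_0_nat)
    moreover have "ord a div r < ord a" using \<open>0 < ord a\<close> prime_gt_1_nat[OF r(1)] by simp
    ultimately show False by simp
  qed
qed

text \<open>The commutator has order \<open>q\<close>, so it generates the subgroup of order \<open>q\<close> of the cyclic group of \<open>b\<close>. This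
subgroup is proper, since \<open>b\<close> does not commute with \<open>a\<close> and the commutator does.\<close>

lemma class_two_pair_power_eq_commutator:
  assumes q: "Factorial_Ring.prime q" and p: "class_two_pair q a b z" and m: "ord b = q ^ m"
    and z: "z = b [^] (t::nat)"
  shows "\<exists>j. t = q ^ (m - 1) * j \<and> \<not> q dvd j \<and> 2 \<le> m"
proof -
  have c: "a \<in> carrier G" "b \<in> carrier G" "z \<in> carrier G" "a \<otimes> b = b \<otimes> a \<otimes> z"
    "z \<otimes> a = a \<otimes> z" "z \<otimes> b = b \<otimes> z" "z \<noteq> \<one>" "z [^] q = \<one>"
    using p by (auto simp: class_two_pair_def)
  have zt: "z [^] t = \<one>"
  proof -
    have "a \<otimes> b [^] t = b [^] t \<otimes> a \<otimes> z [^] t" by (rule commutator_power_right[OF c(1-4,6)])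
    moreover have "a \<otimes> b [^] t = b [^] t \<otimes> a" using c z by simp
    ultimately have "b [^] t \<otimes> a = b [^] t \<otimes> a \<otimes> z [^] t" by simp
    then show ?thesis using c(1-3) by (metis l_cancel_one' m_closed nat_pow_closed)
  qed
  then have qt: "q dvd t" using ord_prime_eq[OF q c(3,7,8)] c by (simp add: pow_eq_id)
  have "b [^] (t * q) = \<one>" using c z by (simp add: nat_pow_pow[symmetric])
  then have d1: "q ^ m dvd t * q" using c m by (simp add: pow_eq_id)
  have d2: "\<not> q ^ m dvd t" using c z m by (metis pow_eq_id)
  have "m \<noteq> 0" using d2 by (metis one_dvd power_0)
  then have qm: "q ^ m = q ^ (m - 1) * q" by (metis power_minus_mult neq0_conv)
  have q0: "0 < q" using q prime_gt_0_nat by blast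
  have "q ^ (m - 1) dvd t" using d1 q0 unfolding qm by simp
  then obtain j where j: "t = q ^ (m - 1) * j" by blast
  have nj: "\<not> q dvd j"
  proof
    assume "q dvd j"
    then have "q ^ (m - 1) * q dvd q ^ (m - 1) * j" by (rule mult_dvd_mono[OF dvd_refl])
    then show False using d2 j qm by simp
  qed
  have "m \<noteq> 1" using qt j nj by auto
  then show ?thesis using \<open>m \<noteq> 0\<close> j nj by (intro exI[of _ j]) auto
qed

text \<open>Both cyclic groups would have the same subgroup of order \<open>q\<close>. Then multiplying a power of \<open>b\<close> by a suitable
power of \<open>a\<close> makes its \<open>q^(n-1)\<close>-th power trivial, while the commutator with \<open>a\<close> stays nontrivial; this
contradicts minimality. The commutators that arise from expanding the power cancel because
\<open>N * (N - 1) div 2\<close> is a multiple of \<open>q\<close> for \<open>N = q^(n-1)\<close>, as \<open>q\<close> is odd and \<open>n\<close> is at least 2.\<close>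

lemma class_two_pair_not_both:
  assumes q: "Factorial_Ring.prime q" "odd q" and p: "class_two_pair q a b z"
    and min: "\<forall>a' b' z'. class_two_pair q a' b' z' \<longrightarrow> ord a + ord b \<le> ord a' + ord b'"
    and a: "z = a [^] (s::nat)" and b: "z = b [^] (t::nat)"
    and le: "ord b \<le> ord a"
  shows False
proof -
  have c: "a \<in> carrier G" "b \<in> carrier G" "z \<in> carrier G" "a \<otimes> b = b \<otimes> a \<otimes> z"
    "z \<otimes> a = a \<otimes> z" "z \<otimes> b = b \<otimes> z" "z \<noteq> \<one>" "z [^] q = \<one>"
    using p by (auto simp: class_two_pair_def)
  note p' = class_two_swap[OF p]
  have min': "\<forall>a' b' z'. class_two_pair q a' b' z' \<longrightarrow> ord b + ord a \<le> ord a' + ord b'"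
    using min by (simp only: add.commute[of "ord b"])
  obtain m where m: "ord a = q ^ m" using class_two_pair_minimal_prime_power[OF q(1) p min] by blast
  obtain n where n: "ord b = q ^ n" using class_two_pair_minimal_prime_power[OF q(1) p' min'] by blast
  obtain j where j: "t = q ^ (n - 1) * j" "\<not> q dvd j" "2 \<le> n"
    using class_two_pair_power_eq_commutator[OF q(1) p n b] by blast
  have iz: "inv z = a [^] ((ord a - 1) * s)" using a c inv_pow_nat by simp
  obtain i where i: "(ord a - 1) * s = q ^ (m - 1) * i"
    using class_two_pair_power_eq_commutator[OF q(1) p' m iz] by blast
  have q1: "1 < q" using q(1) prime_gt_1_nat by blast
  have nm: "n \<le> m" using le q1 unfolding m n by simp
  \<comment> \<open>The exponent \<open>y\<close> is chosen such that the \<open>?N\<close>-th power of \<open>?y\<close> is the inverse of that of \<open>?x\<close>.\<close>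
  define y where "y = q ^ (m - n) * i"
  let ?x = "b [^] j" and ?y = "a [^] y"
  let ?N = "q ^ (n - 1)"
  have ab: "a \<otimes> ?x = ?x \<otimes> a \<otimes> z [^] j" by (rule commutator_power_right[OF c(1-4,6)])
  have zjc: "z [^] j \<in> carrier G" using c by simp
  have zja: "z [^] j \<otimes> a = a \<otimes> z [^] j" using commute_pow[of a z j] c by simp
  have zjb: "z [^] j \<otimes> b = b \<otimes> z [^] j" using commute_pow[of b z j] c by simp
  let ?w = "(z [^] j) [^] y"
  have yx: "?y \<otimes> ?x = ?x \<otimes> ?y \<otimes> ?w"
    by (rule commutator_power_left[OF c(1) _ zjc ab zja]) (use c in simp)
  have wa: "a \<otimes> ?w = ?w \<otimes> a" using commute_pow[of a "z [^] j" y] c zja by simp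
  have wb: "b \<otimes> ?w = ?w \<otimes> b" using commute_pow[of b "z [^] j" y] c zjb by simp
  have wx: "?w \<otimes> ?x = ?x \<otimes> ?w" using commute_pow[of ?w b j] wb c by simp
  have wy: "?w \<otimes> ?y = ?y \<otimes> ?w" using commute_pow[of ?w a y] wa c by simp
  have Nodd: "odd ?N" using q by simp
  have qN: "q dvd ?N" using j(3) by (cases n; cases "n - 1") auto
  have "?N * (?N - 1) div 2 = ?N * ((?N - 1) div 2)"
    using Nodd by (metis div_mult_swap even_diff_nat odd_one dvd_div_mult odd_even_add even_diff_nat odd_pos)
  then have "q dvd ?N * (?N - 1) div 2" using qN by simp
  then obtain e where e: "?N * (?N - 1) div 2 = q * e" by blast
  have w1: "?w [^] (?N * (?N - 1) div 2) = \<one>"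
  proof -
    have "?w [^] (q * e) = z [^] (q * (j * y * e))"
      using c by (simp add: nat_pow_pow algebra_simps)
    also have "\<dots> = (z [^] q) [^] (j * y * e)" by (simp only: nat_pow_pow[OF c(3)])
    also have "\<dots> = \<one>" by (simp only: c(8) nat_pow_one)
    finally show ?thesis unfolding e .
  qed
  have "(?x \<otimes> ?y) [^] ?N = ?x [^] ?N \<otimes> ?y [^] ?N \<otimes> ?w [^] (?N * (?N - 1) div 2)"
    using c by (intro mult_pow_class_two yx wx wy) auto
  also have "?x [^] ?N = z" using c b j by (simp add: nat_pow_pow mult.commute)
  also have "?y [^] ?N = inv z"
  proof -
    have "y * ?N = q ^ (m - 1) * i"
    proof -
      have "q ^ (m - n) * ?N = q ^ (m - 1)" using nm j(3) by (simp add: power_add[symmetric])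
      then show ?thesis unfolding y_def by (metis mult.assoc mult.commute)
    qed
    then show ?thesis using c iz i by (simp add: nat_pow_pow)
  qed
  finally have "(?x \<otimes> ?y) [^] ?N = \<one>" using c w1 by simp
  then have "ord (?x \<otimes> ?y) dvd ?N" using c by (simp add: pow_eq_id)
  then have "ord (?x \<otimes> ?y) \<le> ?N" using q1 by (intro dvd_imp_le) auto
  also have "?N < q ^ n" using q1 j(3) by (intro power_strict_increasing) auto
  finally have lt: "ord (?x \<otimes> ?y) < ord b" using n by simp
  have "class_two_pair q a (?x \<otimes> ?y) (z [^] j)"
    unfolding class_two_pair_def
  proof (intro conjI)
    have ay: "a \<otimes> ?y = ?y \<otimes> a" using commute_pow[of a a y] c by simp
    have "z [^] j \<otimes> ?y = ?y \<otimes> z [^] j" using commute_pow[of "z [^] j" a y] zja c by simp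
    moreover have "z [^] j \<otimes> ?x = ?x \<otimes> z [^] j" using commute_pow[of "z [^] j" b j] zjb c by simp
    ultimately show "z [^] j \<otimes> (?x \<otimes> ?y) = ?x \<otimes> ?y \<otimes> z [^] j"
      using commute_mult[of "z [^] j" ?x ?y] c by simp
    have "a \<otimes> (?x \<otimes> ?y) = ?x \<otimes> a \<otimes> (z [^] j \<otimes> ?y)"
      using ab c by (simp add: m_assoc[symmetric])
    also have "\<dots> = ?x \<otimes> (a \<otimes> ?y) \<otimes> z [^] j"
      using \<open>z [^] j \<otimes> ?y = ?y \<otimes> z [^] j\<close> c by (simp add: m_assoc)
    also have "\<dots> = ?x \<otimes> ?y \<otimes> a \<otimes> z [^] j" unfolding ay using c by (simp add: m_assoc)
    finally show "a \<otimes> (?x \<otimes> ?y) = ?x \<otimes> ?y \<otimes> a \<otimes> z [^] j" .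
    have "ord z = q" by (rule ord_prime_eq[OF q(1) c(3,7,8)])
    then show "z [^] j \<noteq> \<one>" using c(3) j by (simp add: pow_eq_id)
    show "(z [^] j) [^] q = \<one>"
      using c by (simp add: nat_pow_pow mult.commute[of j]) (simp add: nat_pow_pow[symmetric])
  qed (use c zja in auto)
  then have "ord a + ord b \<le> ord a + ord (?x \<otimes> ?y)" using min by blast
  then show False using lt by linarith
qed

lemma class_two_pair_good:
  assumes q: "Factorial_Ring.prime q" "odd q" and ex: "class_two_pair q a0 b0 z0"
  shows "\<exists>a b z. class_two_pair q a b z \<and> (\<forall>t::nat. z \<noteq> b [^] t)"
proof (rule ccontr)
  assume "\<not> ?thesis"
  then have no: "\<exists>t::nat. z = b [^] t" if "class_two_pair q a b z" for a b z using that by blast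
  obtain p where p: "case p of (a, b) \<Rightarrow> \<exists>z. class_two_pair q a b z"
    and min: "\<And>p'. case p' of (a, b) \<Rightarrow> \<exists>z. class_two_pair q a b z \<Longrightarrow>
        (case p of (a, b) \<Rightarrow> ord a + ord b) \<le> (case p' of (a, b) \<Rightarrow> ord a + ord b)"
    using ex_has_least_nat[of "\<lambda>(a, b). \<exists>z. class_two_pair q a b z" "(a0, b0)" "\<lambda>(a, b). ord a + ord b"] ex
    by blast
  obtain a b where ab: "p = (a, b)" by (cases p)
  obtain z where z: "class_two_pair q a b z" using p ab by auto
  have min1: "\<forall>a' b' z'. class_two_pair q a' b' z' \<longrightarrow> ord a + ord b \<le> ord a' + ord b'"
  proof (intro allI impI)
    fix a' b' z' assume "class_two_pair q a' b' z'"
    then show "ord a + ord b \<le> ord a' + ord b'" using min[of "(a', b')"] ab by auto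
  qed
  then have min2: "\<forall>a' b' z'. class_two_pair q a' b' z' \<longrightarrow> ord b + ord a \<le> ord a' + ord b'"
    by (simp only: add.commute[of "ord b"])
  have c: "z \<in> carrier G" "a \<in> carrier G" "b \<in> carrier G" using z by (auto simp: class_two_pair_def)
  note z' = class_two_swap[OF z]
  obtain t where t: "z = b [^] (t::nat)" using no[OF z] by blast
  obtain s where s: "inv z = a [^] (s::nat)" using no[OF z'] by blast
  have za: "z = a [^] ((ord a - 1) * s)" using s c inv_pow_nat[of a s] by (metis inv_inv)
  have zb: "inv z = b [^] ((ord b - 1) * t)" using t c inv_pow_nat[of b t] by simp
  show False
  proof (cases "ord b \<le> ord a")
    case True
    then show False using class_two_pair_not_both[OF q z min1 za t] by blast
  next
    case False
    then show False using class_two_pair_not_both[OF q z' min2 zb s] by simp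
  qed
qed

lemma cyclic_subgroup:
  assumes "x \<in> carrier G" shows "subgroup (range (\<lambda>i::nat. x [^] i)) G"
proof -
  have "adjoin {\<one>} x = range (\<lambda>i::nat. x [^] i)" using assms by (auto simp: adjoin_def image_iff)
  then show ?thesis using adjoin_subgroup[OF triv_subgroup assms] assms by simp
qed

text \<open>By the last clause, the commutator of \<open>a\<close> and \<open>b\<close> lies outside the group generated by \<open>b^q\<close>, so that a
character of \<open>A\<close> can be trivial on that group and distinguish \<open>a\<close> from its conjugate.\<close>

definition inducing :: "'a set \<Rightarrow> 'a \<Rightarrow> nat \<Rightarrow> 'a \<Rightarrow> bool" where
  "inducing A b q a \<longleftrightarrow> subgroup A G \<and> commuting A \<and> b \<in> carrier G \<and> Factorial_Ring.prime q \<and>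
     q dvd ord b \<and> b [^] q \<in> A \<and> (\<forall>x\<in>A. conjugate (inv b) x \<in> A) \<and> a \<in> A \<and>
     (\<forall>i::nat. inv a \<otimes> conjugate (inv b) a \<noteq> (b [^] q) [^] i)"

text \<open>The subgroup is generated by \<open>a\<close>, \<open>z\<close> and \<open>b^q\<close>.\<close>

lemma inducing_of_class_two:
  assumes q: "Factorial_Ring.prime q" and p: "class_two_pair q a b z" and nz: "\<And>t::nat. z \<noteq> b [^] t"
  shows "\<exists>A. inducing A b q a"
proof -
  have c: "a \<in> carrier G" "b \<in> carrier G" "z \<in> carrier G" "a \<otimes> b = b \<otimes> a \<otimes> z"
    "z \<otimes> a = a \<otimes> z" "z \<otimes> b = b \<otimes> z" "z \<noteq> \<one>" "z [^] q = \<one>"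
    using p by (auto simp: class_two_pair_def)
  let ?B = "b [^] q"
  have aB: "a \<otimes> ?B = ?B \<otimes> a" using commutator_power_right[OF c(1-4,6), of q] c by simp
  have zB: "z \<otimes> ?B = ?B \<otimes> z" using commute_pow[of z b q] c by simp
  let ?K1 = "adjoin {\<one>} a"
  have k1: "\<And>k. k \<in> {\<one>} \<Longrightarrow> k \<otimes> a = a \<otimes> k" using c by simp
  have K1: "subgroup ?K1 G" "commuting ?K1" "a \<in> ?K1"
    using adjoin_subgroup[OF triv_subgroup c(1) k1] adjoin_contains(2)[OF triv_subgroup c(1) k1]
      adjoin_commuting[OF triv_subgroup c(1) k1] by (simp_all add: commuting_def)
  let ?K2 = "adjoin ?K1 z"
  have powa: "x \<otimes> a [^] i = a [^] i \<otimes> x" if "x \<in> carrier G" "x \<otimes> a = a \<otimes> x" for x and i :: nat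
    using commute_pow[of x a i] that c by simp
  have k2: "\<And>k. k \<in> ?K1 \<Longrightarrow> k \<otimes> z = z \<otimes> k"
    using powa[of z] c by (auto simp: adjoin_def)
  have K2: "subgroup ?K2 G" "commuting ?K2" "z \<in> ?K2" "a \<in> ?K2"
    using adjoin_subgroup[OF K1(1) c(3) k2] adjoin_contains[OF K1(1) c(3) k2]
      adjoin_commuting[OF K1(1) c(3) k2 K1(2)] K1(3) by auto
  let ?A = "adjoin ?K2 ?B"
  have Bc: "?B \<in> carrier G" using c by simp
  have k3: "k \<otimes> ?B = ?B \<otimes> k" if k: "k \<in> ?K2" for k
  proof -
    obtain k1 i where k': "k = k1 \<otimes> z [^] (i::nat)" "k1 \<in> ?K1" using k unfolding adjoin_def[of ?K1] by blast
    obtain l where l: "k1 = a [^] (l::nat)" using k'(2) c by (auto simp: adjoin_def)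
    have "?B \<otimes> a [^] l = a [^] l \<otimes> ?B" using powa[OF Bc] aB by simp
    moreover have "?B \<otimes> z [^] i = z [^] i \<otimes> ?B" using commute_pow[OF Bc c(3)] zB by simp
    ultimately show ?thesis using commute_mult[of ?B "a [^] l" "z [^] i"] c k' l by simp
  qed
  have A: "subgroup ?A G" "commuting ?A" "z \<in> ?A" "a \<in> ?A" "?B \<in> ?A" "?K2 \<subseteq> ?A"
    using adjoin_subgroup[OF K2(1) Bc k3] adjoin_contains[OF K2(1) Bc k3]
      adjoin_commuting[OF K2(1) Bc k3 K2(2)] K2(3,4) by auto
  have ca: "conjugate (inv b) a = a \<otimes> z"
    using c by (simp add: conjugate_def m_assoc cancel_inv)
  have cz: "conjugate (inv b) z = z" using c by (simp add: conjugate_def m_assoc cancel_inv)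
  have cB: "conjugate (inv b) ?B = ?B"
    using c commute_pow[of b b q] by (simp add: conjugate_def m_assoc) (metis cancel_inv(2) nat_pow_closed)
  have "conjugate (inv b) x \<in> ?A" if x: "x \<in> ?A" for x
  proof -
    have f: "conjugate (inv b) y = inv b \<otimes> y \<otimes> b" for y using c by (simp add: conjugate_def)
    have c0: "inv b \<otimes> k \<otimes> b \<in> ?A" if "k \<in> {\<one>}" for k
      using that c subgroup.one_closed[OF A(1)] by simp
    have c1: "inv b \<otimes> a \<otimes> b \<in> ?A"
      unfolding f[symmetric] ca by (rule subgroup.m_closed[OF A(1) A(4) A(3)])
    have c2: "inv b \<otimes> z \<otimes> b \<in> ?A" unfolding f[symmetric] cz by (rule A(3))
    have c3: "inv b \<otimes> ?B \<otimes> b \<in> ?A" unfolding f[symmetric] cB by (rule A(5))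
    have s1: "inv b \<otimes> y \<otimes> b \<in> ?A" if "y \<in> ?K1" for y
      by (rule conj_adjoin_closed[OF triv_subgroup A(1) c(1,2) c0 c1 that])
    have s2: "inv b \<otimes> y \<otimes> b \<in> ?A" if "y \<in> ?K2" for y
      by (rule conj_adjoin_closed[OF K1(1) A(1) c(3,2) s1 c2 that])
    have "inv b \<otimes> x \<otimes> b \<in> ?A"
      by (rule conj_adjoin_closed[OF K2(1) A(1) Bc c(2) s2 c3 x])
    then show ?thesis using f by simp
  qed
  moreover have "inv a \<otimes> conjugate (inv b) a = z" unfolding ca using c by (simp add: cancel_inv)
  moreover have "z \<noteq> ?B [^] i" for i :: nat using nz[of "q * i"] c by (simp add: nat_pow_pow)
  moreover have "q dvd ord b"
  proof -
    have "a \<otimes> b [^] ord b = b [^] ord b \<otimes> a \<otimes> z [^] ord b" by (rule commutator_power_right[OF c(1-4,6)])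
    then have "z [^] ord b = \<one>" using c by (simp add: pow_ord_eq_1)
    then show ?thesis using c ord_prime_eq[OF q c(3,7,8)] by (simp add: pow_eq_id)
  qed
  ultimately show ?thesis using A q c unfolding inducing_def by metis
qed

text \<open>Let \<open>b\<close> have least order among the elements that normalize \<open>A\<close> without centralizing it, and let \<open>q\<close> be a prime
divisor of its order. Then \<open>b^q\<close> centralizes \<open>A\<close>, and \<open>A\<close> together with \<open>b^q\<close> serves the purpose unless
all commutators of \<open>b\<close> with elements of \<open>A\<close> are powers of \<open>b^q\<close>. In that case these commutators are
central in the group generated by \<open>A\<close> and \<open>b\<close>, and a pair of class two takes over.\<close>

lemma inducing_exists:
  assumes odd: "odd (order G)" and nonab: "\<not> commuting (carrier G)"
  shows "\<exists>A b q a. inducing A b q a"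
proof -
  obtain A g where A: "subgroup A G" "commuting A" and g: "normalizes g A" "\<exists>a\<in>A. a \<otimes> g \<noteq> g \<otimes> a"
    using abelian_subgroup_noncentral_normalizer[OF nonab] by blast
  have As: "x \<in> carrier G" if "x \<in> A" for x using that A(1) subgroup_elem by blast
  define P where "P = (\<lambda>b. normalizes b A \<and> (\<exists>a\<in>A. a \<otimes> b \<noteq> b \<otimes> a))"
  obtain b where Pb: "P b" and bmin: "\<And>b'. P b' \<Longrightarrow> ord b \<le> ord b'"
    using ex_has_least_nat[of P g ord] g by (auto simp: P_def)
  have bc: "b \<in> carrier G" and bn: "\<And>a. a \<in> A \<Longrightarrow> conjugate (inv b) a \<in> A"
    using Pb by (auto simp: P_def normalizes_def)
  obtain a where a: "a \<in> A" "a \<otimes> b \<noteq> b \<otimes> a" using Pb by (auto simp: P_def)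
  have ac: "a \<in> carrier G" using As a by blast
  have "b \<noteq> \<one>" using a ac by auto
  then have "ord b \<noteq> 1" using ord_eq_1[OF bc] by blast
  then obtain q where q: "Factorial_Ring.prime q" "q dvd ord b" using prime_factor_nat by blast
  have "q dvd order G" using q(2) ord_dvd_group_order[OF bc] dvd_trans by blast
  then have qodd: "odd q" using odd dvd_trans by blast
  let ?B = "b [^] q"
  have Bc: "?B \<in> carrier G" using bc by simp
  have BA: "x \<otimes> ?B = ?B \<otimes> x" if "x \<in> A" for x
  proof (rule ccontr)
    assume "x \<otimes> ?B \<noteq> ?B \<otimes> x"
    moreover have "normalizes ?B A"
      using conjugate_inv_nat_pow[OF bc _ bn, of _ q] As Bc by (auto simp: normalizes_def)
    ultimately have "ord b \<le> ord ?B" using bmin that by (auto simp: P_def)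
    moreover have "ord ?B = ord b div q" using q bc by (intro ord_pow) (auto simp: prime_gt_0_nat)
    moreover have "ord b div q < ord b" using ord_pos[OF bc] prime_gt_1_nat[OF q(1)] by simp
    ultimately show False by simp
  qed
  let ?z = "inv a \<otimes> conjugate (inv b) a"
  show ?thesis
  proof (cases "\<exists>i::nat. ?z = ?B [^] i")
    case False
    let ?A = "adjoin A ?B"
    have A': "subgroup ?A G" "commuting ?A" "A \<subseteq> ?A" "?B \<in> ?A"
      using adjoin_subgroup[OF A(1) Bc BA] adjoin_contains[OF A(1) Bc BA]
        adjoin_commuting[OF A(1) Bc BA A(2)] by auto
    have f: "conjugate (inv b) y = inv b \<otimes> y \<otimes> b" for y using bc by (simp add: conjugate_def)
    have cB: "conjugate (inv b) ?B = ?B"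
      using bc commute_pow[of b b q] by (simp add: conjugate_def m_assoc) (metis cancel_inv(2) nat_pow_closed)
    have c0: "inv b \<otimes> k \<otimes> b \<in> ?A" if "k \<in> A" for k
      using bn[OF that] A'(3) unfolding f by blast
    have c1: "inv b \<otimes> ?B \<otimes> b \<in> ?A" unfolding f[symmetric] cB by (rule A'(4))
    have "inv b \<otimes> x \<otimes> b \<in> ?A" if "x \<in> ?A" for x
      by (rule conj_adjoin_closed[OF A(1) A'(1) Bc bc c0 c1 that])
    then have "inducing ?A b q a" using A' q bc a False f by (auto simp: inducing_def)
    then show ?thesis by blast
  next
    case True
    then obtain i where i: "?z = ?B [^] (i::nat)" by blast
    have cac: "conjugate (inv b) a \<in> carrier G" using ac bc by simp
    have zc: "?z \<in> carrier G" using i Bc by simp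
    have za: "?z \<otimes> a = a \<otimes> ?z" unfolding i using commute_pow[OF ac Bc BA[OF a(1)], of i] by simp
    have zb: "?z \<otimes> b = b \<otimes> ?z"
    proof -
      have "b \<otimes> b [^] (q * i) = b [^] (q * i) \<otimes> b" using commute_pow[of b b "q * i"] bc by simp
      then show ?thesis unfolding i using bc by (simp add: nat_pow_pow)
    qed
    have abz: "a \<otimes> b = b \<otimes> a \<otimes> ?z"
      using ac bc by (simp add: conjugate_def m_assoc cancel_inv)
    have "?z \<noteq> \<one>" using a abz ac bc by auto
    moreover have "?z [^] q = \<one>"
    proof -
      have "a \<otimes> ?B = ?B \<otimes> a \<otimes> ?z [^] q" by (rule commutator_power_right[OF ac bc zc abz zb])
      then have "?B \<otimes> a = ?B \<otimes> a \<otimes> ?z [^] q" using BA[OF a(1)] by simp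
      then show ?thesis using ac Bc zc by (metis l_cancel_one' m_closed nat_pow_closed)
    qed
    ultimately have "class_two_pair q a b ?z"
      unfolding class_two_pair_def using ac bc zc za zb abz by blast
    then show ?thesis using class_two_pair_good[OF q(1) qodd] inducing_of_class_two[OF q(1)] by metis
  qed
qed

end

section \<open>The free pair\<close>

text \<open>If all \<open>\<psi> i\<close> have the same rate, they are equal up to complex conjugation. If moreover no two consecutive values
were equal, they would alternate between two conjugate values, which the odd period forbids. So one
of the ratios is 1; the ratio at 0 is not, and 1 is the only value of rate 1.\<close>

lemma nonconstant_bass_rate:
  fixes \<psi> :: "int \<Rightarrow> complex"
  assumes q: "odd q" and d: "coprime d 6" and root: "\<And>i. \<psi> i ^ d = 1"
    and per: "\<And>i. \<psi> (i + int q) = \<psi> i" and ne: "\<psi> 0 \<noteq> \<psi> 1"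
  shows "(\<exists>i j. bass_rate (\<psi> i) \<noteq> bass_rate (\<psi> j)) \<or>
    (\<exists>i j. bass_rate (\<psi> (i + 1) / \<psi> i) \<noteq> bass_rate (\<psi> (j + 1) / \<psi> j))"
proof (rule ccontr)
  assume neg: "\<not> ?thesis"
  have const: "bass_rate (\<psi> i) = bass_rate (\<psi> j)" for i j using neg by blast
  have const': "bass_rate (\<psi> (i + 1) / \<psi> i) = bass_rate (\<psi> (j + 1) / \<psi> j)" for i j using neg by blast
  have not1: "\<psi> i \<noteq> 1" for i
  proof
    assume "\<psi> i = 1"
    then have "bass_rate (\<psi> j) = 1" for j using const[of j i] by (simp add: bass_rate_def)
    then have "\<psi> j = 1" for j using bass_rate_eq_1_iff[OF root d] by blast
    then show False using ne by simp
  qed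
  have nz: "\<psi> i \<noteq> 0" for i using root_norm[OF root d, of i] by auto
  have re: "Re (\<psi> i) = Re (\<psi> j)" for i j
    using const[of i j] not1 by (simp add: bass_rate_def)
  have im: "Im (\<psi> i) ^ 2 = Im (\<psi> j) ^ 2" for i j
  proof -
    have "Re (\<psi> l) ^ 2 + Im (\<psi> l) ^ 2 = 1" for l using root_norm[OF root d, of l] by (simp add: cmod_def)
    then show ?thesis using re[of i j] by (metis add_left_cancel)
  qed
  have two: "\<psi> i = \<psi> j \<or> \<psi> i = cnj (\<psi> j)" for i j
    using im[of i j] re[of i j] by (auto simp: power2_eq_iff complex_eq_iff)
  have ratio: "\<psi> (i + 1) / \<psi> i \<noteq> 1" for i
  proof
    assume "\<psi> (i + 1) / \<psi> i = 1"
    then have "bass_rate (\<psi> (0 + 1) / \<psi> 0) = 1" using const'[of i 0] by (simp add: bass_rate_def)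
    moreover have "(\<psi> (0 + 1) / \<psi> 0) ^ d = 1" by (simp only: power_divide root) simp
    ultimately have "\<psi> (0 + 1) / \<psi> 0 = 1" using bass_rate_eq_1_iff[of "\<psi> (0 + 1) / \<psi> 0" d] d by blast
    then show False using ne nz[of 0] by simp
  qed
  have flip: "\<psi> (i + 1) = cnj (\<psi> i)" for i
    using two[of "i + 1" i] ratio[of i] nz[of i] by auto
  have per2: "\<psi> (1 + 2 * int n) = \<psi> 1" for n
  proof (induction n)
    case (Suc n)
    have "\<psi> (1 + 2 * int (Suc n)) = \<psi> (1 + 2 * int n + 1 + 1)" by (simp add: algebra_simps)
    also have "\<dots> = \<psi> (1 + 2 * int n)" by (simp only: flip complex_cnj_cnj)
    finally show ?case using Suc by simp
  qed simp
  obtain n where n: "q = 2 * n + 1" using q by (elim oddE)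
  have "\<psi> 1 = \<psi> (0 + int q)" using per2[of n] n by (simp add: add.commute)
  then show False using per[of 0] ne by simp
qed

context induced_rep
begin

lemma bq_int: "b [^] (i + int q) = b [^] i \<otimes> b [^] q"
  using b by (simp add: int_pow_mult int_pow_int)

lemma conj_chi_mult:
  assumes "x \<in> A" "y \<in> A"
  shows "conj_chi (x \<otimes> y) i = conj_chi x i * conj_chi y i"
proof -
  let ?c = "\<lambda>x. inv (b [^] i) \<otimes> x \<otimes> b [^] i"
  have "?c (x \<otimes> y) = ?c x \<otimes> ?c y" using assms A_sub by (simp add: m_assoc cancel_inv)
  then show ?thesis using chi_mult[OF normal normal] assms by (simp add: conj_chi_def)
qed

lemma conj_chi_inv:
  assumes "x \<in> A" shows "conj_chi (inv x) i * conj_chi x i = 1"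
  using conj_chi_mult[of "inv x" x i] subgroup.m_inv_closed[OF A assms] assms A_sub[OF assms]
  by (simp add: conj_chi_def chi_one)

lemma conj_chi_conjugate:
  assumes "x \<in> A" shows "conj_chi (conjugate (inv b) x) i = conj_chi x (i + 1)"
proof -
  have "b [^] (1 + i) = b \<otimes> b [^] i" using b int_pow_mult[of b 1 i] by (simp add: int_pow_1)
  then show ?thesis
    using assms A_sub b by (simp add: conj_chi_def conjugate_def m_assoc inv_mult_group add.commute)
qed

lemma conj_chi_period1:
  assumes "commuting A" "x \<in> A"
  shows "conj_chi x (i + int q) = conj_chi x i"
proof -
  let ?x = "inv (b [^] i) \<otimes> x \<otimes> b [^] i" and ?B = "b [^] q"
  have x: "?x \<in> A" by (rule normal[OF assms(2)])
  have "inv (b [^] (i + int q)) \<otimes> x \<otimes> b [^] (i + int q) = inv ?B \<otimes> (?x \<otimes> ?B)"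
    unfolding bq_int using assms A_sub b by (simp add: inv_mult_group m_assoc)
  also have "?x \<otimes> ?B = ?B \<otimes> ?x" using x bq assms(1) by (simp add: commuting_def)
  also have "inv ?B \<otimes> (?B \<otimes> ?x) = ?x" using b A_sub[OF x] by (intro cancel_inv) auto
  finally show ?thesis by (simp add: conj_chi_def)
qed

text \<open>Either \<open>a\<close> itself or its commutator with \<open>b\<close> will do.\<close>

lemma exists_nonconstant_rate:
  assumes cA: "commuting A" and q: "odd q" and co: "coprime (order G) 6"
    and a: "a \<in> A" and ne: "conj_chi a 0 \<noteq> conj_chi a 1"
  shows "\<exists>g\<in>A. \<exists>i j. bass_rate (conj_chi g i) \<noteq> bass_rate (conj_chi g j)"
proof -
  have bA: "conjugate (inv b) a \<in> A"
    using normal[OF a, of 1] b by (simp add: conjugate_def int_pow_1)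
  let ?g = "conjugate (inv b) a \<otimes> inv a"
  have g: "?g \<in> A" using bA a subgroup.m_closed[OF A] subgroup.m_inv_closed[OF A] by blast
  have q': "conj_chi ?g i = conj_chi a (i + 1) / conj_chi a i" for i
  proof -
    have nz: "conj_chi a i \<noteq> 0" using conj_chi_inv[OF a, of i] by auto
    have "conj_chi ?g i = conj_chi a (i + 1) * conj_chi (inv a) i"
      using conj_chi_mult[OF bA subgroup.m_inv_closed[OF A a]] conj_chi_conjugate[OF a] by simp
    then show ?thesis using conj_chi_inv[OF a, of i] nz by (simp add: field_simps)
  qed
  have "coprime (ord a) 6"
    using co ord_dvd_group_order[OF A_sub[OF a]] coprime_divisors dvd_refl by blast
  then have "(\<exists>i j. bass_rate (conj_chi a i) \<noteq> bass_rate (conj_chi a j)) \<or>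
    (\<exists>i j. bass_rate (conj_chi a (i + 1) / conj_chi a i) \<noteq> bass_rate (conj_chi a (j + 1) / conj_chi a j))"
    using nonconstant_bass_rate[of q "ord a" "conj_chi a", OF q _ conj_chi_root[OF a] conj_chi_period1[OF cA a] ne]
    by blast
  then show ?thesis using a g q' by metis
qed

text \<open>Here \<open>\<mu> True\<close> and \<open>\<mu> False\<close> are the rates and their inverses, and the indices where they attain their maxima \<open>L\<close> are
the extremal ones, so that \<open>dominant_powers\<close> applies to both signs of the exponent.\<close>

lemma free_pair_from_rates:
  assumes cA: "commuting A" and qp: "Factorial_Ring.prime q" "odd q" and qb: "q dvd ord b"
    and co: "coprime (order G) 6" and bA: "b \<notin> A"
    and g: "g \<in> A" and nc: "bass_rate (conj_chi g i0) \<noteq> bass_rate (conj_chi g j0)"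
  shows "\<exists>\<beta>\<in>bicyclic_units G. \<exists>u\<in>bass_cyclic_units G.
    eventually (\<lambda>t::nat. free_pair (units_of ZG) u (\<beta> [^]\<^bsub>units_of ZG\<^esub> t)) sequentially"
proof -
  let ?d = "ord g"
  have gc: "g \<in> carrier G" using g A_sub by blast
  have d6: "coprime ?d 6" using co ord_dvd_group_order[OF gc] coprime_divisors dvd_refl by blast
  have dodd: "odd ?d"
  proof
    assume "even ?d"
    then have "is_unit (2::nat)" using d6 by (intro coprime_common_divisor[of ?d 6]) auto
    then show False by simp
  qed
  have d0: "0 < ?d" using ord_pos[OF gc] .
  define \<psi> where "\<psi> = conj_chi g"
  have root: "\<psi> i ^ ?d = 1" for i by (simp add: \<psi>_def conj_chi_root[OF g])
  have per: "\<psi> i = \<psi> j" if "i mod int q = j mod int q" for i j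
    unfolding \<psi>_def by (rule period_mod[of "conj_chi g", OF conj_chi_period1[OF cA g] that])
  define I where "I = {0..<int q}"
  have I: "finite I" "I \<noteq> {}" using q by (auto simp: I_def)
  define s where "s i = bass_rate (\<psi> i)" for i
  have s0: "0 < s i" for i unfolding s_def by (rule bass_rate_pos[OF root d6])
  have nc': "bass_rate (\<psi> i0) \<noteq> bass_rate (\<psi> j0)" using nc by (simp add: \<psi>_def)
  obtain k where k: "\<not> int q dvd k"
    and ext: "\<And>e. (\<Sum>i\<in>extremal e s I. \<psi> i - \<psi> (i - k)) \<noteq> 0"
    using extremal_shift_sums[of q ?d \<psi> i0 j0, OF qp d6 root per nc'] unfolding I_def s_def by blast
  define v where "v i = \<psi> i - \<psi> (i - k)" for i
  define \<mu> where "\<mu> e i = (if e then s i else 1 / s i)" for e i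
  define L where "L e = Max (\<mu> e ` I)" for e
  have \<mu>0: "0 < \<mu> e i" for e i using s0 by (simp add: \<mu>_def)
  have \<mu>L: "\<mu> e i \<le> L e" if "i \<in> I" for e i unfolding L_def using I that by (intro Max_ge) auto
  have Lex: "\<exists>i\<in>I. \<mu> e i = L e" for e
  proof -
    have "L e \<in> \<mu> e ` I" unfolding L_def using I by (intro Max_in) auto
    then show ?thesis by auto
  qed
  have L0: "0 < L e" for e using Lex[of e] \<mu>0 by metis
  have exteq: "{i \<in> I. \<mu> e i = L e} = extremal e s I" for e
  proof -
    have "\<mu> e i = L e \<longleftrightarrow> (\<forall>j\<in>I. \<mu> e j \<le> \<mu> e i)" if "i \<in> I" for i
      using \<mu>L Lex[of e] that by (metis antisym)
    moreover have "\<mu> e j \<le> \<mu> e i \<longleftrightarrow> (if e then s j \<le> s i else s i \<le> s j)" for i j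
      using s0[of i] s0[of j] by (auto simp: \<mu>_def field_simps)
    ultimately show ?thesis by (auto simp: extremal_def)
  qed
  have "\<exists>c>0. \<exists>N. \<forall>n\<ge>N. c * L e ^ n \<le> cmod (\<Sum>i\<in>I. of_real (\<mu> e i ^ n) * v i)" for e
    using dominant_powers[of I "L e" "\<mu> e" v, OF I(1) L0 \<mu>0 \<mu>L] ext[of e] unfolding exteq v_def by blast
  then obtain c' N' where c': "\<And>e. 0 < c' e"
    and N': "\<And>e n. n \<ge> N' e \<Longrightarrow> c' e * L e ^ n \<le> cmod (\<Sum>i\<in>I. of_real (\<mu> e i ^ n) * v i)"
    by metis
  define c where "c = min (c' True) (c' False)"
  define N where "N = max (N' True) (N' False)"
  have c0: "0 < c" using c' by (simp add: c_def)
  have cle: "c \<le> c' e" and Nge: "N' e \<le> N" for e by (cases e; simp add: c_def N_def)+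
  have dom: "c * L e ^ n \<le> cmod (coord_sum I (\<lambda>i. of_real (\<mu> e i ^ n) * v i))" if "N \<le> n" for e n
  proof -
    have "c * L e ^ n \<le> c' e * L e ^ n" using cle L0[of e] by (simp add: mult_right_mono)
    also have "\<dots> \<le> cmod (coord_sum I (\<lambda>i. of_real (\<mu> e i ^ n) * v i))"
      unfolding coord_sum_def using N' Nge that le_trans by blast
    finally show ?thesis .
  qed
  have cv: "c \<le> l1norm I v"
  proof -
    have "c * L True ^ N \<le> l1norm I (\<lambda>i. of_real (\<mu> True i ^ N) * v i)"
      using dom[OF order_refl, of True] coord_sum_le_l1norm order_trans by blast
    also have "\<dots> \<le> L True ^ N * l1norm I v"
    proof (rule l1norm_scale_le)
      show "0 \<le> \<mu> True i ^ N" for i using \<mu>0[of True i] by simp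
      show "\<mu> True i ^ N \<le> L True ^ N" if "i \<in> I" for i
        by (rule power_mono[OF \<mu>L[OF that] less_imp_le[OF \<mu>0]])
    qed
    finally show ?thesis using L0[of True] by (simp add: mult.commute)
  qed
  \<comment> \<open>The factor \<open>ord g\<close> makes the eigenvalues positive reals, \<open>totient (ord g)\<close> belongs to the definition
     of the Bass cyclic units, and \<open>N + 1\<close> makes the asymptotic bound valid from the first power on.\<close>
  define W where "W = ?d * totient ?d * (N + 1)"
  have t0: "0 < totient ?d" using d0 by simp
  have W: "?d dvd W" "totient ?d dvd W" "N \<le> W * n" "0 < W" if "0 < n" for n
  proof -
    have "1 * (N + 1) * 1 \<le> W * n" unfolding W_def using d0 t0 that
      by (intro mult_mono) (auto simp: Suc_le_eq)
    then show "N \<le> W * n" by simp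
  qed (use d0 t0 in \<open>auto simp: W_def\<close>)
  define u where "u = bass_unit G 2 (2 * W) g"
  have uU: "u \<in> Units ZG" unfolding u_def
    using W(2)[of 1] by (intro bass_unit_in_Units gc dodd) auto
  have u_bass: "u \<in> bass_cyclic_units G"
    unfolding bass_cyclic_units_def mem_Collect_eq
    by (rule exI[of _ 2], rule exI[of _ "2 * W"], rule exI[of _ g])
      (use gc d0 dodd W(2,4)[of 1] in \<open>auto simp: u_def\<close>)
  let ?h = "b [^] k"
  define \<beta> where "\<beta> = \<one>\<^bsub>ZG\<^esub> \<oplus>\<^bsub>ZG\<^esub> bicyclic_nilpotent ?h g"
  have \<beta>U: "\<beta> \<in> Units ZG" unfolding \<beta>_def by (rule bicyclic_in_Units[OF bi gc])
  have \<beta>_bic: "\<beta> \<in> bicyclic_units G"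
    unfolding bicyclic_units_def \<beta>_def bicyclic_nilpotent_def using gc ord_pos[OF bi, of k] bi by blast
  have qh: "q dvd ord ?h"
  proof -
    have "b [^] (k * int (ord ?h)) = \<one>"
      using pow_ord_eq_1[OF bi[of k]] b by (simp add: int_pow_pow[symmetric] int_pow_int)
    then have "int (ord b) dvd k * int (ord ?h)" using b by (simp add: int_pow_eq_id)
    then have "int q dvd k * int (ord ?h)" using qb by (meson dvd_trans of_nat_dvd_iff)
    then show ?thesis using k qp(1) prime_dvd_mult_iff[of "int q"] by auto
  qed
  define \<kappa> where "\<kappa> = ord ?h div q"
  have \<kappa>: "1 \<le> \<kappa>" using qh ord_pos[OF bi, of k] q by (auto simp: \<kappa>_def elim!: dvdE)
  \<comment> \<open>The sum of the \<open>b^l\<close> with \<open>l < q\<close> has all coordinates equal to 1.\<close>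
  define \<alpha>0 where "\<alpha>0 = (\<lambda>x. \<Sum>l<q. gr_embed (b [^] l) x)"
  have \<alpha>0: "\<alpha>0 \<in> carrier ZG" using gr_geom_closed[OF b, of q] by (simp add: \<alpha>0_def gr_geom_eq[OF b])
  define vec where "vec \<alpha> = coord (\<alpha> \<otimes>\<^bsub>ZG\<^esub> \<alpha>0)" for \<alpha>
  have nA: "b [^] i \<notin> A" if i: "0 < i" "i < q" for i :: nat
  proof
    assume iA: "b [^] i \<in> A"
    have "\<not> q dvd i" using i by (simp add: nat_dvd_not_less)
    then have "gcd i q = 1" using qp(1) by (metis coprime_iff_gcd_eq_1 coprime_commute prime_imp_coprime_nat)
    moreover have "\<exists>x y. i * x = q * y + gcd i q" using i by (intro bezout_nat) auto
    ultimately obtain x y where xy: "i * x = q * y + 1" by auto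
    have "(b [^] i) [^] x = (b [^] q) [^] y \<otimes> b"
      using b xy by (simp add: nat_pow_pow)
    then have "b = inv ((b [^] q) [^] y) \<otimes> (b [^] i) [^] x" using b by (simp add: cancel_inv)
    moreover have "inv ((b [^] q) [^] y) \<otimes> (b [^] i) [^] x \<in> A"
      using subgroup.m_closed[OF A] subgroup.m_inv_closed[OF A] power_in_A[OF iA] power_in_A[OF bq] by blast
    ultimately show False using bA by simp
  qed
  have vec_u: "vec (u \<otimes>\<^bsub>ZG\<^esub> \<alpha>) i = of_real (s i ^ W) * vec \<alpha> i" if "\<alpha> \<in> carrier ZG" for \<alpha> i
  proof -
    have "vec (u \<otimes>\<^bsub>ZG\<^esub> \<alpha>) i = (if \<psi> i = 1 then 1 else (1 + \<psi> i) ^ (2 * W)) * vec \<alpha> i"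
      unfolding vec_def \<psi>_def u_def using coord_bass_unit[of "\<alpha> \<otimes>\<^bsub>ZG\<^esub> \<alpha>0" g "2 * W" i] that \<alpha>0 g dodd W(2)[of 1]
        Units_closed uU[unfolded u_def] by (simp add: R.m_assoc R.Units_closed)
    also have "(if \<psi> i = 1 then 1 else (1 + \<psi> i) ^ (2 * W)) = of_real (s i ^ W)"
      using bass_rate_power[OF root d6, of i W] W(1)[of 1] by (simp add: s_def) (simp add: bass_rate_def)
    finally show ?thesis .
  qed
  have vec_\<beta>: "vec (\<beta> \<otimes>\<^bsub>ZG\<^esub> \<alpha>) i = vec \<alpha> i + of_nat \<kappa> * coord_sum I (vec \<alpha>) * v i"
    if "\<alpha> \<in> carrier ZG" for \<alpha> i
    unfolding vec_def coord_sum_def v_def \<psi>_def \<kappa>_def I_def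
    using coord_bicyclic[OF qp(1) k qh, of "\<alpha> \<otimes>\<^bsub>ZG\<^esub> \<alpha>0" g i] that \<alpha>0 g R.Units_closed[OF \<beta>U]
    by (simp add: \<beta>_def R.m_assoc)
  have v_sum: "coord_sum I v = 0"
    unfolding coord_sum_def v_def I_def sum_subtractf using sum_period_shift[of q \<psi> k, OF q per] by simp
  let ?U = "units_of ZG"
  have grU: "group ?U" by (rule R.units_group)
  have Uc: "carrier ?U = Units ZG" "\<one>\<^bsub>?U\<^esub> = \<one>\<^bsub>ZG\<^esub>" "\<And>x y. x \<otimes>\<^bsub>?U\<^esub> y = x \<otimes>\<^bsub>ZG\<^esub> y"
    by (simp_all add: units_of_def)
  have vec_\<beta>t: "vec (\<beta> [^]\<^bsub>?U\<^esub> t \<otimes>\<^bsub>ZG\<^esub> \<alpha>) i = vec \<alpha> i + of_real (real (t * \<kappa>)) * coord_sum I (vec \<alpha>) * v i"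
    if "\<alpha> \<in> carrier ZG" for \<alpha> i and t :: nat
    using that
  proof (induction t arbitrary: \<alpha> i)
    case 0
    then show ?case by (simp add: Uc)
  next
    case (Suc t)
    have \<beta>t: "\<beta> [^]\<^bsub>?U\<^esub> t \<in> carrier ZG"
      using monoid.nat_pow_closed[OF group.is_monoid[OF grU]] \<beta>U R.Units_closed by (metis Uc(1))
    have \<beta>c: "\<beta> \<in> carrier ZG" using \<beta>U R.Units_closed by blast
    have "\<beta> [^]\<^bsub>?U\<^esub> Suc t \<otimes>\<^bsub>ZG\<^esub> \<alpha> = \<beta> [^]\<^bsub>?U\<^esub> t \<otimes>\<^bsub>ZG\<^esub> (\<beta> \<otimes>\<^bsub>ZG\<^esub> \<alpha>)"
      using \<beta>t \<beta>c Suc.prems by (simp add: Uc R.m_assoc)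
    moreover have "coord_sum I (vec (\<beta> \<otimes>\<^bsub>ZG\<^esub> \<alpha>)) = coord_sum I (vec \<alpha>)"
      using coord_sum_shear[of I "vec (\<beta> \<otimes>\<^bsub>ZG\<^esub> \<alpha>)" "vec \<alpha>" "of_nat \<kappa> * coord_sum I (vec \<alpha>)" v]
        vec_\<beta>[OF Suc.prems] v_sum by simp
    ultimately show ?case
      using Suc.IH[of "\<beta> \<otimes>\<^bsub>ZG\<^esub> \<alpha>" i] vec_\<beta>[OF Suc.prems, of i] \<beta>c Suc.prems
      by (simp add: algebra_simps)
  qed
  let ?b1 = "2 * (1 + 2 * l1norm I v / c) / c" and ?b2 = "2 * (2 * l1norm I v / c) / l1norm I v"
  obtain n0 :: nat where n0: "max ?b1 ?b2 < real n0" using reals_Archimedean2 by blast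
  have "free_pair ?U u (\<beta> [^]\<^bsub>?U\<^esub> t)" if t: "n0 \<le> t" for t
  proof -
    let ?B = "\<beta> [^]\<^bsub>?U\<^esub> t" and ?T = "real (t * \<kappa>)"
    have BU: "?B \<in> Units ZG"
      using monoid.nat_pow_closed[OF group.is_monoid[OF grU]] \<beta>U by (metis Uc(1))
    have inv_act: "x \<otimes>\<^bsub>?U\<^esub> (inv\<^bsub>?U\<^esub> x \<otimes>\<^bsub>?U\<^esub> a) = a \<and> inv\<^bsub>?U\<^esub> x \<otimes>\<^bsub>?U\<^esub> a \<in> carrier ?U"
      if "x \<in> carrier ?U" "a \<in> carrier ?U" for x a
      using that group.r_inv[OF grU] group.inv_closed[OF grU] monoid.m_closed[OF group.is_monoid[OF grU]]
        monoid.l_one[OF group.is_monoid[OF grU]]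
      by (simp add: monoid.m_assoc[OF group.is_monoid[OF grU], symmetric])
    have "shear_ping_pong ?U u ?B vec I (\<lambda>e i. \<mu> e i ^ W) (\<lambda>e. L e ^ W) v c ?T"
    proof (intro shear_ping_pong.intro shear_ping_pong_axioms.intro grU I)
      show "u \<in> carrier ?U" "?B \<in> carrier ?U" using uU BU by (simp_all add: Uc)
      show "vec \<one>\<^bsub>?U\<^esub> i = 1" if "i \<in> I" for i
        unfolding vec_def using coord_one[OF nA, of i] \<alpha>0 by (simp add: Uc \<alpha>0_def)
      show "coord_sum I v = 0" by (rule v_sum)
      show "vec ((if e then u else inv\<^bsub>?U\<^esub> u) \<otimes>\<^bsub>?U\<^esub> a) i = of_real (\<mu> e i ^ W) * vec a i"
        if a: "a \<in> carrier ?U" and "i \<in> I" for a e i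
      proof (cases e)
        case True
        then show ?thesis using vec_u[of a i] a R.Units_closed by (simp add: Uc \<mu>_def)
      next
        case False
        let ?a = "inv\<^bsub>?U\<^esub> u \<otimes>\<^bsub>?U\<^esub> a"
        have "u \<otimes>\<^bsub>?U\<^esub> ?a = a" "?a \<in> carrier ?U" using inv_act[of u a] a uU by (simp_all add: Uc(1))
        then have "vec a i = of_real (s i ^ W) * vec ?a i"
          using vec_u[of ?a i] R.Units_closed by (simp add: Uc)
        then have "vec ?a i = of_real ((1 / s i) ^ W) * vec a i"
          using s0[of i] by (simp add: power_divide field_simps)
        then show ?thesis using False by (simp add: \<mu>_def)
      qed
      show "vec ((if e then ?B else inv\<^bsub>?U\<^esub> ?B) \<otimes>\<^bsub>?U\<^esub> a) i =
          vec a i + of_real (if e then ?T else - ?T) * coord_sum I (vec a) * v i"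
        if a: "a \<in> carrier ?U" and "i \<in> I" for a e i
      proof (cases e)
        case True
        then show ?thesis using vec_\<beta>t[of a t i] a R.Units_closed by (simp add: Uc)
      next
        case False
        let ?a = "inv\<^bsub>?U\<^esub> ?B \<otimes>\<^bsub>?U\<^esub> a"
        have e: "?B \<otimes>\<^bsub>?U\<^esub> ?a = a" "?a \<in> carrier ?U" using inv_act[of ?B a] a BU by (simp_all add: Uc(1))
        have vj: "vec a j = vec ?a j + of_real ?T * coord_sum I (vec ?a) * v j" for j
          using vec_\<beta>t[of ?a t j] R.Units_closed e by (simp add: Uc)
        have "coord_sum I (vec a) = coord_sum I (vec ?a)"
          using coord_sum_shear[of I "vec a" "vec ?a" "of_real ?T * coord_sum I (vec ?a)" v] vj v_sum by simp
        then show ?thesis using False vj[of i] by simp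
      qed
      show "0 < \<mu> e i ^ W" for e i using \<mu>0 by simp
      show "\<mu> e i ^ W \<le> L e ^ W" if "i \<in> I" for e i
        by (rule power_mono[OF \<mu>L[OF that] less_imp_le[OF \<mu>0]])
      show "\<mu> True i ^ W * \<mu> False i ^ W = 1" for i
        using s0[of i] by (simp add: \<mu>_def power_mult_distrib[symmetric])
      show "0 < c" by (rule c0)
      have "0 \<le> l1norm I v" by simp
      then show "c \<le> 2 * l1norm I v" using cv by linarith
      show "c * (L e ^ W) ^ n \<le> cmod (coord_sum I (\<lambda>i. of_real ((\<mu> e i ^ W) ^ n) * v i))"
        if "0 < n" for e n
        unfolding power_mult[symmetric] by (rule dom[OF W(3)[OF that]])
      have "real n0 * 1 \<le> real t * real \<kappa>" using t \<kappa> by (intro mult_mono) auto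
      then have "max ?b1 ?b2 < ?T" using n0 by simp
      then show "?b1 < ?T" "?b2 < ?T" by simp_all
    qed
    then show ?thesis by (rule shear_ping_pong.free_pair_shear)
  qed
  then have "eventually (\<lambda>t. free_pair ?U u (\<beta> [^]\<^bsub>?U\<^esub> t)) sequentially"
    by (auto simp: eventually_sequentially)
  then show ?thesis using u_bass \<beta>_bic by blast
qed

end

lemma (in finite_group) exists_free_pair:
  assumes nonab: "\<not> commuting (carrier G)" and co: "coprime (order G) 6"
  shows "\<exists>\<beta>\<in>bicyclic_units G. \<exists>u\<in>bass_cyclic_units G.
    eventually (\<lambda>t::nat. free_pair (units_of ZG) u (\<beta> [^]\<^bsub>units_of ZG\<^esub> t)) sequentially"
proof -
  have odd: "odd (order G)"
  proof
    assume "even (order G)"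
    then have "is_unit (2::nat)" using co by (intro coprime_common_divisor[of "order G" 6]) auto
    then show False by simp
  qed
  obtain A b q a where "inducing A b q a" using inducing_exists[OF odd nonab] by blast
  then have hA: "subgroup A G" "commuting A" and hb: "b \<in> carrier G" and hq: "Factorial_Ring.prime q" "q dvd ord b"
    and hbq: "b [^] q \<in> A" and bn: "\<And>x. x \<in> A \<Longrightarrow> conjugate (inv b) x \<in> A" and a: "a \<in> A"
    and nz: "\<And>i::nat. inv a \<otimes> conjugate (inv b) a \<noteq> (b [^] q) [^] i"
    by (auto simp: inducing_def)
  have As: "x \<in> carrier G" if "x \<in> A" for x using that subgroup_elem[OF hA(1)] by blast
  have qodd: "odd q" using odd hq(2) ord_dvd_group_order[OF hb] dvd_trans by blast
  let ?z = "inv a \<otimes> conjugate (inv b) a" and ?B = "range (\<lambda>i::nat. (b [^] q) [^] i)"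
  have z: "?z \<in> A" using a bn[OF a] subgroup.m_closed[OF hA(1)] subgroup.m_inv_closed[OF hA(1)] by blast
  have B: "subgroup ?B G" "?B \<subseteq> A" using cyclic_subgroup[OF As[OF hbq]] subgroup_pow[OF hA(1) hbq] by auto
  have zB: "?z \<notin> ?B" using nz by blast
  obtain chi where chi: "character_on A chi" "\<forall>x\<in>?B. chi x = 1" "chi ?z \<noteq> 1"
    using character_separates[OF hA B z zB] by blast
  have bqB: "b [^] q \<in> ?B" using As[OF hbq] by (intro image_eqI[of _ _ 1]) auto
  have conj_A: "inv (b [^] (i::int)) \<otimes> x \<otimes> b [^] i \<in> A" if x: "x \<in> A" for i x
  proof -
    have o0: "0 < ord b" by (rule ord_pos[OF hb])
    have "b [^] i = b [^] (int (ord b) * (i div int (ord b)) + i mod int (ord b))" by simp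
    also have "\<dots> = b [^] (i mod int (ord b))"
      using hb by (simp only: int_pow_mult) (simp add: int_pow_pow[symmetric] int_pow_int pow_ord_eq_1)
    also have "\<dots> = b [^] nat (i mod int (ord b))" using o0 by (simp add: int_pow_int[symmetric])
    finally have e: "b [^] i = b [^] nat (i mod int (ord b))" .
    have "A \<subseteq> carrier G" using As by blast
    then have "conjugate (inv (b [^] nat (i mod int (ord b)))) x \<in> A"
      using conjugate_inv_nat_pow[OF hb _ bn x] by blast
    then show ?thesis unfolding e using hb by (simp add: conjugate_def)
  qed
  interpret induced_rep G A b q chi
  proof (intro induced_rep.intro induced_rep_axioms.intro finite_group_axioms)
    show "subgroup A G" "b \<in> carrier G" "b [^] q \<in> A" using hA hb hbq by auto
    show "0 < q" using hq prime_gt_0_nat by blast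
    show "chi (x \<otimes> y) = chi x * chi y" if "x \<in> A" "y \<in> A" for x y
      using chi(1) that by (simp add: character_on_def)
    show "chi \<one> = 1" using chi(1) by (simp add: character_on_def)
    show "chi (b [^] q) = 1" using chi(2) bqB by blast
    show "inv (b [^] i) \<otimes> x \<otimes> b [^] i \<in> A" if "x \<in> A" for i :: int and x by (rule conj_A[OF that])
  qed
  have c0: "conj_chi a 0 = chi a" using As[OF a] by (simp add: conj_chi_def)
  have c1: "conj_chi a 1 = chi a * chi ?z"
  proof -
    have "conjugate (inv b) a = a \<otimes> ?z" using As a bn[OF a] by (simp add: cancel_inv)
    then have "chi (conjugate (inv b) a) = chi a * chi ?z" using chi_mult[OF a z] by simp
    moreover have "conj_chi a 1 = chi (conjugate (inv b) a)"
      using hb by (simp add: conj_chi_def conjugate_def int_pow_1)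
    ultimately show ?thesis by simp
  qed
  have "chi a \<noteq> 0" using conj_chi_inv[OF a, of 0] c0 by auto
  then have ne: "conj_chi a 0 \<noteq> conj_chi a 1" using c0 c1 chi(3) by simp
  have bA: "b \<notin> A"
  proof
    assume "b \<in> A"
    then have ab: "a \<otimes> b = b \<otimes> a" using hA(2) a unfolding commuting_def by blast
    have "conjugate (inv b) a = inv b \<otimes> (a \<otimes> b)" using As[OF a] hb by (simp add: conjugate_def m_assoc)
    then have "conjugate (inv b) a = a" using As[OF a] hb by (simp add: ab cancel_inv)
    then show False using nz[of 0] As[OF a] by simp
  qed
  obtain g i j where "g \<in> A" "bass_rate (conj_chi g i) \<noteq> bass_rate (conj_chi g j)"
    using exists_nonconstant_rate[OF hA(2) qodd co a ne] by blast
  then show ?thesis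
    using free_pair_from_rates[OF hA(2) hq(1) qodd hq(2) co bA] by blast
qed

theorem theorem1p3:
  fixes G :: "('a, 'b) monoid_scheme"
  assumes "group G"
    and "finite (carrier G)"
    and "\<not> comm_group G"
    and "coprime (order G) 6"
  shows "\<exists>\<beta>\<in>bicyclic_units G. \<exists>u\<in>bass_cyclic_units G.
           eventually (\<lambda>t::nat. free_pair (units_of (group_ring G))
             u (\<beta> [^]\<^bsub>units_of (group_ring G)\<^esub> t)) sequentially"
proof -
  interpret group G by fact
  interpret finite_group G by unfold_locales fact
  have "\<not> commuting (carrier G)"
  proof
    assume "commuting (carrier G)"
    then have "comm_group G" by (intro group_comm_groupI) (auto simp: commuting_def)
    then show False using assms(3) by simp
  qed
  then show ?thesis using assms(4) by (rule exists_free_pair)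
qed

end
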